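(* Let $\Gamma$ be a transitive algebraic Lie pseudogroup on a manifold $M$, and let $A_1,A_2\in\mathrm{Diff}_k(M)$ be differential operators on $M$ of constant $\Gamma$-type such that for each of them the stabilizers of the symbol $\sigma_{A_i}$ in the linear isotropy groups are finite. Let $\nabla_1,\nabla_2$ be the Wagner connections associated with $A_1,A_2$, and let $\sigma(A_1),\sigma(A_2)\in\Sigma_k(M)\oplus\Sigma_{k-1}(M)\oplus\cdots\oplus\Sigma_0(M)$ be the total symbols of $A_1,A_2$ with respect to the quantizations associated with $\nabla_1,\nabla_2$ respectively. Then the operators $A_1,A_2$ are $\Gamma$-equivalent if and only if their total symbols $\sigma(A_1),\sigma(A_2)$ are $\Gamma$-equivalent.
   Context: Pseudogroups. A pseudogroup $\Gamma$ on a connected smooth manifold $M$ is a collection of local diffeomorphisms (diffeomorphisms between open sets of $M$) containing $\mathrm{id}_M$, closed under restriction to open subsets, under composition (where defined) and under inverses, and such that a local diffeomorphism belongs to $\Gamma$ if its restrictions to open domains of its domain belong to $\Gamma$. It is transitive if for all $a,b\in M$ there is $\phi\in\Gamma$ with $\phi(a)=b$. Let $D_j(M)\to M$ be the bundle of $j$-jets $[\phi]^j_a$ of local diffeomorphisms, and $G_j=\{[\phi]^j_a:\phi\in\Gamma,\ a\in\mathrm{dom}(\phi)\}\subset D_j(M)$. $\Gamma$ is regular if all $G_j$ are smooth submanifolds and smooth subbundles of $D_j(M)$ over $M$. A regular pseudogroup is a Lie pseudogroup if $\cdots\to G_j\to G_{j-1}\to\cdots\to G_1\to M\times M\to M$ is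 a tower of smooth bundles defining a formally integrable equation, in the sense that the first prolongations satisfy $G_j^{(1)}\subset G_{j+1}$ for all $j\ge1$. It is algebraic if the fibres of $G_j$ are algebraic submanifolds of the fibres of $D_j(M)$ and the composition law is algebraic. Linear isotropy. $G_1(a,b)$ is the set of $1$-jets $[\psi]_{a,b}$ at $a$ of $\psi\in\Gamma$ with $\psi(a)=b$, regarded as linear isomorphisms $T_aM\to T_bM$ and acting on tensors; $G_1(a)=G_1(a,a)$ is the linear isotropy group. Operators. $\mathrm{Diff}_k(M)$ is the module of scalar linear differential operators of order $\le k$, $\Sigma_i(M)$ the module of sections of $S^iTM$, $\Sigma^i(M)$ the module of sections of $S^iT^*M$, and $\sigma_A\in\Sigma_k(M)$ the principal symbol of $A$. $O_a\subset S^kT_aM$ is the $G_1(a)$-orbit of $\sigma_{A,a}$. $A$ has constant $\Gamma$-type if $[\psi]_{a,b}(O_a)=O_b$ for all $a,b\in M$ and all $\psi\in\Gamma$ with $\psi(a)=b$. Wagner connection. An affine connection (torsion allowed) is a $\Gamma$-connection if its parallel transports along paths connecting $a,b\in M$ are elements of $G_1(a,b)$. For an operator $A$ of constant $\Gamma$-type whose symbol has finite stabilizers in the groups $G_1(a)$, the Wagner connection associated with $A$ is the unique affine $\Gamma$-connection on $M$ preserving $\sigma_A$ (the existence and uniqueness is another theorem of the paper). Quantization and total symbol. For an affine connection $\nabla$, let $d^s_\nabla\colon\Sigma^i(M)\to\Sigma^{i+1}(M)$ be the composition of the covariant differential (induced by $\nabla$ on $S^iT^*M$) with symmetrization for $i\ge1$,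 and $d^s_\nabla=d$ on $C^\infty(M)=\Sigma^0(M)$; it is a derivation of the symmetric algebra. For $H\in\Sigma_i(M)$ put $Q(H)(f)=\frac1{i!}\langle H,(d^s_\nabla)^i f\rangle$, where $\langle\cdot,\cdot\rangle\colon\Sigma_i(M)\otimes\Sigma^i(M)\to C^\infty(M)$ is the standard pairing, normalized by $\langle v_1\cdots v_i,\theta^i\rangle=i!\prod_j\theta(v_j)$; then $Q(H)\in\mathrm{Diff}_i(M)$ has symbol $H$. For $A\in\mathrm{Diff}_k(M)$, put $A_{1}=A-Q(\sigma_A)\in\mathrm{Diff}_{k-1}(M)$ and let $\sigma_{k-1}\in\Sigma_{k-1}(M)$ be its symbol, then $A_2=A_1-Q(\sigma_{k-1})\in\mathrm{Diff}_{k-2}(M)$ with symbol $\sigma_{k-2}\in\Sigma_{k-2}(M)$, and so on; this gives uniquely $A=Q(\sigma_A)+\sum_{i=0}^{k-1}Q(\sigma_i)$, and $\sigma(A)=[\sigma_A,\sigma_{k-1},\dots,\sigma_1,\sigma_0]$ is the total symbol of $A$. Equivalence. Two operators (respectively total symbols) on $M$ are $\Gamma$-equivalent if there is a diffeomorphism $\psi\in\Gamma$ of $M$ with $\psi_*(A_1)=A_2$, where $\psi_*(A)=(\psi^{-1})^*\circ A\circ\psi^*$ (respectively $\psi_*$ maps each component of $\sigma(A_1)$ to the corresponding component of $\sigma(A_2)$). *)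

theory Defs
  imports "HOL-Analysis.Analysis"
begin

section \<open>Smooth functions\<close>

text \<open>\<open>S\<close> is meant to be open. The directional derivatives determine the Frechet derivative, so
  continuity of all of them is continuity of the derivative.\<close>

fun Ck_on :: "nat \<Rightarrow> ('a::euclidean_space \<Rightarrow> 'b::real_normed_vector) \<Rightarrow> 'a set \<Rightarrow> bool" where
  "Ck_on 0 f S \<longleftrightarrow> continuous_on S f"
| "Ck_on (Suc k) f S \<longleftrightarrow> (\<forall>x\<in>S. f differentiable (at x)) \<and>
     (\<forall>v. Ck_on k (\<lambda>x. frechet_derivative f (at x) v) S)"

definition smooth_on :: "'a::euclidean_space set \<Rightarrow> ('a \<Rightarrow> 'b::real_normed_vector) \<Rightarrow> bool" where
  "smooth_on S f \<longleftrightarrow> (\<forall>k. Ck_on k f S)"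

text \<open>\<open>pderivs [i\<^sub>1, \<dots>, i\<^sub>r] f\<close> is the iterated partial derivative of \<open>f\<close> in the directions
  \<open>i\<^sub>1, \<dots>, i\<^sub>r\<close>.\<close>

fun pderivs :: "'n::finite list \<Rightarrow> (real^'n \<Rightarrow> 'b::real_normed_vector) \<Rightarrow> real^'n \<Rightarrow> 'b" where
  "pderivs [] f = f"
| "pderivs (i # is) f = (\<lambda>x. frechet_derivative (pderivs is f) (at x) (axis i 1))"


section \<open>Smooth manifolds\<close>

text \<open>The manifold is the whole type \<open>'m\<close>, Hausdorff and second countable by its sort, together
  with an atlas of charts \<open>(U, x)\<close>, of which only the values of \<open>x\<close> on \<open>U\<close> matter.\<close>

type_synonym ('m, 'n) atlas = "('m set \<times> ('m \<Rightarrow> real^'n)) set"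

definition connected_smooth_manifold ::
    "('m::{t2_space,second_countable_topology}, 'n::finite) atlas \<Rightarrow> bool" where
  "connected_smooth_manifold M \<longleftrightarrow>
     connected (UNIV :: 'm set) \<and>
     (\<Union>(U, x)\<in>M. U) = UNIV \<and>
     (\<forall>(U, x)\<in>M. open U \<and> open (x ` U) \<and> inj_on x U \<and>
        continuous_on U x \<and> continuous_on (x ` U) (inv_into U x)) \<and>
     (\<forall>(U, x)\<in>M. \<forall>(V, y)\<in>M. smooth_on (x ` (U \<inter> V)) (y \<circ> inv_into U x))"

definition smooth_funs :: "('m::topological_space, 'n::finite) atlas \<Rightarrow> ('m \<Rightarrow> real) set" where
  "smooth_funs M = {f. \<forall>(U, x)\<in>M. smooth_on (x ` U) (f \<circ> inv_into U x)}"

text \<open>Local diffeomorphisms are partial maps \<open>'m \<rightharpoonup> 'm\<close>, so that each of them determines its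
  domain. The empty map is one of them.\<close>

definition pinv :: "('m \<rightharpoonup> 'm) \<Rightarrow> ('m \<rightharpoonup> 'm)" where
  "pinv \<phi> = (\<lambda>b. if b \<in> ran \<phi> then Some (THE a. \<phi> a = Some b) else None)"

definition smooth_pmap ::
    "('m::topological_space, 'n::finite) atlas \<Rightarrow> ('m \<rightharpoonup> 'm) \<Rightarrow> bool" where
  "smooth_pmap M \<phi> \<longleftrightarrow> open (dom \<phi>) \<and> continuous_on (dom \<phi>) (the \<circ> \<phi>) \<and>
     (\<forall>(U, x)\<in>M. \<forall>(V, y)\<in>M.
        smooth_on (x ` {a \<in> U \<inter> dom \<phi>. the (\<phi> a) \<in> V}) (y \<circ> the \<circ> \<phi> \<circ> inv_into U x))"

definition local_diffeo ::
    "('m::topological_space, 'n::finite) atlas \<Rightarrow> ('m \<rightharpoonup> 'm) \<Rightarrow> bool" where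
  "local_diffeo M \<phi> \<longleftrightarrow> inj_on \<phi> (dom \<phi>) \<and> smooth_pmap M \<phi> \<and> smooth_pmap M (pinv \<phi>)"


section \<open>Pseudogroups\<close>

definition pseudogroup ::
    "('m::topological_space, 'n::finite) atlas \<Rightarrow> ('m \<rightharpoonup> 'm) set \<Rightarrow> bool" where
  "pseudogroup M \<Gamma> \<longleftrightarrow>
     (\<forall>\<phi>\<in>\<Gamma>. local_diffeo M \<phi>) \<and>
     Some \<in> \<Gamma> \<and>
     (\<forall>\<phi>\<in>\<Gamma>. \<forall>U. open U \<longrightarrow> \<phi> |` U \<in> \<Gamma>) \<and>
     (\<forall>\<phi>\<in>\<Gamma>. \<forall>\<psi>\<in>\<Gamma>. \<psi> \<circ>\<^sub>m \<phi> \<in> \<Gamma>) \<and>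
     (\<forall>\<phi>\<in>\<Gamma>. pinv \<phi> \<in> \<Gamma>) \<and>
     (\<forall>\<phi>. local_diffeo M \<phi> \<and>
        (\<exists>\<U>. (\<forall>U\<in>\<U>. open U \<and> \<phi> |` U \<in> \<Gamma>) \<and> dom \<phi> \<subseteq> \<Union>\<U>) \<longrightarrow> \<phi> \<in> \<Gamma>)"

definition transitive_pseudogroup :: "('m \<rightharpoonup> 'm) set \<Rightarrow> bool" where
  "transitive_pseudogroup \<Gamma> \<longleftrightarrow> (\<forall>a b. \<exists>\<phi>\<in>\<Gamma>. \<phi> a = Some b)"


section \<open>Smooth structures on sets of jets\<close>

text \<open>The dimension of the space of \<open>j\<close>-jets depends on \<open>j\<close>, so coordinates on it take values in
  \<open>'i \<Rightarrow> real\<close> with an infinite index type \<open>'i\<close>; for each \<open>j\<close> all but finitely many coordinates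
  vanish identically. Smoothness of real functions on open subsets of \<open>'i \<Rightarrow> real\<close> (with the product
  topology) is existence and continuity of all iterated partial derivatives. A finite dimensional
  coordinate subspace is a retract by a projection, so that this induces the usual notion on it.\<close>

fun Ck_coord :: "nat \<Rightarrow> (('i \<Rightarrow> real) \<Rightarrow> real) \<Rightarrow> ('i \<Rightarrow> real) set \<Rightarrow> bool" where
  "Ck_coord 0 F S \<longleftrightarrow> continuous_on S F"
| "Ck_coord (Suc k) F S \<longleftrightarrow> continuous_on S F \<and>
     (\<forall>i. (\<forall>z\<in>S. (\<lambda>t. F (z(i := t))) differentiable (at (z i))) \<and>
          Ck_coord k (\<lambda>z. deriv (\<lambda>t. F (z(i := t))) (z i)) S)"

definition smooth_coord :: "('i \<Rightarrow> real) set \<Rightarrow> (('i \<Rightarrow> real) \<Rightarrow> real) \<Rightarrow> bool" where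
  "smooth_coord S F \<longleftrightarrow> (\<forall>k. Ck_coord k F S)"

text \<open>A space with local coordinate systems. A coordinate system may be redundant: its image need
  not be open in a coordinate subspace.\<close>

type_synonym ('p, 'i) coords = "('p set \<times> ('p \<Rightarrow> 'i \<Rightarrow> real)) set"

definition prod_coords :: "('p, 'i) coords \<Rightarrow> ('q, 'k) coords \<Rightarrow> ('p \<times> 'q, 'i + 'k) coords" where
  "prod_coords C D = {(U \<times> V, \<lambda>(p, q). case_sum (x p) (y q)) | U x V y. (U, x) \<in> C \<and> (V, y) \<in> D}"

definition std_coords :: "('i \<Rightarrow> real, 'i) coords" where
  "std_coords = {(UNIV, \<lambda>z. z)}"

text \<open>Smoothness of maps between arbitrary subsets is existence of local smooth extensions in
  coordinates.\<close>

definition smooth_map ::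
    "('p, 'i) coords \<Rightarrow> 'p set \<Rightarrow> ('q, 'k) coords \<Rightarrow> 'q set \<Rightarrow> ('p \<Rightarrow> 'q) \<Rightarrow> bool" where
  "smooth_map C S D T f \<longleftrightarrow> f ` S \<subseteq> T \<and>
     (\<forall>p\<in>S. \<forall>(U, x)\<in>C. \<forall>(V, y)\<in>D. p \<in> U \<and> f p \<in> V \<longrightarrow>
        (\<exists>Z F. open Z \<and> x p \<in> Z \<and> (\<forall>k. smooth_coord Z (\<lambda>z. F z k)) \<and>
           (\<forall>q \<in> S \<inter> U. x q \<in> Z \<longrightarrow> f q \<in> V \<and> y (f q) = F (x q))))"

definition diffeo_between ::
    "('p, 'i) coords \<Rightarrow> 'p set \<Rightarrow> ('q, 'k) coords \<Rightarrow> 'q set \<Rightarrow> ('p \<Rightarrow> 'q) \<Rightarrow> bool" where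
  "diffeo_between C S D T f \<longleftrightarrow>
     bij_betw f S T \<and> smooth_map C S D T f \<and> smooth_map D T C S (inv_into S f)"

definition rel_open :: "('p, 'i) coords \<Rightarrow> 'p set \<Rightarrow> 'p set \<Rightarrow> bool" where
  "rel_open C S W \<longleftrightarrow> W \<subseteq> S \<and>
     (\<forall>p\<in>W. \<forall>(U, x)\<in>C. p \<in> U \<longrightarrow>
        (\<exists>Z. open Z \<and> x p \<in> Z \<and> (\<forall>q \<in> S \<inter> U. x q \<in> Z \<longrightarrow> q \<in> W)))"

text \<open>Embedded submanifolds: subsets that are, with the induced smooth structure, locally
  diffeomorphic to open subsets of a fixed Euclidean space
  \<open>{z :: nat \<Rightarrow> real. \<forall>i\<ge>d. z i = 0}\<close>.\<close>

definition submanifold :: "('p, 'i) coords \<Rightarrow> 'p set \<Rightarrow> bool" where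
  "submanifold C S \<longleftrightarrow> (\<exists>d::nat. \<forall>p\<in>S. \<exists>W Z h.
     rel_open C S W \<and> p \<in> W \<and> open (Z :: (nat \<Rightarrow> real) set) \<and>
     diffeo_between C W std_coords (Z \<inter> {z. \<forall>i\<ge>d. z i = 0}) h)"

text \<open>Locally trivial smooth bundles \<open>\<pi> : E \<rightarrow> B\<close>; near \<open>b\<close> the fibre over \<open>b\<close> itself serves as
  typical fibre.\<close>

definition smooth_bundle ::
    "('p, 'i) coords \<Rightarrow> 'p set \<Rightarrow> ('q, 'k) coords \<Rightarrow> 'q set \<Rightarrow> ('p \<Rightarrow> 'q) \<Rightarrow> bool" where
  "smooth_bundle C E D B \<pi> \<longleftrightarrow>
     \<pi> ` E = B \<and> smooth_map C E D B \<pi> \<and>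
     (\<forall>b\<in>B. submanifold C {e \<in> E. \<pi> e = b} \<and>
        (\<exists>W \<tau>. rel_open D B W \<and> b \<in> W \<and>
           diffeo_between C {e \<in> E. \<pi> e \<in> W} (prod_coords D C) (W \<times> {e \<in> E. \<pi> e = b}) \<tau> \<and>
           (\<forall>e\<in>E. \<pi> e \<in> W \<longrightarrow> fst (\<tau> e) = \<pi> e)))"


section \<open>Jets of local diffeomorphisms\<close>

definition jet_eq :: "('m::topological_space, 'n::finite) atlas \<Rightarrow> nat \<Rightarrow> 'm \<Rightarrow>
    ('m \<rightharpoonup> 'm) \<Rightarrow> ('m \<rightharpoonup> 'm) \<Rightarrow> bool" where
  "jet_eq M j a \<phi> \<psi> \<longleftrightarrow> a \<in> dom \<phi> \<and> a \<in> dom \<psi> \<and> \<phi> a = \<psi> a \<and>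
     (\<forall>(U, x)\<in>M. \<forall>(V, y)\<in>M. a \<in> U \<and> the (\<phi> a) \<in> V \<longrightarrow>
        (\<forall>is. length is \<le> j \<longrightarrow>
           pderivs is (y \<circ> the \<circ> \<phi> \<circ> inv_into U x) (x a) =
           pderivs is (y \<circ> the \<circ> \<psi> \<circ> inv_into U x) (x a)))"

text \<open>A jet is its source together with an equivalence class of local diffeomorphisms.\<close>

type_synonym 'm jet = "'m \<times> ('m \<rightharpoonup> 'm) set"

definition jet_of :: "('m::topological_space, 'n::finite) atlas \<Rightarrow> nat \<Rightarrow> ('m \<rightharpoonup> 'm) \<Rightarrow> 'm \<Rightarrow> 'm jet"
  where "jet_of M j \<phi> a = (a, {\<psi>. local_diffeo M \<psi> \<and> jet_eq M j a \<phi> \<psi>})"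

definition jet_rep :: "'m jet \<Rightarrow> ('m \<rightharpoonup> 'm)" where
  "jet_rep \<theta> = (SOME \<phi>. \<phi> \<in> snd \<theta>)"

definition jet_target :: "'m jet \<Rightarrow> 'm" where
  "jet_target \<theta> = the (jet_rep \<theta> (fst \<theta>))"

definition jet_proj :: "('m::topological_space, 'n::finite) atlas \<Rightarrow> nat \<Rightarrow> 'm jet \<Rightarrow> 'm jet" where
  "jet_proj M j \<theta> = jet_of M j (jet_rep \<theta>) (fst \<theta>)"

definition jet_comp ::
    "('m::topological_space, 'n::finite) atlas \<Rightarrow> nat \<Rightarrow> 'm jet \<Rightarrow> 'm jet \<Rightarrow> 'm jet" where
  "jet_comp M j \<theta>' \<theta> = jet_of M j (jet_rep \<theta>' \<circ>\<^sub>m jet_rep \<theta>) (fst \<theta>)"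

definition all_jets :: "('m::topological_space, 'n::finite) atlas \<Rightarrow> nat \<Rightarrow> 'm jet set" where
  "all_jets M j = {jet_of M j \<phi> a | \<phi> a. local_diffeo M \<phi> \<and> a \<in> dom \<phi>}"

definition jets ::
    "('m::topological_space, 'n::finite) atlas \<Rightarrow> ('m \<rightharpoonup> 'm) set \<Rightarrow> nat \<Rightarrow> 'm jet set" where
  "jets M \<Gamma> j = {jet_of M j \<phi> a | \<phi> a. \<phi> \<in> \<Gamma> \<and> a \<in> dom \<phi>}"

definition base_coords :: "('m, 'n::finite) atlas \<Rightarrow> ('m, 'n) coords" where
  "base_coords M = {(U, \<lambda>p i. x p $ i) | U x. (U, x) \<in> M}"

text \<open>Coordinates of a jet: the coordinates of its source, and all partial derivatives up to order
  \<open>j\<close> (starting with the coordinates of the target for the empty list). The derivative along a list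
  and along a permutation of it are listed separately.\<close>

definition jet_coord :: "nat \<Rightarrow> 'm set \<times> ('m \<Rightarrow> real^'n) \<Rightarrow> 'm set \<times> ('m \<Rightarrow> real^'n) \<Rightarrow>
    'm jet \<Rightarrow> ('n::finite + 'n list \<times> 'n) \<Rightarrow> real" where
  "jet_coord j c d \<theta> = (case c of (U, x) \<Rightarrow> case d of (V, y) \<Rightarrow>
     case_sum (\<lambda>i. x (fst \<theta>) $ i)
       (\<lambda>(is, k). if length is \<le> j
          then pderivs is (y \<circ> the \<circ> jet_rep \<theta> \<circ> inv_into U x) (x (fst \<theta>)) $ k else 0))"

definition jet_coords :: "('m::topological_space, 'n::finite) atlas \<Rightarrow> nat \<Rightarrow>
    ('m jet, 'n + 'n list \<times> 'n) coords" where
  "jet_coords M j = {({\<theta> \<in> all_jets M j. fst \<theta> \<in> fst c \<and> jet_target \<theta> \<in> fst d}, jet_coord j c d)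
     | c d. c \<in> M \<and> d \<in> M}"


section \<open>Lie pseudogroups\<close>

definition regular_pseudogroup ::
    "('m::topological_space, 'n::finite) atlas \<Rightarrow> ('m \<rightharpoonup> 'm) set \<Rightarrow> bool" where
  "regular_pseudogroup M \<Gamma> \<longleftrightarrow> pseudogroup M \<Gamma> \<and>
     (\<forall>j. submanifold (jet_coords M j) (jets M \<Gamma> j) \<and>
          smooth_bundle (jet_coords M j) (jets M \<Gamma> j) (base_coords M) UNIV fst)"

text \<open>The first prolongation of \<open>E \<subseteq> D\<^sub>j(M)\<close> is \<open>J\<^sup>1(E) \<inter> D\<^sub>j\<^sub>+\<^sub>1(M)\<close>: the \<open>(j+1)\<close>-jets at \<open>a\<close> of those
  \<open>\<phi>\<close> for which the section \<open>p \<mapsto> [\<phi>]\<^sub>p\<^sup>j\<close> of \<open>D\<^sub>j(M)\<close> has the same 1-jet at \<open>a\<close> as some local section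
  of \<open>E\<close>.\<close>

definition prolongation :: "('m::topological_space, 'n::finite) atlas \<Rightarrow> nat \<Rightarrow> 'm jet set \<Rightarrow>
    'm jet set" where
  "prolongation M j E = {jet_of M (Suc j) \<phi> a | \<phi> a. local_diffeo M \<phi> \<and> a \<in> dom \<phi> \<and>
     (\<exists>W s. open W \<and> a \<in> W \<and> smooth_map (base_coords M) W (jet_coords M j) E s \<and>
        (\<forall>p\<in>W. fst (s p) = p) \<and> s a = jet_of M j \<phi> a \<and>
        (\<forall>(U, x)\<in>M. \<forall>(V, z)\<in>jet_coords M j. a \<in> U \<and> s a \<in> V \<longrightarrow>
           (\<forall>k. frechet_derivative (\<lambda>u. z (s (inv_into U x u)) k) (at (x a)) =
                frechet_derivative (\<lambda>u. z (jet_of M j \<phi> (inv_into U x u)) k) (at (x a)))))}"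

definition lie_pseudogroup ::
    "('m::topological_space, 'n::finite) atlas \<Rightarrow> ('m \<rightharpoonup> 'm) set \<Rightarrow> bool" where
  "lie_pseudogroup M \<Gamma> \<longleftrightarrow> regular_pseudogroup M \<Gamma> \<and>
     smooth_bundle (prod_coords (base_coords M) (base_coords M)) UNIV (base_coords M) UNIV fst \<and>
     smooth_bundle (jet_coords M 1) (jets M \<Gamma> 1) (prod_coords (base_coords M) (base_coords M)) UNIV
       (\<lambda>\<theta>. (fst \<theta>, jet_target \<theta>)) \<and>
     (\<forall>j\<ge>1. smooth_bundle (jet_coords M (Suc j)) (jets M \<Gamma> (Suc j))
               (jet_coords M j) (jets M \<Gamma> j) (jet_proj M j)) \<and>
     (\<forall>j\<ge>1. prolongation M j (jets M \<Gamma> j) \<subseteq> jets M \<Gamma> (Suc j))"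

inductive poly_fun :: "(('i \<Rightarrow> real) \<Rightarrow> real) \<Rightarrow> bool" where
  poly_const: "poly_fun (\<lambda>z. c)"
| poly_coord: "poly_fun (\<lambda>z. z i)"
| poly_add: "poly_fun P \<Longrightarrow> poly_fun Q \<Longrightarrow> poly_fun (\<lambda>z. P z + Q z)"
| poly_mult: "poly_fun P \<Longrightarrow> poly_fun Q \<Longrightarrow> poly_fun (\<lambda>z. P z * Q z)"

definition jets_fibre :: "'m jet set \<Rightarrow> 'm \<Rightarrow> 'm \<Rightarrow> 'm jet set" where
  "jets_fibre E a b = {\<theta> \<in> E. fst \<theta> = a \<and> jet_target \<theta> = b}"

text \<open>It is the fibres over pairs \<open>(a, b) \<in> M \<times> M\<close> that are algebraic varieties: with fixed source and
  target, changes of coordinates act on jet coordinates by polynomial maps.\<close>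

definition algebraic_pseudogroup ::
    "('m::topological_space, 'n::finite) atlas \<Rightarrow> ('m \<rightharpoonup> 'm) set \<Rightarrow> bool" where
  "algebraic_pseudogroup M \<Gamma> \<longleftrightarrow>
     (\<forall>j a b. submanifold (jet_coords M j) (jets_fibre (jets M \<Gamma> j) a b) \<and>
        (\<forall>c\<in>M. \<forall>d\<in>M. a \<in> fst c \<and> b \<in> fst d \<longrightarrow>
           (\<exists>\<P>. finite \<P> \<and> (\<forall>P\<in>\<P>. poly_fun P) \<and>
              jets_fibre (jets M \<Gamma> j) a b =
                {\<theta> \<in> jets_fibre (all_jets M j) a b. \<forall>P\<in>\<P>. P (jet_coord j c d \<theta>) = 0}))) \<and>
     (\<forall>j a b b'. \<forall>c\<in>M. \<forall>d\<in>M. \<forall>d'\<in>M. a \<in> fst c \<and> b \<in> fst d \<and> b' \<in> fst d' \<longrightarrow>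
        (\<exists>P. (\<forall>k. poly_fun (P k)) \<and>
           (\<forall>\<theta> \<in> jets_fibre (jets M \<Gamma> j) a b. \<forall>\<theta>' \<in> jets_fibre (jets M \<Gamma> j) b b'. \<forall>k.
              jet_coord j c d' (jet_comp M j \<theta>' \<theta>) k =
              P k (case_sum (jet_coord j d d' \<theta>') (jet_coord j c d \<theta>)))))"


section \<open>Tangent vectors, tensors and vector fields\<close>

text \<open>\<open>T\<^sub>aM\<close> consists of the derivations at \<open>a\<close> of the algebra of smooth functions, and \<open>T\<^sub>a\<^sup>*M\<close> is its
  dual. \<open>S\<^sup>kT\<^sub>aM\<close> and \<open>S\<^sup>kT\<^sub>a\<^sup>*M\<close> are modelled by symmetric \<open>k\<close>-linear forms on \<open>T\<^sub>a\<^sup>*M\<close> and on \<open>T\<^sub>aM\<close>,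
  applied to lists of length \<open>k\<close>; the product \<open>v\<^sub>1 \<cdots> v\<^sub>k\<close> is the form with value
  \<open>\<xi>(v\<^sub>1) \<cdots> \<xi>(v\<^sub>k)\<close> at \<open>(\<xi>, \<dots>, \<xi>)\<close>. Tangent vectors, covectors and contravariant tensors are extended
  by 0 outside their domains, so that equality is equality of functions.\<close>

type_synonym 'm tvec = "('m \<Rightarrow> real) \<Rightarrow> real"
type_synonym 'm covec = "'m tvec \<Rightarrow> real"
type_synonym 'm vfield = "'m \<Rightarrow> 'm tvec"
type_synonym 'm contra = "'m covec list \<Rightarrow> real"
type_synonym 'm contra_field = "'m \<Rightarrow> 'm contra"
type_synonym 'm cov_field = "'m \<Rightarrow> 'm tvec list \<Rightarrow> real"

definition tangent_space ::
    "('m::topological_space, 'n::finite) atlas \<Rightarrow> 'm \<Rightarrow> 'm tvec set" where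
  "tangent_space M a = {v.
     (\<forall>f\<in>smooth_funs M. \<forall>g\<in>smooth_funs M. v (\<lambda>p. f p + g p) = v f + v g) \<and>
     (\<forall>c. \<forall>f\<in>smooth_funs M. v (\<lambda>p. c * f p) = c * v f) \<and>
     (\<forall>f\<in>smooth_funs M. \<forall>g\<in>smooth_funs M. v (\<lambda>p. f p * g p) = f a * v g + g a * v f) \<and>
     (\<forall>f. f \<notin> smooth_funs M \<longrightarrow> v f = 0)}"

definition cotangent_space ::
    "('m::topological_space, 'n::finite) atlas \<Rightarrow> 'm \<Rightarrow> 'm covec set" where
  "cotangent_space M a = {\<xi>.
     (\<forall>v\<in>tangent_space M a. \<forall>w\<in>tangent_space M a. \<xi> (\<lambda>f. v f + w f) = \<xi> v + \<xi> w) \<and>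
     (\<forall>c. \<forall>v\<in>tangent_space M a. \<xi> (\<lambda>f. c * v f) = c * \<xi> v) \<and>
     (\<forall>v. v \<notin> tangent_space M a \<longrightarrow> \<xi> v = 0)}"

definition dfun ::
    "('m::topological_space, 'n::finite) atlas \<Rightarrow> 'm \<Rightarrow> ('m \<Rightarrow> real) \<Rightarrow> 'm covec" where
  "dfun M a f = (\<lambda>v. if v \<in> tangent_space M a then v f else 0)"

definition vfields :: "('m::topological_space, 'n::finite) atlas \<Rightarrow> 'm vfield set" where
  "vfields M = {X. (\<forall>a. X a \<in> tangent_space M a) \<and>
     (\<forall>f\<in>smooth_funs M. (\<lambda>a. X a f) \<in> smooth_funs M)}"

definition extend ::
    "('m::topological_space, 'n::finite) atlas \<Rightarrow> 'm \<Rightarrow> 'm tvec \<Rightarrow> 'm vfield" where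
  "extend M a v = (SOME X. X \<in> vfields M \<and> X a = v)"

definition is_frame :: "('m::topological_space, 'n::finite) atlas \<Rightarrow> 'm \<Rightarrow> ('n \<Rightarrow> 'm tvec) \<Rightarrow> bool"
  where "is_frame M a e \<longleftrightarrow> (\<forall>i. e i \<in> tangent_space M a) \<and>
     (\<forall>v\<in>tangent_space M a. \<exists>!c::'n \<Rightarrow> real. v = (\<lambda>f. \<Sum>i\<in>UNIV. c i * e i f))"

definition coframe ::
    "('m::topological_space, 'n::finite) atlas \<Rightarrow> 'm \<Rightarrow> ('n \<Rightarrow> 'm tvec) \<Rightarrow> 'n \<Rightarrow> 'm covec" where
  "coframe M a e i = (\<lambda>v. if v \<in> tangent_space M a
     then (THE c::'n \<Rightarrow> real. v = (\<lambda>f. \<Sum>i\<in>UNIV. c i * e i f)) i else 0)"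

text \<open>\<open>k!\<close> times the full contraction of the two symmetric forms. This is the pairing with
  \<open>\<langle>v\<^sub>1 \<cdots> v\<^sub>k, \<theta>\<^sup>k\<rangle> = k! \<theta>(v\<^sub>1) \<cdots> \<theta>(v\<^sub>k)\<close>, and it does not depend on the basis.\<close>

definition pairing :: "('m::topological_space, 'n::finite) atlas \<Rightarrow> nat \<Rightarrow>
    'm contra_field \<Rightarrow> 'm cov_field \<Rightarrow> 'm \<Rightarrow> real" where
  "pairing M k H T a = (let e = (SOME e. is_frame M a e) in
     fact k * (\<Sum>is | length is = k. H a (map (coframe M a e) is) * T a (map e is)))"

text \<open>The differential of a local diffeomorphism; \<open>f \<circ> \<psi>\<close> is only defined near \<open>a\<close> and is replaced
  by a global smooth function with the same germ at \<open>a\<close>.\<close>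

definition differential :: "('m::topological_space, 'n::finite) atlas \<Rightarrow> ('m \<rightharpoonup> 'm) \<Rightarrow> 'm \<Rightarrow>
    'm tvec \<Rightarrow> 'm tvec" where
  "differential M \<psi> a = (\<lambda>v\<in>tangent_space M a. \<lambda>f.
     if f \<in> smooth_funs M
     then v (SOME g. g \<in> smooth_funs M \<and> (\<forall>\<^sub>F p in nhds a. g p = f (the (\<psi> p)))) else 0)"

text \<open>\<open>G\<^sub>1(a, b)\<close> as a set of linear maps \<open>T\<^sub>aM \<rightarrow> T\<^sub>bM\<close>.\<close>

definition linear_isotropy :: "('m::topological_space, 'n::finite) atlas \<Rightarrow> ('m \<rightharpoonup> 'm) set \<Rightarrow>
    'm \<Rightarrow> 'm \<Rightarrow> ('m tvec \<Rightarrow> 'm tvec) set" where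
  "linear_isotropy M \<Gamma> a b = {differential M \<psi> a | \<psi>. \<psi> \<in> \<Gamma> \<and> \<psi> a = Some b}"

text \<open>The tensor in \<open>S\<^sup>kT\<^sub>bM\<close> obtained from \<open>H \<in> S\<^sup>kT\<^sub>aM\<close> by a linear map \<open>g : T\<^sub>aM \<rightarrow> T\<^sub>bM\<close>.\<close>

definition act :: "('m::topological_space, 'n::finite) atlas \<Rightarrow> 'm \<Rightarrow> 'm \<Rightarrow>
    ('m tvec \<Rightarrow> 'm tvec) \<Rightarrow> 'm contra \<Rightarrow> 'm contra" where
  "act M a b g H = (\<lambda>\<eta>s. if set \<eta>s \<subseteq> cotangent_space M b
     then H (map (\<lambda>\<eta> v. if v \<in> tangent_space M a then \<eta> (g v) else 0) \<eta>s) else 0)"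


section \<open>Differential operators and symbols\<close>

type_synonym 'm oper = "('m \<Rightarrow> real) \<Rightarrow> ('m \<Rightarrow> real)"

definition commutator :: "'m oper \<Rightarrow> ('m \<Rightarrow> real) \<Rightarrow> 'm oper" where
  "commutator A f = (\<lambda>g p. A (\<lambda>q. f q * g q) p - f p * A g p)"

definition linear_oper :: "('m::topological_space, 'n::finite) atlas \<Rightarrow> 'm oper \<Rightarrow> bool" where
  "linear_oper M A \<longleftrightarrow>
     (\<forall>f\<in>smooth_funs M. A f \<in> smooth_funs M) \<and>
     (\<forall>f\<in>smooth_funs M. \<forall>g\<in>smooth_funs M. A (\<lambda>p. f p + g p) = (\<lambda>p. A f p + A g p)) \<and>
     (\<forall>c. \<forall>f\<in>smooth_funs M. A (\<lambda>p. c * f p) = (\<lambda>p. c * A f p))"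

text \<open>Scalar linear differential operators of order at most \<open>k\<close>: linear operators on the algebra of
  smooth functions all of whose \<open>(k+1)\<close>-fold commutators with functions vanish.\<close>

fun diff_oper :: "('m::topological_space, 'n::finite) atlas \<Rightarrow> nat \<Rightarrow> 'm oper \<Rightarrow> bool" where
  "diff_oper M 0 A \<longleftrightarrow> linear_oper M A \<and>
     (\<forall>f\<in>smooth_funs M. \<forall>g\<in>smooth_funs M. commutator A f g = (\<lambda>p. 0))"
| "diff_oper M (Suc k) A \<longleftrightarrow> linear_oper M A \<and>
     (\<forall>f\<in>smooth_funs M. diff_oper M k (commutator A f))"

text \<open>The symbol of degree \<open>k\<close> of an operator of order at most \<open>k\<close>:
  \<open>\<sigma>\<^sub>A(d\<^sub>af\<^sub>1, \<dots>, d\<^sub>af\<^sub>k) = 1/k! [\<dots>[A, f\<^sub>1], \<dots>, f\<^sub>k](a)\<close>, where the iterated commutator is a function,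
  acting by multiplication. So \<open>\<sigma>\<^sub>A(d\<^sub>af, \<dots>, d\<^sub>af) = 1/k! A(f\<^sup>k)(a)\<close> if \<open>f(a) = 0\<close>.\<close>

definition symbol :: "('m::topological_space, 'n::finite) atlas \<Rightarrow> nat \<Rightarrow> 'm oper \<Rightarrow>
    'm contra_field" where
  "symbol M k A a = (\<lambda>\<xi>s. if length \<xi>s = k \<and> set \<xi>s \<subseteq> cotangent_space M a
     then fold (\<lambda>\<xi> B. commutator B (SOME f. f \<in> smooth_funs M \<and> dfun M a f = \<xi>)) \<xi>s A (\<lambda>p. 1) a
            / fact k
     else 0)"

definition symbol_orbit :: "('m::topological_space, 'n::finite) atlas \<Rightarrow> ('m \<rightharpoonup> 'm) set \<Rightarrow> nat \<Rightarrow>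
    'm oper \<Rightarrow> 'm \<Rightarrow> 'm contra set" where
  "symbol_orbit M \<Gamma> k A a = {act M a a g (symbol M k A a) | g. g \<in> linear_isotropy M \<Gamma> a a}"

definition constant_type :: "('m::topological_space, 'n::finite) atlas \<Rightarrow> ('m \<rightharpoonup> 'm) set \<Rightarrow> nat \<Rightarrow>
    'm oper \<Rightarrow> bool" where
  "constant_type M \<Gamma> k A \<longleftrightarrow> (\<forall>a b. \<forall>\<psi>\<in>\<Gamma>. \<psi> a = Some b \<longrightarrow>
     act M a b (differential M \<psi> a) ` symbol_orbit M \<Gamma> k A a = symbol_orbit M \<Gamma> k A b)"

definition symbol_stabilizer :: "('m::topological_space, 'n::finite) atlas \<Rightarrow> ('m \<rightharpoonup> 'm) set \<Rightarrow>
    nat \<Rightarrow> 'm oper \<Rightarrow> 'm \<Rightarrow> ('m tvec \<Rightarrow> 'm tvec) set" where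
  "symbol_stabilizer M \<Gamma> k A a =
     {g \<in> linear_isotropy M \<Gamma> a a. act M a a g (symbol M k A a) = symbol M k A a}"


section \<open>Affine connections\<close>

type_synonym 'm conn = "'m vfield \<Rightarrow> 'm vfield \<Rightarrow> 'm vfield"

definition affine_connection :: "('m::topological_space, 'n::finite) atlas \<Rightarrow> 'm conn \<Rightarrow> bool" where
  "affine_connection M nab \<longleftrightarrow>
     (\<forall>X\<in>vfields M. \<forall>Y\<in>vfields M. nab X Y \<in> vfields M) \<and>
     (\<forall>X\<in>vfields M. \<forall>X'\<in>vfields M. \<forall>Y\<in>vfields M.
        nab (\<lambda>a h. X a h + X' a h) Y = (\<lambda>a h. nab X Y a h + nab X' Y a h)) \<and>
     (\<forall>f\<in>smooth_funs M. \<forall>X\<in>vfields M. \<forall>Y\<in>vfields M.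
        nab (\<lambda>a h. f a * X a h) Y = (\<lambda>a h. f a * nab X Y a h)) \<and>
     (\<forall>X\<in>vfields M. \<forall>Y\<in>vfields M. \<forall>Y'\<in>vfields M.
        nab X (\<lambda>a h. Y a h + Y' a h) = (\<lambda>a h. nab X Y a h + nab X Y' a h)) \<and>
     (\<forall>f\<in>smooth_funs M. \<forall>X\<in>vfields M. \<forall>Y\<in>vfields M.
        nab X (\<lambda>a h. f a * Y a h) = (\<lambda>a h. X a f * Y a h + f a * nab X Y a h))"

definition smooth_path :: "('m::topological_space, 'n::finite) atlas \<Rightarrow> (real \<Rightarrow> 'm) \<Rightarrow> bool" where
  "smooth_path M \<gamma> \<longleftrightarrow> (\<exists>S. open S \<and> {0..1} \<subseteq> S \<and> continuous_on S \<gamma> \<and>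
     (\<forall>(U, x)\<in>M. smooth_on {t \<in> S. \<gamma> t \<in> U} (x \<circ> \<gamma>)))"

definition velocity ::
    "('m::topological_space, 'n::finite) atlas \<Rightarrow> (real \<Rightarrow> 'm) \<Rightarrow> real \<Rightarrow> 'm tvec" where
  "velocity M \<gamma> t = (\<lambda>f. if f \<in> smooth_funs M then deriv (f \<circ> \<gamma>) t else 0)"

text \<open>\<open>w\<close> is the covariant derivative at time \<open>t\<close> of the vector field \<open>V\<close> along \<open>\<gamma>\<close>: if
  \<open>V(s) = \<Sum>\<^sub>i c\<^sub>i(s) E\<^sub>i(\<gamma>(s))\<close> for \<open>s\<close> near \<open>t\<close>, then
  \<open>w = \<Sum>\<^sub>i (c\<^sub>i'(t) E\<^sub>i + c\<^sub>i(t) \<nabla>\<^bsub>\<gamma>'(t)\<^esub> E\<^sub>i)(\<gamma>(t))\<close>. Here \<open>\<nabla>\<^bsub>\<gamma>'(t)\<^esub> E\<^sub>i\<close> is computed with any vector field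
  extending \<open>\<gamma>'(t)\<close>.\<close>

definition has_cov_deriv_along :: "('m::topological_space, 'n::finite) atlas \<Rightarrow> 'm conn \<Rightarrow>
    (real \<Rightarrow> 'm) \<Rightarrow> (real \<Rightarrow> 'm tvec) \<Rightarrow> real \<Rightarrow> 'm tvec \<Rightarrow> bool" where
  "has_cov_deriv_along M nab \<gamma> V t w \<longleftrightarrow>
     (\<exists>(E :: 'n \<Rightarrow> 'm vfield) c c'.
        (\<forall>i. E i \<in> vfields M \<and> (c i has_real_derivative c' i) (at t within {0..1})) \<and>
        (\<exists>\<delta>>0. \<forall>s\<in>{0..1}. \<bar>s - t\<bar> < \<delta> \<longrightarrow> V s = (\<lambda>f. \<Sum>i\<in>UNIV. c i s * E i (\<gamma> s) f)) \<and>
        w = (\<lambda>f. \<Sum>i\<in>UNIV. c' i * E i (\<gamma> t) f +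
               c i t * nab (extend M (\<gamma> t) (velocity M \<gamma> t)) (E i) (\<gamma> t) f))"

definition parallel_along :: "('m::topological_space, 'n::finite) atlas \<Rightarrow> 'm conn \<Rightarrow>
    (real \<Rightarrow> 'm) \<Rightarrow> (real \<Rightarrow> 'm tvec) \<Rightarrow> bool" where
  "parallel_along M nab \<gamma> V \<longleftrightarrow> (\<forall>t\<in>{0..1}.
     V t \<in> tangent_space M (\<gamma> t) \<and> has_cov_deriv_along M nab \<gamma> V t (\<lambda>f. 0))"

definition parallel_transport :: "('m::topological_space, 'n::finite) atlas \<Rightarrow> 'm conn \<Rightarrow>
    (real \<Rightarrow> 'm) \<Rightarrow> 'm tvec \<Rightarrow> 'm tvec" where
  "parallel_transport M nab \<gamma> = (\<lambda>v\<in>tangent_space M (\<gamma> 0).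
     THE w. \<exists>V. parallel_along M nab \<gamma> V \<and> V 0 = v \<and> V 1 = w)"

definition gamma_connection :: "('m::topological_space, 'n::finite) atlas \<Rightarrow> ('m \<rightharpoonup> 'm) set \<Rightarrow>
    'm conn \<Rightarrow> bool" where
  "gamma_connection M \<Gamma> nab \<longleftrightarrow> affine_connection M nab \<and>
     (\<forall>\<gamma>. smooth_path M \<gamma> \<longrightarrow> parallel_transport M nab \<gamma> \<in> linear_isotropy M \<Gamma> (\<gamma> 0) (\<gamma> 1))"

definition preserves :: "('m::topological_space, 'n::finite) atlas \<Rightarrow> 'm conn \<Rightarrow>
    'm contra_field \<Rightarrow> bool" where
  "preserves M nab H \<longleftrightarrow> (\<forall>\<gamma>. smooth_path M \<gamma> \<longrightarrow>
     act M (\<gamma> 0) (\<gamma> 1) (parallel_transport M nab \<gamma>) (H (\<gamma> 0)) = H (\<gamma> 1))"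

definition wagner_connection :: "('m::topological_space, 'n::finite) atlas \<Rightarrow> ('m \<rightharpoonup> 'm) set \<Rightarrow>
    nat \<Rightarrow> 'm oper \<Rightarrow> 'm conn \<Rightarrow> bool" where
  "wagner_connection M \<Gamma> k A nab \<longleftrightarrow>
     gamma_connection M \<Gamma> nab \<and> preserves M nab (symbol M k A) \<and>
     (\<forall>nab'. gamma_connection M \<Gamma> nab' \<and> preserves M nab' (symbol M k A) \<longrightarrow>
        (\<forall>X\<in>vfields M. \<forall>Y\<in>vfields M. nab' X Y = nab X Y))"


section \<open>Quantization and total symbols\<close>

text \<open>The covariant differential of a covariant tensor field, with the direction of differentiation
  as first argument:
  \<open>(\<nabla>T)(v\<^sub>0, v\<^sub>1, \<dots>) = (\<nabla>\<^bsub>X\<^esub>T)(Y\<^sub>1, \<dots>) = X(T(Y\<^sub>1, \<dots>)) - \<Sum>\<^sub>j T(\<dots>, \<nabla>\<^bsub>X\<^esub>Y\<^sub>j, \<dots>)\<close> for any vector fields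
  \<open>X\<close>, \<open>Y\<^sub>j\<close> extending the vectors \<open>v\<^sub>0\<close>, \<open>v\<^sub>j\<close>.\<close>

definition cov_differential :: "('m::topological_space, 'n::finite) atlas \<Rightarrow> 'm conn \<Rightarrow>
    'm cov_field \<Rightarrow> 'm cov_field" where
  "cov_differential M nab T a ws = (case ws of [] \<Rightarrow> 0 | v # vs \<Rightarrow>
     (let X = extend M a v; Ys = map (extend M a) vs in
        X a (\<lambda>p. T p (map (\<lambda>Y. Y p) Ys)) -
        (\<Sum>j<length vs. T a (vs[j := nab X (Ys ! j) a]))))"

definition symmetrization :: "'m cov_field \<Rightarrow> 'm cov_field" where
  "symmetrization T a vs =
     (\<Sum>\<pi> | \<pi> permutes {..<length vs}. T a (permute_list \<pi> vs)) / fact (length vs)"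

definition sym_deriv :: "('m::topological_space, 'n::finite) atlas \<Rightarrow> 'm conn \<Rightarrow>
    'm cov_field \<Rightarrow> 'm cov_field" where
  "sym_deriv M nab T = symmetrization (cov_differential M nab T)"

text \<open>A function as a tensor field of degree 0. On such fields \<^const>\<open>sym_deriv\<close> is the ordinary
  differential.\<close>

definition fun_field :: "('m \<Rightarrow> real) \<Rightarrow> 'm cov_field" where
  "fun_field f a vs = (if vs = [] then f a else 0)"

definition quantization :: "('m::topological_space, 'n::finite) atlas \<Rightarrow> 'm conn \<Rightarrow> nat \<Rightarrow>
    'm contra_field \<Rightarrow> 'm oper" where
  "quantization M nab i H f = (\<lambda>a.
     pairing M i H ((sym_deriv M nab ^^ i) (fun_field f)) a / fact i)"

text \<open>The list \<open>[\<sigma>\<^sub>A, \<sigma>\<^sub>k\<^sub>-\<^sub>1, \<dots>, \<sigma>\<^sub>0]\<close>.\<close>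

fun total_symbol :: "('m::topological_space, 'n::finite) atlas \<Rightarrow> 'm conn \<Rightarrow> nat \<Rightarrow> 'm oper \<Rightarrow>
    'm contra_field list" where
  "total_symbol M nab 0 A = [symbol M 0 A]"
| "total_symbol M nab (Suc k) A = symbol M (Suc k) A #
     total_symbol M nab k
       (\<lambda>f p. A f p - quantization M nab (Suc k) (symbol M (Suc k) A) f p)"


section \<open>Equivalence\<close>

definition global_diffeos :: "('m \<rightharpoonup> 'm) set \<Rightarrow> ('m \<rightharpoonup> 'm) set" where
  "global_diffeos \<Gamma> = {\<psi> \<in> \<Gamma>. dom \<psi> = UNIV \<and> ran \<psi> = UNIV}"

definition push_oper :: "('m \<rightharpoonup> 'm) \<Rightarrow> 'm oper \<Rightarrow> 'm oper" where
  "push_oper \<psi> A f = A (f \<circ> (the \<circ> \<psi>)) \<circ> (the \<circ> pinv \<psi>)"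

definition push_field :: "('m::topological_space, 'n::finite) atlas \<Rightarrow> ('m \<rightharpoonup> 'm) \<Rightarrow>
    'm contra_field \<Rightarrow> 'm contra_field" where
  "push_field M \<psi> H b = (let a = the (pinv \<psi> b) in act M a b (differential M \<psi> a) (H a))"

definition equiv_opers :: "('m::topological_space, 'n::finite) atlas \<Rightarrow> ('m \<rightharpoonup> 'm) set \<Rightarrow>
    'm oper \<Rightarrow> 'm oper \<Rightarrow> bool" where
  "equiv_opers M \<Gamma> A1 A2 \<longleftrightarrow>
     (\<exists>\<psi>\<in>global_diffeos \<Gamma>. \<forall>f\<in>smooth_funs M. push_oper \<psi> A1 f = A2 f)"

definition equiv_total_symbols :: "('m::topological_space, 'n::finite) atlas \<Rightarrow> ('m \<rightharpoonup> 'm) set \<Rightarrow>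
    'm contra_field list \<Rightarrow> 'm contra_field list \<Rightarrow> bool" where
  "equiv_total_symbols M \<Gamma> S1 S2 \<longleftrightarrow>
     (\<exists>\<psi>\<in>global_diffeos \<Gamma>. map (push_field M \<psi>) S1 = S2)"

end

theory Submission
  imports Defs
begin

text \<open>A diffeomorphism \<open>\<psi> \<in> \<Gamma>\<close> carries the Wagner connection of \<open>A\<^sub>1\<close> to a \<open>\<Gamma>\<close>-connection that preserves
  \<open>\<psi>\<^sub>* \<sigma>\<^bsub>A\<^sub>1\<^esub>\<close>: parallel transport is natural (it exists and is unique because it solves a linear ODE),
  and \<open>\<Gamma>\<close> is closed under conjugation. If \<open>\<psi>\<^sub>* \<sigma>\<^bsub>A\<^sub>1\<^esub> = \<sigma>\<^bsub>A\<^sub>2\<^esub>\<close>, which follows from either side of the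
  equivalence, then uniqueness of the Wagner connection gives \<open>\<psi>\<^sub>* \<nabla>\<^sub>1 = \<nabla>\<^sub>2\<close>. Quantization and symbols
  are natural as well, so \<open>\<psi>\<^sub>*\<close> maps the total symbol of \<open>A\<^sub>1\<close> to that of \<open>\<psi>\<^sub>* A\<^sub>1\<close> with respect to \<open>\<nabla>\<^sub>2\<close>.
  Finally, for a fixed connection an operator is determined by its total symbol. The naturality of
  the lower components needs that \<open>A - Q(\<sigma>\<^sub>A)\<close> really has smaller order, i.e. that \<open>Q(H)\<close> is a
  differential operator with symbol \<open>H\<close>.\<close>

section \<open>Smooth functions on open sets\<close>

text \<open>Two obstacles shape the development. Tangent vectors are derivations of the algebra of
  global functions, so nothing can be computed in a chart directly: bump functions turn local data
  into global functions and fields, and Hadamard's lemma shows that a derivation is determined by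
  its values on coordinates. The result is packaged as \<open>local_frame\<close>, through which the
  later local computations go. The other obstacle is that \<open>parallel_transport\<close> is a
  definite description. Its naturality needs a parallel field for every initial vector, so that
  there is something to push forward, and uniqueness, so that the endpoint of the pushed field is
  the transport. The linear ODE is solved on short intervals inside one frame, and bisection of
  \<open>{0..1}\<close> covers the path. That Q(H) has symbol H is a statement about commutators of
  full length only. There the correction terms of the connection vanish because their order is too
  small, so torsion and curvature never enter. The k-th iterate of d^s contributes k! equal terms,
  which compensate the 1/k! in \<open>symbol\<close>.\<close>

lemma Ck_on_subset: "Ck_on k f S \<Longrightarrow> T \<subseteq> S \<Longrightarrow> Ck_on k f T"
  by (induction k arbitrary: f) (auto intro: continuous_on_subset)

lemma Ck_on_imp_continuous_on: "Ck_on k f S \<Longrightarrow> continuous_on S f"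
  by (cases k) (auto intro!: continuous_at_imp_continuous_on differentiable_imp_continuous_within)

lemma Ck_on_SucD: "Ck_on (Suc k) f S \<Longrightarrow> Ck_on k f S"
proof (induction k arbitrary: f)
  case 0
  then show ?case using Ck_on_imp_continuous_on[OF 0] by simp
next
  case (Suc k)
  then show ?case by simp
qed

text \<open>Agreement is required on an open set, since the derivatives in \<open>Ck_on\<close> are
  taken in the full space and see a neighbourhood of each point.\<close>

lemma Ck_on_cong:
  assumes "open S" "\<And>x. x \<in> S \<Longrightarrow> f x = g x" "Ck_on k f S"
  shows "Ck_on k g S"
  using assms(2,3)
proof (induction k arbitrary: f g)
  case 0
  then show ?case using continuous_on_cong[of S S f g] by simp
next
  case (Suc k)
  have der: "(g has_derivative frechet_derivative f (at x)) (at x)" if "x \<in> S" for x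
    using Suc.prems that assms(1) has_derivative_transform_within_open[of f _ x UNIV S g]
    by (auto simp: frechet_derivative_works)
  then have eq: "frechet_derivative f (at x) = frechet_derivative g (at x)" if "x \<in> S" for x
    using that frechet_derivative_at by blast
  have "g differentiable at x" if "x \<in> S" for x
    using der[OF that] by (auto simp: differentiable_def)
  moreover have "Ck_on k (\<lambda>x. frechet_derivative g (at x) v) S" for v
    by (rule Suc.IH[of "\<lambda>x. frechet_derivative f (at x) v"]) (use eq Suc.prems in auto)
  ultimately show ?case by simp
qed

text \<open>Lets an explicit formula \<open>f'\<close> stand for the derivative in place of
  \<open>frechet_derivative\<close>; most closure properties below are inductions with this
  rule.\<close>

lemma Ck_on_SucI:
  assumes "open S" "\<And>x. x \<in> S \<Longrightarrow> (f has_derivative f' x) (at x)"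
    and "\<And>v. Ck_on k (\<lambda>x. f' x v) S"
  shows "Ck_on (Suc k) f S"
proof -
  have "frechet_derivative f (at x) = f' x" if "x \<in> S" for x
    using assms(2)[OF that] by (simp add: frechet_derivative_at[symmetric])
  then have "Ck_on k (\<lambda>x. frechet_derivative f (at x) v) S" for v
    by (intro Ck_on_cong[OF assms(1) _ assms(3)[of v]]) auto
  then show ?thesis using assms(2) by (auto simp: differentiable_def)
qed

lemma Ck_on_SucE:
  assumes "Ck_on (Suc k) f S" "x \<in> S"
  shows "(f has_derivative frechet_derivative f (at x)) (at x)"
  using assms by (auto simp: frechet_derivative_works)

lemma Ck_on_local:
  assumes "\<And>x. x \<in> S \<Longrightarrow> \<exists>T. open T \<and> x \<in> T \<and> Ck_on k f T"
  shows "Ck_on k f S"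
  using assms
proof (induction k arbitrary: f)
  case 0
  have "isCont f x" if "x \<in> S" for x
    using 0[OF that] continuous_on_eq_continuous_at by auto
  then show ?case by (simp add: continuous_at_imp_continuous_on)
next
  case (Suc k)
  have "f differentiable at x" if "x \<in> S" for x using Suc.prems[OF that] by auto
  moreover have "Ck_on k (\<lambda>x. frechet_derivative f (at x) v) S" for v
    by (rule Suc.IH) (use Suc.prems in fastforce)
  ultimately show ?case by simp
qed

lemma Ck_on_const: "open S \<Longrightarrow> Ck_on k (\<lambda>x. c) S"
proof (induction k arbitrary: c)
  case (Suc k)
  show ?case by (rule Ck_on_SucI[where f' = "\<lambda>x v. 0"]) (use Suc in auto)
qed simp

lemma Ck_on_linear:
  assumes "bounded_linear h" "open S" "Ck_on k f S"
  shows "Ck_on k (\<lambda>x. h (f x)) S"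
  using assms(3)
proof (induction k arbitrary: f)
  case 0
  then show ?case using bounded_linear.continuous_on[OF assms(1)] by simp
next
  case (Suc k)
  show ?case
  proof (rule Ck_on_SucI[where f' = "\<lambda>x v. h (frechet_derivative f (at x) v)"])
    show "((\<lambda>x. h (f x)) has_derivative (\<lambda>v. h (frechet_derivative f (at x) v))) (at x)"
      if "x \<in> S" for x
      using Ck_on_SucE[OF Suc.prems that] bounded_linear.has_derivative[OF assms(1)] by blast
  qed (use assms Suc in auto)
qed

lemma Ck_on_add:
  assumes "open S" "Ck_on k f S" "Ck_on k g S"
  shows "Ck_on k (\<lambda>x. f x + g x) S"
  using assms(2,3)
proof (induction k arbitrary: f g)
  case (Suc k)
  show ?case
  proof (rule Ck_on_SucI)
    show "((\<lambda>x. f x + g x) has_derivative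
        (\<lambda>v. frechet_derivative f (at x) v + frechet_derivative g (at x) v)) (at x)" if "x \<in> S"
            for x
      using Ck_on_SucE[OF Suc.prems(1) that] Ck_on_SucE[OF Suc.prems(2) that]
          by (rule has_derivative_add)
  qed (use assms Suc in auto)
qed (simp add: continuous_on_add)

lemma (in bounded_bilinear) Ck_on_bilinear:
  assumes "open S" "Ck_on k f S" "Ck_on k g S"
  shows "Ck_on k (\<lambda>x. prod (f x) (g x)) S"
  using assms(2,3)
proof (induction k arbitrary: f g)
  case 0
  then show ?case by (simp add: continuous_on)
next
  case (Suc k)
  show ?case
  proof (rule Ck_on_SucI[where f' = "\<lambda>x v. prod (f x) (frechet_derivative g (at x) v) +
        prod (frechet_derivative f (at x) v) (g x)"])
    show "((\<lambda>x. prod (f x) (g x)) has_derivative (\<lambda>v. prod (f x) (frechet_derivative g (at x) v) +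
        prod (frechet_derivative f (at x) v) (g x))) (at x)" if "x \<in> S" for x
      using Ck_on_SucE[OF Suc.prems(1) that] Ck_on_SucE[OF Suc.prems(2) that] FDERIV by blast
    show "Ck_on k (\<lambda>x. prod (f x) (frechet_derivative g (at x) v) +
        prod (frechet_derivative f (at x) v) (g x)) S" for v
      using Suc.prems Ck_on_SucD[OF Suc.prems(1)] Ck_on_SucD[OF Suc.prems(2)]
      by (intro Ck_on_add Suc.IH assms(1)) auto
  qed (rule assms)
qed

lemma Ck_on_sum:
  assumes "open S" "\<And>i. i \<in> I \<Longrightarrow> Ck_on k (f i) S"
  shows "Ck_on k (\<lambda>x. \<Sum>i\<in>I. f i x) S"
  using assms(2)
  by (induction I rule: infinite_finite_induct) (auto intro!: Ck_on_add Ck_on_const assms(1))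

text \<open>The direction \<open>frechet_derivative f (at x) v\<close> in which \<open>g\<close> is
  differentiated moves with \<open>x\<close>, while \<open>Ck_on\<close> controls fixed directions
  only. Expanding it along \<open>Basis\<close> leaves derivatives of \<open>g\<close> in constant
  directions, to which the induction hypothesis applies.\<close>

lemma Ck_on_compose:
  fixes f :: "'a::euclidean_space \<Rightarrow> 'b::euclidean_space"
  assumes "open S" "open T" "f ` S \<subseteq> T" "Ck_on k f S" "Ck_on k g T"
  shows "Ck_on k (\<lambda>x. g (f x)) S"
  using assms(3-5)
proof (induction k arbitrary: g)
  case 0
  then show ?case using continuous_on_compose2[of T g S f] by simp
next
  case (Suc k)
  let ?f' = "\<lambda>x v. \<Sum>b\<in>Basis. (frechet_derivative f (at x) v \<bullet> b) *\<^sub>R frechet_derivative g (at (f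
      x)) b"
  show ?case
  proof (rule Ck_on_SucI[where f' = ?f'])
    show "((\<lambda>x. g (f x)) has_derivative ?f' x) (at x)" if x: "x \<in> S" for x
    proof -
      have g: "(g has_derivative frechet_derivative g (at (f x))) (at (f x))"
        using x Suc.prems by (intro Ck_on_SucE) auto
      then interpret g: bounded_linear "frechet_derivative g (at (f x))"
        by (rule has_derivative_bounded_linear)
      have "((\<lambda>x. g (f x)) has_derivative
          (\<lambda>v. frechet_derivative g (at (f x)) (frechet_derivative f (at x) v))) (at x)"
        using diff_chain_at[OF Ck_on_SucE[OF Suc.prems(2) x] g] by (simp add: comp_def)
      moreover have "frechet_derivative g (at (f x)) (frechet_derivative f (at x) v) = ?f' x v"
          for v
        by (subst euclidean_representation[symmetric, of "frechet_derivative f (at x) v"])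
          (simp only: g.sum g.scaleR)
      ultimately show ?thesis by (simp only:)
    qed
    show "Ck_on k (\<lambda>x. ?f' x v) S" for v
    proof (intro Ck_on_sum bounded_bilinear.Ck_on_bilinear[OF bounded_bilinear_scaleR] assms(1))
      show "Ck_on k (\<lambda>x. frechet_derivative f (at x) v \<bullet> b) S" for b
        by (rule Ck_on_linear[OF bounded_linear_inner_left assms(1)]) (use Suc.prems in auto)
      show "Ck_on k (\<lambda>x. frechet_derivative g (at (f x)) b) S" for b
        by (rule Suc.IH[of "\<lambda>y. frechet_derivative g (at y) b"]) (use Suc.prems Ck_on_SucD[OF
            Suc.prems(2)] in auto)
    qed
  qed (rule assms)
qed

lemma smooth_on_subset: "smooth_on S f \<Longrightarrow> T \<subseteq> S \<Longrightarrow> smooth_on T f"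
  unfolding smooth_on_def using Ck_on_subset by blast

lemma smooth_on_cong:
  "smooth_on S f \<Longrightarrow> open S \<Longrightarrow> (\<And>x. x \<in> S \<Longrightarrow> f x = g x) \<Longrightarrow> smooth_on S g"
  unfolding smooth_on_def using Ck_on_cong by blast

lemma smooth_on_local:
  "(\<And>x. x \<in> S \<Longrightarrow> \<exists>T. open T \<and> x \<in> T \<and> smooth_on T f) \<Longrightarrow> smooth_on S f"
  unfolding smooth_on_def by (intro allI Ck_on_local) metis

lemma smooth_on_const: "open S \<Longrightarrow> smooth_on S (\<lambda>x. c)"
  unfolding smooth_on_def using Ck_on_const by blast

lemma smooth_on_linear: "bounded_linear h \<Longrightarrow> open S \<Longrightarrow> smooth_on S f \<Longrightarrow> smooth_on S (\<lambda>x. h (f x))"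
  unfolding smooth_on_def using Ck_on_linear by blast

lemma smooth_on_add:
  "open S \<Longrightarrow> smooth_on S f \<Longrightarrow> smooth_on S g \<Longrightarrow> smooth_on S (\<lambda>x. f x + g x)"
  unfolding smooth_on_def using Ck_on_add by blast

lemma smooth_on_mult:
  fixes f g :: "'a::euclidean_space \<Rightarrow> real"
  shows "open S \<Longrightarrow> smooth_on S f \<Longrightarrow> smooth_on S g \<Longrightarrow> smooth_on S (\<lambda>x. f x * g x)"
  unfolding smooth_on_def using bounded_bilinear.Ck_on_bilinear[OF bounded_bilinear_mult] by blast

lemma smooth_on_sum:
  "open S \<Longrightarrow> (\<And>i. i \<in> I \<Longrightarrow> smooth_on S (f i)) \<Longrightarrow> smooth_on S (\<lambda>x. \<Sum>i\<in>I. f i x)"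
  unfolding smooth_on_def by (intro allI Ck_on_sum) auto

lemma smooth_on_compose:
  fixes f :: "'a::euclidean_space \<Rightarrow> 'b::euclidean_space"
  shows "open S \<Longrightarrow> open T \<Longrightarrow> f ` S \<subseteq> T \<Longrightarrow> smooth_on S f \<Longrightarrow> smooth_on T g \<Longrightarrow>
    smooth_on S (\<lambda>x. g (f x))"
  unfolding smooth_on_def using Ck_on_compose by blast

lemma Ck_on_id: "open S \<Longrightarrow> Ck_on k (\<lambda>x. x) S"
proof (cases k)
  case (Suc m)
  assume "open S"
  then show ?thesis unfolding Suc
    by (intro Ck_on_SucI[where f' = "\<lambda>x v. v"]) (auto intro: Ck_on_const)
qed simp

lemma smooth_on_id: "open S \<Longrightarrow> smooth_on S (\<lambda>x. x)"
  unfolding smooth_on_def using Ck_on_id by blast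

lemma smooth_on_frechet:
  "smooth_on S f \<Longrightarrow> smooth_on S (\<lambda>x. frechet_derivative f (at x) v)"
  unfolding smooth_on_def using Ck_on.simps(2) by blast

lemma smooth_on_has_derivative:
  "smooth_on S f \<Longrightarrow> x \<in> S \<Longrightarrow> (f has_derivative frechet_derivative f (at x)) (at x)"
  unfolding smooth_on_def using Ck_on_SucE by blast

lemma smooth_on_imp_continuous_on: "smooth_on S f \<Longrightarrow> continuous_on S f"
  unfolding smooth_on_def using Ck_on_imp_continuous_on by blast

lemma smooth_on_SucI:
  assumes "open S" "\<And>x. x \<in> S \<Longrightarrow> (f has_derivative f' x) (at x)" "\<And>v. smooth_on S (\<lambda>x. f' x v)"
  shows "smooth_on S f"
  unfolding smooth_on_def
proof
  fix k
  have "Ck_on (Suc k) f S" using assms by (intro Ck_on_SucI) (auto simp: smooth_on_def)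
  then show "Ck_on k f S" by (rule Ck_on_SucD)
qed

section \<open>Bump functions\<close>

text \<open>The parameter \<open>m\<close> makes the family closed under differentiation up to
  linear combinations, so that one induction shows exp(-1/t), extended by 0, to be smooth.\<close>

definition flat :: "nat \<Rightarrow> real \<Rightarrow> real" where
  "flat m t = (if t > 0 then exp (- 1 / t) / t ^ m else 0)"

lemma flat_tendsto_0: "(flat m \<longlongrightarrow> 0) (at 0)"
proof (rule filterlim_split_at)
  show "(flat m \<longlongrightarrow> 0) (at_left 0)"
    by (rule tendsto_eventually) (auto simp: flat_def eventually_at_filter)
  have "((\<lambda>x. inverse x ^ m / exp (inverse x)) \<longlongrightarrow> (0::real)) (at_right 0)"
    by (rule filterlim_compose[OF tendsto_power_div_exp_0 filterlim_inverse_at_top_right])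
  moreover have "\<forall>\<^sub>F x in at_right 0. inverse x ^ m / exp (inverse x) = flat m x"
    by (auto simp: flat_def eventually_at_filter exp_minus field_simps)
  ultimately show "(flat m \<longlongrightarrow> 0) (at_right 0)"
    by (rule Lim_transform_eventually)
qed

lemma flat_has_derivative:
  "(flat m has_real_derivative (flat (m + 2) t - real m * flat (m + 1) t)) (at t)"
proof -
  consider "t < 0" | "t = 0" | "t > 0" by linarith
  then show ?thesis
  proof cases
    case 1
    have "((\<lambda>x. 0) has_real_derivative 0) (at t)" by simp
    then have "(flat m has_real_derivative 0) (at t)"
      by (rule has_field_derivative_transform_within_open[of _ _ _ "{..<0}"]) (use 1 in \<open>auto
          simp: flat_def\<close>)
    then show ?thesis using 1 by (simp add: flat_def)
  next
    case 2
    \<comment> \<open>At 0 the difference quotient of \<open>flat m\<close> is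
      \<open>flat (m + 1)\<close>, so one limit serves all \<open>m\<close>.\<close>
    have "((\<lambda>h. (flat m (0 + h) - flat m 0) / h) \<longlongrightarrow> 0) (at 0)"
    proof (rule Lim_transform_eventually[OF flat_tendsto_0[of "m + 1"]])
      show "\<forall>\<^sub>F h in at 0. flat (m + 1) h = (flat m (0 + h) - flat m 0) / h"
        by (auto simp: flat_def eventually_at_filter)
    qed
    then show ?thesis using 2 by (simp add: DERIV_def flat_def)
  next
    case 3
    have "((\<lambda>x. exp (- 1 / x) / x ^ m) has_real_derivative
        (flat (m + 2) t - real m * flat (m + 1) t)) (at t)"
      using 3
      apply (auto intro!: derivative_eq_intros simp: flat_def field_simps power2_eq_square)
      apply (cases m; auto simp: field_simps)
      done
    then show ?thesis
      by (rule has_field_derivative_transform_within_open[of _ _ _ "{0<..}"]) (use 3 in \<open>auto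
          simp: flat_def\<close>)
  qed
qed

lemma Ck_on_flat: "Ck_on k (flat m) UNIV"
proof (induction k arbitrary: m)
  case 0
  then show ?case
    using DERIV_isCont[OF flat_has_derivative] by (simp add: continuous_at_imp_continuous_on)
next
  case (Suc k)
  have *: "Ck_on k (\<lambda>x. (flat (m + 2) x + (- real m) * flat (m + 1) x) * v) UNIV" for v
    by (intro bounded_bilinear.Ck_on_bilinear[OF bounded_bilinear_mult] Ck_on_add Ck_on_const Suc
        open_UNIV)
  show ?case
  proof (rule Ck_on_SucI)
    show "(flat m has_derivative (\<lambda>v. (flat (m + 2) x + (- real m) * flat (m + 1) x) * v)) (at x)"
        for x
      using flat_has_derivative[of m x] by (simp add: has_field_derivative_def)
  qed (use * in auto)
qed

lemma smooth_on_flat: "smooth_on UNIV (flat m)"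
  unfolding smooth_on_def using Ck_on_flat by blast

text \<open>\<open>b\<close> is positive exactly inside the ball of radius \<open>r\<close>, and
  \<open>c\<close> is half its value at the centre. As \<open>flat\<close> vanishes at negative
  arguments, \<open>\<beta>\<close> is 1 wherever \<open>b\<close> exceeds \<open>c\<close>, which
  is a neighbourhood of \<open>a\<close>. Where \<open>b\<close> is 0, the quotient is 1 and
  \<open>\<beta>\<close> is 0.\<close>

lemma euclidean_bump:
  fixes a :: "'a::euclidean_space"
  assumes "r > 0"
  obtains \<beta> :: "'a \<Rightarrow> real" and \<epsilon> where "smooth_on UNIV \<beta>" "\<epsilon> > 0"
    "\<And>x. x \<in> ball a \<epsilon> \<Longrightarrow> \<beta> x = 1" "\<And>x. dist a x \<ge> r \<Longrightarrow> \<beta> x = 0"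
proof -
  define b where "b x = flat 0 (r\<^sup>2 - (x - a) \<bullet> (x - a))" for x
  define c where "c = b a / 2"
  define \<beta> where "\<beta> x = 1 - flat 0 (c - b x) / flat 0 c" for x
  have "smooth_on UNIV (\<lambda>x. (x - a) \<bullet> (x - a))"
  proof (rule smooth_on_SucI)
    show "((\<lambda>x. (x - a) \<bullet> (x - a)) has_derivative (\<lambda>v. 2 * (v \<bullet> (x + (- a))))) (at x)" for x
      by (auto intro!: derivative_eq_intros simp: inner_commute)
    show "smooth_on UNIV (\<lambda>x. 2 * (v \<bullet> (x + (- a))))" for v
      by (intro smooth_on_mult smooth_on_const smooth_on_linear[OF bounded_linear_inner_right]
          smooth_on_add smooth_on_id open_UNIV)
  qed simp
  then have "smooth_on UNIV (\<lambda>x. r\<^sup>2 + (- 1) * ((x - a) \<bullet> (x - a)))"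
    by (intro smooth_on_add smooth_on_mult smooth_on_const) auto
  then have "smooth_on UNIV (\<lambda>x. flat 0 (r\<^sup>2 + (- 1) * ((x - a) \<bullet> (x - a))))"
    by (rule smooth_on_compose[rotated 3]) (auto intro: smooth_on_flat)
  then have b: "smooth_on UNIV b" by (simp add: b_def[abs_def])
  then have "smooth_on UNIV (\<lambda>x. c + (- 1) * b x)"
    by (intro smooth_on_add smooth_on_mult smooth_on_const) auto
  then have "smooth_on UNIV (\<lambda>x. flat 0 (c + (- 1) * b x))"
    by (rule smooth_on_compose[rotated 3]) (auto intro: smooth_on_flat)
  then have "smooth_on UNIV (\<lambda>x. 1 + (- 1 / flat 0 c) * flat 0 (c + (- 1) * b x))"
    by (intro smooth_on_add smooth_on_mult smooth_on_const) auto
  then have 1: "smooth_on UNIV \<beta>" by (simp add: \<beta>_def[abs_def])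
  have ba: "b a > 0" using assms by (simp add: b_def flat_def)
  then have c: "c > 0" "flat 0 c > 0" by (auto simp: c_def flat_def)
  have "isCont b a" using smooth_on_imp_continuous_on[OF b]
      by (simp add: continuous_on_eq_continuous_at)
  then have "\<forall>\<^sub>F x in nhds a. b x > c"
    using ba by (intro order_tendstoD) (auto simp: c_def continuous_within tendsto_nhds_iff)
  then obtain \<epsilon> where \<epsilon>: "\<epsilon> > 0" "\<And>x. dist x a < \<epsilon> \<Longrightarrow> b x > c"
    unfolding eventually_nhds_metric by blast
  have 2: "\<beta> x = 1" if "x \<in> ball a \<epsilon>" for x
    using \<epsilon>(2)[of x] that by (auto simp: \<beta>_def flat_def dist_commute)
  have 3: "\<beta> x = 0" if "dist a x \<ge> r" for x
  proof -
    have "r\<^sup>2 \<le> (dist a x)\<^sup>2" using that assms by (intro power_mono) auto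
    then have "b x = 0" by (simp add: b_def flat_def dist_norm power2_norm_eq_inner inner_diff
        inner_commute)
    then show ?thesis using c by (simp add: \<beta>_def)
  qed
  show ?thesis using that[OF 1 \<epsilon>(1) 2 3] .
qed

section \<open>Hadamard's lemma\<close>

lemma segment_in_ball:
  fixes p x :: "'a::real_normed_vector"
  assumes "x \<in> ball p r" "t \<in> {0..1}"
  shows "p + t *\<^sub>R (x - p) \<in> ball p r"
proof -
  have "dist p (p + t *\<^sub>R (x - p)) = t * dist p x"
    using assms by (simp add: dist_norm norm_minus_commute)
  also have "\<dots> \<le> dist p x" using assms by (intro mult_left_le_one_le) auto
  finally show ?thesis using assms by simp
qed

text \<open>Each differentiation under the integral brings out a further factor \<open>t\<close>.
  The arbitrary weight \<open>w\<close> absorbs it, becoming \<open>w t * t\<close>, and this closes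
  the induction.\<close>

lemma Ck_on_integral:
  fixes f :: "'a::euclidean_space \<Rightarrow> real"
  assumes "smooth_on (ball p r) f" "continuous_on {0..1} w"
  shows "Ck_on k (\<lambda>x. integral (cbox 0 1) (\<lambda>t. w t * f (p + t *\<^sub>R (x - p)))) (ball p r)"
  using assms
proof (induction k arbitrary: f w)
  case (0 f w)
  have "continuous_on (ball p r \<times> cbox 0 1) (\<lambda>(x, t). w t * f (p + t *\<^sub>R (x - p)))"
    unfolding split_beta
    by (intro continuous_intros continuous_on_compose2[OF 0(2)]
        continuous_on_compose2[OF smooth_on_imp_continuous_on[OF 0(1)]])
      (auto simp del: mem_ball intro!: segment_in_ball)
  from integral_continuous_on_param[OF this] show ?case by simp
next
  case (Suc k f w)
  let ?D = "\<lambda>y. frechet_derivative f (at y)"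
  \<comment> \<open>\<open>leibniz_rule\<close> asks for a derivative that is jointly continuous as
    a bounded linear map; in finite dimension this follows from continuity of its value on each
    fixed vector.\<close>
  define B where "B x t = Blinfun (\<lambda>v. (w t * t) * ?D (p + t *\<^sub>R (x - p)) v)" for x t
  have D: "(f has_derivative ?D (p + t *\<^sub>R (x - p))) (at (p + t *\<^sub>R (x - p)))"
    if "x \<in> ball p r" "t \<in> {0..1}" for x t
    by (rule smooth_on_has_derivative[OF Suc.prems(1) segment_in_ball[OF that]])
  have B: "blinfun_apply (B x t) = (\<lambda>v. (w t * t) * ?D (p + t *\<^sub>R (x - p)) v)"
    if "x \<in> ball p r" "t \<in> {0..1}" for x t
    unfolding B_def using has_derivative_bounded_linear[OF D[OF that]]
    by (intro bounded_linear_Blinfun_apply bounded_linear_const_mult)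
  have w': "continuous_on {0..1} (\<lambda>t. w t * t)" using Suc.prems by (intro continuous_intros)
  have cont: "continuous_on (ball p r \<times> cbox 0 1) (\<lambda>(x, t). B x t)"
  proof (rule continuous_on_blinfun_componentwise)
    fix v :: 'a
    have "continuous_on (ball p r \<times> cbox 0 1) (\<lambda>(x, t). (w t * t) * ?D (p + t *\<^sub>R (x - p)) v)"
      unfolding split_beta
      by (intro continuous_intros continuous_on_compose2[OF Suc.prems(2)]
          continuous_on_compose2[OF smooth_on_imp_continuous_on[OF smooth_on_frechet[OF
              Suc.prems(1)]]])
        (auto simp del: mem_ball intro!: segment_in_ball)
    then show "continuous_on (ball p r \<times> cbox 0 1) (\<lambda>z. blinfun_apply (case z of (x, t) \<Rightarrow> B x t) v)"
      by (rule continuous_on_cong[THEN iffD1, rotated -1]) (auto simp del: mem_ball simp: B)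
  qed
  have cont_t: "continuous_on {0..1} (\<lambda>t. w t * f (p + t *\<^sub>R (x - p)))" if "x \<in> ball p r" for x
    by (intro continuous_intros Suc.prems
        continuous_on_compose2[OF smooth_on_imp_continuous_on[OF Suc.prems(1)]])
      (use that in \<open>auto simp del: mem_ball intro!: segment_in_ball\<close>)
  have der: "((\<lambda>x. integral (cbox 0 1) (\<lambda>t. w t * f (p + t *\<^sub>R (x - p)))) has_derivative
      (\<lambda>v. integral (cbox 0 1) (\<lambda>t. (w t * t) * ?D (p + t *\<^sub>R (x - p)) v))) (at x)"
    if x: "x \<in> ball p r" for x
  proof -
    have 1: "((\<lambda>x. integral (cbox 0 1) (\<lambda>t. w t * f (p + t *\<^sub>R (x - p)))) has_derivative
        blinfun_apply (integral (cbox 0 1) (B x))) (at x within ball p r)"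
    proof (rule leibniz_rule[OF _ _ cont x])
      fix y and t :: real assume y: "y \<in> ball p r" and t: "t \<in> cbox 0 1"
      have "((\<lambda>y. f (p + t *\<^sub>R (y - p))) has_derivative (\<lambda>v. ?D (p + t *\<^sub>R (y - p)) (t *\<^sub>R v)))
          (at y)"
        using diff_chain_at[of "\<lambda>y. p + t *\<^sub>R (y - p)" "\<lambda>v. t *\<^sub>R v" y f] D[OF y, of t] t
        by (force simp: comp_def intro!: derivative_eq_intros)
      then have "((\<lambda>y. w t * f (p + t *\<^sub>R (y - p))) has_derivative
          (\<lambda>v. w t * ?D (p + t *\<^sub>R (y - p)) (t *\<^sub>R v))) (at y)"
        by (rule has_derivative_mult_right)
      moreover have "?D (p + t *\<^sub>R (y - p)) (t *\<^sub>R v) = t * ?D (p + t *\<^sub>R (y - p)) v" for v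
        using linear_cmul[OF has_derivative_linear[OF D[OF y, of t]]] t by simp
      ultimately show "((\<lambda>x. w t * f (p + t *\<^sub>R (x - p))) has_derivative blinfun_apply (B y t))
          (at y within ball p r)"
        using t y by (auto simp: B mult.assoc intro: has_derivative_at_withinI)
    next
      fix y assume "y \<in> ball p r"
      then show "(\<lambda>t. w t * f (p + t *\<^sub>R (y - p))) integrable_on cbox 0 1"
        using integrable_continuous_real[OF cont_t] by (simp only: cbox_interval)
    qed simp
    have "blinfun_apply (integral (cbox 0 1) (B x)) v =
        integral (cbox 0 1) (\<lambda>t. (w t * t) * ?D (p + t *\<^sub>R (x - p)) v)" for v
    proof -
      have "continuous_on (cbox 0 1) (\<lambda>t. (\<lambda>(x, t). B x t) (x, t))"
        by (rule continuous_on_compose2[OF cont]) (use x in \<open>auto intro!: continuous_intros\<close>)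
      then have "continuous_on (cbox 0 1) (B x)" by (simp only: split_conv)
      then have "integral (cbox 0 1) ((\<lambda>b. blinfun_apply b v) \<circ> B x) =
          blinfun_apply (integral (cbox 0 1) (B x)) v"
        by (intro integral_linear integrable_continuous blinfun.bounded_linear_left)
      then have "blinfun_apply (integral (cbox 0 1) (B x)) v = integral (cbox 0 1) (\<lambda>t. B x t v)"
        by (simp only: comp_def)
      also have "\<dots> = integral (cbox 0 1) (\<lambda>t. (w t * t) * ?D (p + t *\<^sub>R (x - p)) v)"
        by (rule integral_cong) (use x in \<open>simp add: B\<close>)
      finally show ?thesis .
    qed
    then have "blinfun_apply (integral (cbox 0 1) (B x)) =
        (\<lambda>v. integral (cbox 0 1) (\<lambda>t. (w t * t) * ?D (p + t *\<^sub>R (x - p)) v))" by (rule ext)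
    with 1 show ?thesis by (simp only: at_within_open[OF x open_ball])
  qed
  show ?case
    by (rule Ck_on_SucI[OF open_ball der])
      (use Suc.IH[OF smooth_on_frechet[OF Suc.prems(1)] w'] in auto)
qed

text \<open>The fundamental theorem of calculus along the segment from \<open>p\<close> to
  \<open>x\<close>, with the direction \<open>x - p\<close> expanded in the standard basis;
  \<open>g i\<close> is the mean of the \<open>i\<close>-th partial derivative over the
  segment.\<close>

lemma hadamard:
  fixes f :: "real^'n \<Rightarrow> real"
  assumes f: "smooth_on (ball p r) f" and r: "r > 0"
  obtains g where "\<And>i. smooth_on (ball p r) (g i)"
    "\<And>x. x \<in> ball p r \<Longrightarrow> f x = f p + (\<Sum>i\<in>UNIV. (x $ i - p $ i) * g i x)"
    "\<And>i. g i p = frechet_derivative f (at p) (axis i 1)"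
proof
  let ?D = "\<lambda>y. frechet_derivative f (at y)"
  define g where "g i x = integral (cbox 0 1) (\<lambda>t. 1 * ?D (p + t *\<^sub>R (x - p)) (axis i 1))" for i x
  show "smooth_on (ball p r) (g i)" for i
    unfolding smooth_on_def g_def
    using Ck_on_integral[OF smooth_on_frechet[OF f], of "\<lambda>t. 1"] by simp
  show "g i p = ?D p (axis i 1)" for i by (simp add: g_def)
  fix x assume x: "x \<in> ball p r"
  have D: "(f has_derivative ?D (p + t *\<^sub>R (x - p))) (at (p + t *\<^sub>R (x - p)))" if "t \<in> {0..1}" for t
    by (rule smooth_on_has_derivative[OF f segment_in_ball[OF x that]])
  have lin: "linear (?D (p + t *\<^sub>R (x - p)))" if "t \<in> {0..1}" for t
    using has_derivative_linear[OF D[OF that]] .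
  have int: "(\<lambda>t. ?D (p + t *\<^sub>R (x - p)) v) integrable_on {0..1}" for v
    by (intro integrable_continuous_real continuous_on_compose2[OF smooth_on_imp_continuous_on[OF
        smooth_on_frechet[OF f]]]
        continuous_intros) (use x in \<open>auto simp del: mem_ball intro!: segment_in_ball\<close>)
  have "((\<lambda>t. f (p + t *\<^sub>R (x - p))) has_vector_derivative ?D (p + t *\<^sub>R (x - p)) (x - p)) (at t
      within {0..1})"
    if "t \<in> {0..1}" for t
  proof -
    have "((\<lambda>t. f (p + t *\<^sub>R (x - p))) has_derivative (\<lambda>s. ?D (p + t *\<^sub>R (x - p)) (s *\<^sub>R (x -
        p)))) (at t)"
      using diff_chain_at[of "\<lambda>t. p + t *\<^sub>R (x - p)" "\<lambda>s. s *\<^sub>R (x - p)" t f] D[OF that]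
      by (force simp: comp_def intro!: derivative_eq_intros)
    then show ?thesis
      using linear_cmul[OF lin[OF that]]
      by (simp add: has_vector_derivative_def has_derivative_at_withinI)
  qed
  then have "((\<lambda>t. ?D (p + t *\<^sub>R (x - p)) (x - p)) has_integral f (p + 1 *\<^sub>R (x - p)) - f (p + 0
      *\<^sub>R (x - p))) {0..1}"
    by (intro fundamental_theorem_of_calculus) auto
  then have "f x - f p = integral {0..1} (\<lambda>t. ?D (p + t *\<^sub>R (x - p)) (x - p))"
    by (simp add: integral_unique)
  also have "\<dots> = integral {0..1} (\<lambda>t. \<Sum>i\<in>UNIV. (x $ i - p $ i) * ?D (p + t *\<^sub>R (x - p)) (axis i 1))"
  proof (rule integral_cong)
    fix t :: real assume t: "t \<in> {0..1}"
    have "?D (p + t *\<^sub>R (x - p)) (x - p) = ?D (p + t *\<^sub>R (x - p)) (\<Sum>i\<in>UNIV. (x - p) $ i *\<^sub>R axis i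
        1)"
      using basis_expansion[of "x - p"] by (simp only: scalar_mult_eq_scaleR)
    then show "?D (p + t *\<^sub>R (x - p)) (x - p) = (\<Sum>i\<in>UNIV. (x $ i - p $ i) * ?D (p + t *\<^sub>R (x - p))
        (axis i 1))"
      using lin[OF t] by (simp add: linear_sum linear_cmul)
  qed
  also have "\<dots> = (\<Sum>i\<in>UNIV. (x $ i - p $ i) * g i x)"
    using int by (subst integral_sum) (auto simp: g_def intro!: integrable_on_mult_right)
  finally show "f x = f p + (\<Sum>i\<in>UNIV. (x $ i - p $ i) * g i x)" by simp
qed

section \<open>Smooth functions and tangent vectors on a manifold\<close>

definition smooth_near :: "('m::topological_space, 'n::finite) atlas \<Rightarrow> 'm set \<Rightarrow> ('m \<Rightarrow> real) \<Rightarrow> bool"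
  where "smooth_near M N f \<longleftrightarrow> (\<forall>(U, x)\<in>M. smooth_on (x ` (U \<inter> N)) (f \<circ> inv_into U x))"

text \<open>\<open>E\<close> and \<open>\<xi>\<close> are defined globally, since derivations act on
  global functions only, but they are a frame with dual coordinates on \<open>N\<close> alone. The
  components of a tangent vector \<open>v\<close> are simply the numbers
  \<open>v (\<xi> i)\<close>.\<close>

definition local_frame :: "('m::topological_space, 'n::finite) atlas \<Rightarrow> 'm set \<Rightarrow> ('n \<Rightarrow> 'm vfield) \<Rightarrow>
    ('n \<Rightarrow> 'm \<Rightarrow> real) \<Rightarrow> bool" where
  "local_frame M N E \<xi> \<longleftrightarrow> open N \<and> (\<forall>i. E i \<in> vfields M) \<and> (\<forall>i. \<xi> i \<in> smooth_funs M) \<and>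
     (\<forall>p\<in>N. \<forall>i j. E i p (\<xi> j) = (if i = j then 1 else 0)) \<and>
     (\<forall>p\<in>N. \<forall>v\<in>tangent_space M p. v = (\<lambda>f. \<Sum>i\<in>UNIV. v (\<xi> i) * E i p f))"

locale manifold =
  fixes M :: "('m::{t2_space,second_countable_topology}, 'n::finite) atlas"
  assumes manifold: "connected_smooth_manifold M"
begin

lemma chart_cover: obtains U x where "(U, x) \<in> M" "a \<in> U"
proof -
  have "a \<in> (\<Union>(U, x)\<in>M. U)" using manifold unfolding connected_smooth_manifold_def
      by (simp only: UNIV_I)
  then show ?thesis using that by auto
qed

lemma chartD:
  assumes "(U, x) \<in> M"
  shows "open U" "open (x ` U)" "inj_on x U" "continuous_on U x" "continuous_on (x ` U) (inv_into
      U x)"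
proof -
  have "\<forall>(U, x)\<in>M. open U \<and> open (x ` U) \<and> inj_on x U \<and>
      continuous_on U x \<and> continuous_on (x ` U) (inv_into U x)"
    using manifold unfolding connected_smooth_manifold_def by (elim conjE)
  from bspec[OF this assms] show "open U" "open (x ` U)" "inj_on x U" "continuous_on U x"
    "continuous_on (x ` U) (inv_into U x)"
    by simp_all
qed

lemma transition_smooth:
  assumes "(U, x) \<in> M" "(V, y) \<in> M"
  shows "smooth_on (x ` (U \<inter> V)) (y \<circ> inv_into U x)"
proof -
  have "\<forall>(U, x)\<in>M. \<forall>(V, y)\<in>M. smooth_on (x ` (U \<inter> V)) (y \<circ> inv_into U x)"
    using manifold unfolding connected_smooth_manifold_def by (elim conjE)
  with assms show ?thesis by auto
qed

lemma chart_inv [simp]: "(U, x) \<in> M \<Longrightarrow> p \<in> U \<Longrightarrow> inv_into U x (x p) = p"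
  using chartD(3) by (metis inv_into_f_f)

lemma chart_image_open:
  assumes "(U, x) \<in> M" "open N"
  shows "open (x ` (U \<inter> N))"
proof -
  have "x ` (U \<inter> N) = x ` U \<inter> inv_into U x -` N"
    using assms(1) by auto
  then show ?thesis
    using continuous_open_preimage[OF chartD(5,2)[OF assms(1)] assms(2)] by simp
qed

lemma chart_image_open': "(U, x) \<in> M \<Longrightarrow> open N \<Longrightarrow> N \<subseteq> U \<Longrightarrow> open (x ` N)"
  using chart_image_open[of U x N] by (simp add: Int_absorb1)

lemma smooth_near_UNIV: "smooth_near M UNIV f \<longleftrightarrow> f \<in> smooth_funs M"
  by (simp add: smooth_near_def smooth_funs_def)

lemma smooth_nearD: "smooth_near M N f \<Longrightarrow> (U, x) \<in> M \<Longrightarrow> smooth_on (x ` (U \<inter> N)) (f \<circ> inv_into U x)"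
  unfolding smooth_near_def by blast

lemma smooth_near_subset:
  assumes "smooth_near M N f" "N' \<subseteq> N"
  shows "smooth_near M N' f"
  using assms unfolding smooth_near_def by (fast intro: smooth_on_subset)

lemma smooth_near_local:
  assumes "\<And>a. a \<in> N \<Longrightarrow> \<exists>W. open W \<and> a \<in> W \<and> smooth_near M W f"
  shows "smooth_near M N f"
  unfolding smooth_near_def
proof (clarify, rule smooth_on_local)
  fix U x z assume c: "(U, x) \<in> M" and z: "z \<in> x ` (U \<inter> N)"
  then obtain a where a: "a \<in> U" "a \<in> N" "z = x a" by auto
  with assms obtain W where W: "open W" "a \<in> W" "smooth_near M W f" by blast
  then show "\<exists>T. open T \<and> z \<in> T \<and> smooth_on T (f \<circ> inv_into U x)"
    using chart_image_open[OF c] smooth_nearD[OF W(3) c] a by (intro exI[of _ "x ` (U \<inter> W)"]) auto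
qed

lemma smooth_near_cong:
  assumes "smooth_near M N f" "open N" "\<And>p. p \<in> N \<Longrightarrow> f p = g p"
  shows "smooth_near M N g"
  unfolding smooth_near_def
proof clarify
  fix U x assume c: "(U, x) \<in> M"
  show "smooth_on (x ` (U \<inter> N)) (g \<circ> inv_into U x)"
    by (rule smooth_on_cong[OF smooth_nearD[OF assms(1) c] chart_image_open[OF c assms(2)]])
      (use assms(3) c in auto)
qed

text \<open>All other charts are reached from the given one through the smooth transition
  maps.\<close>

lemma smooth_near_chart:
  assumes c: "(U, x) \<in> M" and N: "open N" "N \<subseteq> U" and f: "smooth_on (x ` N) (f \<circ> inv_into U x)"
  shows "smooth_near M N f"
  unfolding smooth_near_def
proof clarify
  fix V y assume d: "(V, y) \<in> M"
  have o: "open (y ` (V \<inter> N))" using chart_image_open[OF d N(1)] .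
  have "smooth_on (y ` (V \<inter> N)) (\<lambda>z. (f \<circ> inv_into U x) ((x \<circ> inv_into V y) z))"
  proof (rule smooth_on_compose[OF o _ _ _ f])
    show "open (x ` N)" using chart_image_open'[OF c N] .
    show "smooth_on (y ` (V \<inter> N)) (x \<circ> inv_into V y)"
      by (rule smooth_on_subset[OF transition_smooth[OF d c]]) (use N in auto)
  qed (use d in auto)
  then show "smooth_on (y ` (V \<inter> N)) (f \<circ> inv_into V y)"
    by (rule smooth_on_cong[OF _ o]) (use c d N in auto)
qed

lemma smooth_near_const: "open N \<Longrightarrow> smooth_near M N (\<lambda>p. c)"
  unfolding smooth_near_def by (auto simp: comp_def intro!: smooth_on_const chart_image_open)

lemma smooth_near_add:
  "open N \<Longrightarrow> smooth_near M N f \<Longrightarrow> smooth_near M N g \<Longrightarrow> smooth_near M N (\<lambda>p. f p + g p)"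
  unfolding smooth_near_def
  by (auto simp: comp_def intro!: smooth_on_add chart_image_open split: prod.splits)

lemma smooth_near_mult:
  "open N \<Longrightarrow> smooth_near M N f \<Longrightarrow> smooth_near M N g \<Longrightarrow> smooth_near M N (\<lambda>p. f p * g p)"
  unfolding smooth_near_def
  by (auto simp: comp_def intro!: smooth_on_mult chart_image_open split: prod.splits)

lemma smooth_near_coord:
  assumes "(U, x) \<in> M"
  shows "smooth_near M U (\<lambda>p. x p $ i)"
proof (rule smooth_near_chart[OF assms chartD(1)[OF assms] order_refl])
  have o: "open (x ` U)" using chartD(2)[OF assms] .
  have "smooth_on (x ` U) (\<lambda>z. z $ i)"
    by (rule smooth_on_linear[OF bounded_linear_vec_nth o smooth_on_id[OF o]])
  then show "smooth_on (x ` U) ((\<lambda>p. x p $ i) \<circ> inv_into U x)"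
    by (rule smooth_on_cong[OF _ o]) (use assms in auto)
qed

lemma smooth_const [simp]: "(\<lambda>p. c) \<in> smooth_funs M"
  using smooth_near_const[of UNIV] by (simp add: smooth_near_UNIV)

lemma smooth_add [intro]: "f \<in> smooth_funs M \<Longrightarrow> g \<in> smooth_funs M \<Longrightarrow> (\<lambda>p. f p + g p) \<in> smooth_funs M"
  using smooth_near_add[of UNIV] by (simp add: smooth_near_UNIV)

lemma smooth_mult [intro]: "f \<in> smooth_funs M \<Longrightarrow> g \<in> smooth_funs M \<Longrightarrow> (\<lambda>p. f p * g p) \<in> smooth_funs M"
  using smooth_near_mult[of UNIV] by (simp add: smooth_near_UNIV)

lemma smooth_cmult [intro]: "f \<in> smooth_funs M \<Longrightarrow> (\<lambda>p. c * f p) \<in> smooth_funs M"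
  using smooth_mult[of "\<lambda>p. c" f] by simp

lemma smooth_divide [intro]: "f \<in> smooth_funs M \<Longrightarrow> (\<lambda>p. f p / c) \<in> smooth_funs M"
  using smooth_cmult[of f "1 / c"] by simp

lemma smooth_diff [intro]: "f \<in> smooth_funs M \<Longrightarrow> g \<in> smooth_funs M \<Longrightarrow> (\<lambda>p. f p - g p) \<in> smooth_funs M"
  using smooth_add[of f "\<lambda>p. (-1) * g p"] smooth_cmult[of g "-1"] by simp

lemma smooth_sum: "(\<And>i. i \<in> I \<Longrightarrow> f i \<in> smooth_funs M) \<Longrightarrow> (\<lambda>p. \<Sum>i\<in>I. f i p) \<in> smooth_funs M"
  by (induction I rule: infinite_finite_induct) auto

lemma smooth_funs_local:
  assumes "\<And>a. \<exists>g N. g \<in> smooth_funs M \<and> open N \<and> a \<in> N \<and> (\<forall>p\<in>N. f p = g p)"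
  shows "f \<in> smooth_funs M"
  unfolding smooth_near_UNIV[symmetric]
proof (rule smooth_near_local)
  fix a
  obtain g N where g: "g \<in> smooth_funs M" and N: "open N" "a \<in> N" "\<forall>p\<in>N. f p = g p"
    using assms by blast
  have "smooth_near M N g" using g smooth_near_subset[of UNIV g N] by (simp add: smooth_near_UNIV)
  then show "\<exists>W. open W \<and> a \<in> W \<and> smooth_near M W f"
    using N smooth_near_cong[of N g f] by auto
qed

lemma smooth_near_smooth: "f \<in> smooth_funs M \<Longrightarrow> smooth_near M N f"
  using smooth_near_subset[of UNIV f N] by (simp add: smooth_near_UNIV)

lemma smooth_funs_chart: "f \<in> smooth_funs M \<Longrightarrow> (U, x) \<in> M \<Longrightarrow> smooth_on (x ` U) (f \<circ> inv_into U x)"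
  using smooth_nearD[of UNIV f U x] by (simp add: smooth_near_UNIV)

text \<open>The closed set \<open>K\<close> is supplied along with the function because extension by
  zero needs a closed set inside \<open>N\<close>; vanishing outside \<open>N\<close> would not be
  enough.\<close>

lemma bump:
  assumes N: "open N" "a \<in> N"
  obtains \<kappa> W K where "\<kappa> \<in> smooth_funs M" "open W" "a \<in> W" "W \<subseteq> N" "closed K" "K \<subseteq> N"
    "\<And>p. p \<in> W \<Longrightarrow> \<kappa> p = 1" "\<And>p. p \<notin> K \<Longrightarrow> \<kappa> p = 0"
proof -
  obtain U x where c: "(U, x) \<in> M" and a: "a \<in> U" by (rule chart_cover)
  have o: "open (x ` (U \<inter> N))" using chart_image_open[OF c N(1)] .
  then obtain r where r: "r > 0" "cball (x a) r \<subseteq> x ` (U \<inter> N)"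
    using a N(2) open_contains_cball[of "x ` (U \<inter> N)"] by blast
  obtain \<beta> :: "real^'n \<Rightarrow> real" and \<epsilon> where \<beta>: "smooth_on UNIV \<beta>" "\<epsilon> > 0"
    "\<And>z. z \<in> ball (x a) \<epsilon> \<Longrightarrow> \<beta> z = 1" "\<And>z. dist (x a) z \<ge> r \<Longrightarrow> \<beta> z = 0"
    using euclidean_bump[OF r(1), of "x a"] by metis
  define K where "K = inv_into U x ` cball (x a) r"
  define W where "W = U \<inter> N \<inter> x -` ball (x a) \<epsilon>"
  define \<kappa> where "\<kappa> p = (if p \<in> U \<inter> N then \<beta> (x p) else 0)" for p
  have "continuous_on (cball (x a) r) (inv_into U x)"
    by (rule continuous_on_subset[OF chartD(5)[OF c]]) (use r in auto)
  \<comment> \<open>Compactness of the closed ball and the Hausdorff property make \<open>K\<close>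
    closed in the whole manifold, not only in the chart.\<close>
  then have K: "closed K" unfolding K_def
    by (intro compact_imp_closed compact_continuous_image) auto
  have KN: "K \<subseteq> U \<inter> N" unfolding K_def using r(2) c by auto
  have W: "open W" unfolding W_def
    using continuous_open_preimage[of "U \<inter> N" x "ball (x a) \<epsilon>"] chartD(1,4)[OF c] N(1)
    by (auto intro: continuous_on_subset)
  have out: "\<kappa> p = 0" if "p \<notin> K" for p
  proof (cases "p \<in> U \<inter> N")
    case True
    have "x p \<notin> cball (x a) r"
    proof
      assume "x p \<in> cball (x a) r"
      then have "inv_into U x (x p) \<in> K" unfolding K_def by blast
      then show False using True that c by simp
    qed
    then show ?thesis using \<beta>(4) by (simp add: \<kappa>_def)
  qed (auto simp: \<kappa>_def)
  have near: "smooth_near M (U \<inter> N) \<kappa>"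
  proof (rule smooth_near_chart[OF c])
    show "smooth_on (x ` (U \<inter> N)) (\<kappa> \<circ> inv_into U x)"
      by (rule smooth_on_cong[OF smooth_on_subset[OF \<beta>(1)] o]) (use c in \<open>auto simp: \<kappa>_def\<close>)
  qed (use chartD(1)[OF c] N in auto)
  have "smooth_near M UNIV \<kappa>"
  proof (rule smooth_near_local)
    fix p
    show "\<exists>W. open W \<and> p \<in> W \<and> smooth_near M W \<kappa>"
    proof (cases "p \<in> K")
      case True
      then show ?thesis using near KN chartD(1)[OF c] N(1) by (intro exI[of _ "U \<inter> N"]) auto
    next
      case False
      have "smooth_near M (- K) \<kappa>"
        by (rule smooth_near_cong[OF smooth_near_const[of "- K" 0]]) (use K out in auto)
      then show ?thesis using False K by (intro exI[of _ "- K"]) auto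
    qed
  qed
  then have \<kappa>: "\<kappa> \<in> smooth_funs M" by (simp add: smooth_near_UNIV)
  have aW: "a \<in> W" using a N(2) \<beta>(2) by (simp add: W_def)
  have sub: "W \<subseteq> N" "K \<subseteq> N" using KN by (auto simp: W_def)
  have 1: "\<kappa> p = 1" if "p \<in> W" for p using that \<beta>(3) by (simp add: W_def \<kappa>_def)
  show ?thesis by (rule that[OF \<kappa> W aW sub(1) K sub(2) 1 out])
qed

text \<open>Smoothness is checked on two open sets that cover the manifold, \<open>N\<close> and the
  complement of \<open>K\<close>.\<close>

lemma smooth_extend_by_zero:
  assumes "open N" "smooth_near M N f" "\<kappa> \<in> smooth_funs M" "closed K" "K \<subseteq> N"
    and "\<And>p. p \<notin> K \<Longrightarrow> \<kappa> p = 0"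
  shows "(\<lambda>p. if p \<in> N then \<kappa> p * f p else 0) \<in> smooth_funs M" (is "?g \<in> _")
  unfolding smooth_near_UNIV[symmetric]
proof (rule smooth_near_local)
  fix p
  show "\<exists>W. open W \<and> p \<in> W \<and> smooth_near M W ?g"
  proof (cases "p \<in> K")
    case True
    have "smooth_near M N ?g"
      by (rule smooth_near_cong[OF smooth_near_mult[OF assms(1) smooth_near_smooth[OF assms(3)]
          assms(2)]])
        (use assms in auto)
    then show ?thesis using True assms by blast
  next
    case False
    have "smooth_near M (- K) ?g"
      by (rule smooth_near_cong[OF smooth_near_const[of "- K" 0]]) (use assms in auto)
    then show ?thesis using False assms by (intro exI[of _ "- K"]) auto
  qed
qed

lemma smooth_extension:
  assumes "open N" "a \<in> N" "smooth_near M N f"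
  obtains g W where "g \<in> smooth_funs M" "open W" "a \<in> W" "W \<subseteq> N" "\<And>p. p \<in> W \<Longrightarrow> g p = f p"
proof -
  obtain \<kappa> W K where \<kappa>: "\<kappa> \<in> smooth_funs M" "open W" "a \<in> W" "W \<subseteq> N" "closed K" "K \<subseteq> N"
    "\<And>p. p \<in> W \<Longrightarrow> \<kappa> p = 1" "\<And>p. p \<notin> K \<Longrightarrow> \<kappa> p = 0"
    using bump[OF assms(1,2)] by metis
  show ?thesis
    by (rule that[OF smooth_extend_by_zero[OF assms(1,3) \<kappa>(1,5,6,8)] \<kappa>(2-4)]) (use \<kappa> in auto)
qed

section \<open>Derivations, vector fields and local frames\<close>

lemma tangent_add: "v \<in> tangent_space M a \<Longrightarrow> f \<in> smooth_funs M \<Longrightarrow> g \<in> smooth_funs M \<Longrightarrow>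
    v (\<lambda>p. f p + g p) = v f + v g"
  and tangent_cmult: "v \<in> tangent_space M a \<Longrightarrow> f \<in> smooth_funs M \<Longrightarrow> v (\<lambda>p. c * f p) = c * v f"
  and tangent_mult: "v \<in> tangent_space M a \<Longrightarrow> f \<in> smooth_funs M \<Longrightarrow> g \<in> smooth_funs M \<Longrightarrow>
    v (\<lambda>p. f p * g p) = f a * v g + g a * v f"
  and tangent_outside: "v \<in> tangent_space M a \<Longrightarrow> f \<notin> smooth_funs M \<Longrightarrow> v f = 0"
  by (simp_all add: tangent_space_def)

lemma tangent_const: "v \<in> tangent_space M a \<Longrightarrow> v (\<lambda>p. c) = 0"
  using tangent_mult[of v a "\<lambda>p. 1" "\<lambda>p. 1"] tangent_cmult[of v a "\<lambda>p. 1" c] by simp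

lemma tangent_diff: "v \<in> tangent_space M a \<Longrightarrow> f \<in> smooth_funs M \<Longrightarrow> g \<in> smooth_funs M \<Longrightarrow>
    v (\<lambda>p. f p - g p) = v f - v g"
  using tangent_add[of v a f "\<lambda>p. (-1) * g p"] tangent_cmult[of v a g "-1"] smooth_cmult[of g
      "-1"] by simp

lemma tangent_sum:
  assumes "v \<in> tangent_space M a" "\<And>i. i \<in> I \<Longrightarrow> f i \<in> smooth_funs M"
  shows "v (\<lambda>p. \<Sum>i\<in>I. f i p) = (\<Sum>i\<in>I. v (f i))"
  using assms(2)
  by (induction I rule: infinite_finite_induct)
    (auto simp: tangent_const[OF assms(1)] tangent_add[OF assms(1)] smooth_sum)

lemma tangent_space_add: "v \<in> tangent_space M a \<Longrightarrow> w \<in> tangent_space M a \<Longrightarrow>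
    (\<lambda>f. v f + w f) \<in> tangent_space M a"
  and tangent_space_cmult: "v \<in> tangent_space M a \<Longrightarrow> (\<lambda>f. c * v f) \<in> tangent_space M a"
  and tangent_space_zero: "(\<lambda>f. 0) \<in> tangent_space M a"
  by (auto simp: tangent_space_def algebra_simps)

lemma tangent_space_sum: "(\<And>i. i \<in> I \<Longrightarrow> v i \<in> tangent_space M a) \<Longrightarrow>
    (\<lambda>f. \<Sum>i\<in>I. v i f) \<in> tangent_space M a"
  by (induction I rule: infinite_finite_induct) (auto intro: tangent_space_add tangent_space_zero)

text \<open>For a bump function \<open>\<kappa>\<close> supported in \<open>N\<close>, the product
  of \<open>\<kappa>\<close> with \<open>f - g\<close> is identically zero. By the Leibniz rule
  \<open>v\<close> maps it to \<open>v f - v g\<close>, since \<open>f - g\<close> vanishes at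
  \<open>a\<close> and \<open>\<kappa> a = 1\<close>.\<close>

lemma tangent_local:
  assumes v: "v \<in> tangent_space M a" and f: "f \<in> smooth_funs M" and g: "g \<in> smooth_funs M"
    and N: "open N" "a \<in> N" "\<And>p. p \<in> N \<Longrightarrow> f p = g p"
  shows "v f = v g"
proof -
  obtain \<kappa> W K where \<kappa>: "\<kappa> \<in> smooth_funs M" "open W" "a \<in> W" "W \<subseteq> N" "closed K" "K \<subseteq> N"
    "\<And>p. p \<in> W \<Longrightarrow> \<kappa> p = 1" "\<And>p. p \<notin> K \<Longrightarrow> \<kappa> p = 0"
    using bump[OF N(1,2)] by metis
  have "\<kappa> p * (f p - g p) = 0" for p using N(3)[of p] \<kappa>(6) \<kappa>(8)[of p] by (cases "p \<in> K") auto
  then have "(\<lambda>p. \<kappa> p * (f p - g p)) = (\<lambda>p. 0)" by (rule ext)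
  then have "0 = v (\<lambda>p. \<kappa> p * (f p - g p))" using tangent_const[OF v, of 0] by (simp only:)
  also have "\<dots> = v f - v g"
    using tangent_mult[OF v \<kappa>(1) smooth_diff[OF f g]] tangent_diff[OF v f g] N \<kappa> by simp
  finally show ?thesis by simp
qed

lemma vfields_tangent: "X \<in> vfields M \<Longrightarrow> X a \<in> tangent_space M a"
  and vfields_smooth: "X \<in> vfields M \<Longrightarrow> f \<in> smooth_funs M \<Longrightarrow> (\<lambda>a. X a f) \<in> smooth_funs M"
  by (auto simp: vfields_def)

lemma vfields_add: "X \<in> vfields M \<Longrightarrow> Y \<in> vfields M \<Longrightarrow> (\<lambda>a f. X a f + Y a f) \<in> vfields M"
  by (auto simp: vfields_def intro: tangent_space_add)

lemma vfields_fmult: "h \<in> smooth_funs M \<Longrightarrow> X \<in> vfields M \<Longrightarrow> (\<lambda>a f. h a * X a f) \<in> vfields M"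
  by (auto simp: vfields_def intro: tangent_space_cmult)

lemma vfields_cmult: "X \<in> vfields M \<Longrightarrow> (\<lambda>a f. c * X a f) \<in> vfields M"
  using vfields_fmult[of "\<lambda>p. c"] by simp

lemma vfields_zero: "(\<lambda>a f. 0) \<in> vfields M"
  by (auto simp: vfields_def intro: tangent_space_zero)

lemma vfields_sum: "(\<And>i. i \<in> I \<Longrightarrow> X i \<in> vfields M) \<Longrightarrow> (\<lambda>a f. \<Sum>i\<in>I. X i a f) \<in> vfields M"
  by (induction I rule: infinite_finite_induct) (auto intro: vfields_add vfields_zero)

text \<open>The coordinate field in direction \<open>u\<close>, cut off by \<open>\<kappa>\<close>
  so that it is defined everywhere. The value 0 on non-smooth functions is the convention of
  \<open>tangent_space\<close>.\<close>

lemma chart_vfield: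
  assumes c: "(U, x) \<in> M" and \<kappa>: "\<kappa> \<in> smooth_funs M" "closed K" "K \<subseteq> U" "\<And>p. p \<notin> K \<Longrightarrow> \<kappa> p = 0"
  shows "(\<lambda>p f. if f \<in> smooth_funs M \<and> p \<in> U
      then \<kappa> p * frechet_derivative (f \<circ> inv_into U x) (at (x p)) u else 0) \<in> vfields M" (is "?E \<in>
          _")
proof -
  have D: "(f \<circ> inv_into U x has_derivative frechet_derivative (f \<circ> inv_into U x) (at (x p))) (at
      (x p))"
    if "f \<in> smooth_funs M" "p \<in> U" for f p
    using smooth_on_has_derivative[OF smooth_funs_chart[OF that(1) c]] that by blast
  have F: "frechet_derivative h (at z) = h'" if "(h has_derivative h') (at z)"
    for h :: "real^'n \<Rightarrow> real" and h' z
    using frechet_derivative_at[OF that] by simp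
  have "?E p \<in> tangent_space M p" for p
  proof (cases "p \<in> U")
    case True
    have "frechet_derivative ((\<lambda>q. f q + g q) \<circ> inv_into U x) (at (x p)) u =
        frechet_derivative (f \<circ> inv_into U x) (at (x p)) u + frechet_derivative (g \<circ> inv_into U x)
            (at (x p)) u"
      if "f \<in> smooth_funs M" "g \<in> smooth_funs M" for f g
      using fun_cong[OF F[OF has_derivative_add[OF D[OF that(1) True] D[OF that(2) True]]], where
          x = u]
      by (simp add: comp_def)
    moreover have "frechet_derivative ((\<lambda>q. b * f q) \<circ> inv_into U x) (at (x p)) u =
        b * frechet_derivative (f \<circ> inv_into U x) (at (x p)) u"
      if "f \<in> smooth_funs M" for f b
      using fun_cong[OF F[OF has_derivative_mult_right[OF D[OF that True]]], where x = u]
      by (simp add: comp_def)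
    moreover have "frechet_derivative ((\<lambda>q. f q * g q) \<circ> inv_into U x) (at (x p)) u =
        f p * frechet_derivative (g \<circ> inv_into U x) (at (x p)) u +
        g p * frechet_derivative (f \<circ> inv_into U x) (at (x p)) u"
      if "f \<in> smooth_funs M" "g \<in> smooth_funs M" for f g
      using fun_cong[OF F[OF has_derivative_mult[OF D[OF that(1) True] D[OF that(2) True]]], where
          x = u] c True
      by (simp add: comp_def)
    ultimately show ?thesis using True
      by (auto simp: tangent_space_def smooth_add smooth_cmult smooth_mult algebra_simps)
  qed (use tangent_space_zero in auto)
  moreover have "(\<lambda>p. ?E p f) \<in> smooth_funs M" if f: "f \<in> smooth_funs M" for f
  proof -
    have "smooth_near M U (\<lambda>p. frechet_derivative (f \<circ> inv_into U x) (at (x p)) u)"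
    proof (rule smooth_near_chart[OF c chartD(1)[OF c] order_refl])
      show "smooth_on (x ` U) ((\<lambda>p. frechet_derivative (f \<circ> inv_into U x) (at (x p)) u) \<circ> inv_into
          U x)"
        by (rule smooth_on_cong[OF smooth_on_frechet[OF smooth_funs_chart[OF f c]] chartD(2)[OF c]])
          (use c in auto)
    qed
    from smooth_extend_by_zero[OF chartD(1)[OF c] this \<kappa>] f show ?thesis by simp
  qed
  ultimately show ?thesis by (simp add: vfields_def)
qed

text \<open>Cut-off coordinates and cut-off coordinate fields form the frame where the bump function
  is 1. That they span all derivations is Hadamard's lemma: each term (\<xi>_i - \<xi>_i(p)) h_i
  contributes h_i(p) v(\<xi>_i), because its first factor vanishes at \<open>p\<close>.\<close>

lemma local_frame_exists:
  obtains N E \<xi> where "local_frame M N E \<xi>" "a \<in> N"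
proof -
  obtain U x where c: "(U, x) \<in> M" and a: "a \<in> U" by (rule chart_cover)
  obtain \<kappa> W K where \<kappa>: "\<kappa> \<in> smooth_funs M" "open W" "a \<in> W" "W \<subseteq> U" "closed K" "K \<subseteq> U"
    "\<And>p. p \<in> W \<Longrightarrow> \<kappa> p = 1" "\<And>p. p \<notin> K \<Longrightarrow> \<kappa> p = 0"
    using bump[OF chartD(1)[OF c] a] by metis
  define E where "E i p f = (if f \<in> smooth_funs M \<and> p \<in> U
      then \<kappa> p * frechet_derivative (f \<circ> inv_into U x) (at (x p)) (axis i 1) else 0)" for i p f
  define \<xi> where "\<xi> i p = (if p \<in> U then \<kappa> p * x p $ i else 0)" for i p
  have E: "E i \<in> vfields M" for i
    using chart_vfield[OF c \<kappa>(1,5,6,8)] by (simp add: E_def[abs_def])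
  have \<xi>: "\<xi> i \<in> smooth_funs M" for i
    using smooth_extend_by_zero[OF chartD(1)[OF c] smooth_near_coord[OF c] \<kappa>(1,5,6,8)]
    by (simp add: \<xi>_def[abs_def])
  have \<xi>_eq: "\<xi> i p = x p $ i" if "p \<in> W" for i p using \<kappa> that by (auto simp: \<xi>_def)
  have oW: "open (x ` W)" using chart_image_open'[OF c \<kappa>(2,4)] .
  have dual: "E i p (\<xi> j) = (if i = j then 1 else 0)" if p: "p \<in> W" for i j p
  proof -
    have "((\<lambda>z. z $ j) has_derivative (\<lambda>v. v $ j)) (at (x p))"
      using bounded_linear.has_derivative[OF bounded_linear_vec_nth has_derivative_ident] by blast
    then have "(\<xi> j \<circ> inv_into U x has_derivative (\<lambda>v. v $ j)) (at (x p))"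
      by (rule has_derivative_transform_within_open[OF _ oW]) (use p \<xi>_eq c \<kappa>(4) in \<open>auto simp:
          subset_iff\<close>)
    then have "frechet_derivative (\<xi> j \<circ> inv_into U x) (at (x p)) = (\<lambda>v. v $ j)"
      using frechet_derivative_at by force
    then show ?thesis using p \<kappa>(4,7) \<xi> by (auto simp: E_def axis_def)
  qed
  have expand: "v = (\<lambda>f. \<Sum>i\<in>UNIV. v (\<xi> i) * E i p f)" if p: "p \<in> W" and v: "v \<in> tangent_space M p"
      for p v
  proof
    fix f
    show "v f = (\<Sum>i\<in>UNIV. v (\<xi> i) * E i p f)"
    proof (cases "f \<in> smooth_funs M")
      case f: True
      obtain r where r: "r > 0" "ball (x p) r \<subseteq> x ` W"
        using oW p open_contains_ball[of "x ` W"] by blast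
      define B where "B = W \<inter> x -` ball (x p) r"
      have B: "open B" unfolding B_def
        using continuous_open_preimage[of W x "ball (x p) r"] chartD(4)[OF c] \<kappa>(2,4)
        by (auto intro: continuous_on_subset)
      have pB: "p \<in> B" using p r by (simp add: B_def)
      have BU: "B \<subseteq> U" using \<kappa>(4) by (auto simp: B_def)
      have xB: "x ` B = ball (x p) r" using r(2) by (auto simp: B_def)
      have "smooth_on (ball (x p) r) (f \<circ> inv_into U x)"
        by (rule smooth_on_subset[OF smooth_funs_chart[OF f c]]) (use xB BU in auto)
      then obtain g where g: "\<And>i. smooth_on (ball (x p) r) (g i)"
        "\<And>z. z \<in> ball (x p) r \<Longrightarrow> (f \<circ> inv_into U x) z =
          (f \<circ> inv_into U x) (x p) + (\<Sum>i\<in>UNIV. (z $ i - x p $ i) * g i z)"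
        "\<And>i. g i (x p) = frechet_derivative (f \<circ> inv_into U x) (at (x p)) (axis i 1)"
        by (rule hadamard[OF _ r(1)]) (rule that)
      have x_inv: "x (inv_into U x z) = z" if "z \<in> ball (x p) r" for z
        using that xB BU by (intro f_inv_into_f) blast
      have "smooth_near M B (\<lambda>q. g i (x q))" for i
      proof (rule smooth_near_chart[OF c B BU])
        show "smooth_on (x ` B) ((\<lambda>q. g i (x q)) \<circ> inv_into U x)"
          unfolding xB by (rule smooth_on_cong[OF g(1)[of i] open_ball]) (simp add: x_inv del:
              mem_ball)
      qed
      \<comment> \<open>The Hadamard coefficients are smooth near \<open>p\<close> only, whereas
        \<open>v\<close> acts on global functions; so they are replaced by global functions with the
        same germs.\<close>
      then have "\<exists>h V. h \<in> smooth_funs M \<and> open V \<and> p \<in> V \<and> V \<subseteq> B \<and> (\<forall>q\<in>V. h q = g i (x q))" for i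
        by (rule smooth_extension[OF B pB]) blast
      then have "\<forall>i. \<exists>h V. h \<in> smooth_funs M \<and> open V \<and> p \<in> V \<and> V \<subseteq> B \<and> (\<forall>q\<in>V. h q = g i (x q))"
        by blast
      from choice[OF this] obtain h where "\<forall>i. \<exists>V. h i \<in> smooth_funs M \<and> open V \<and> p \<in> V \<and> V \<subseteq> B \<and>
          (\<forall>q\<in>V. h i q = g i (x q))"
        by blast
      from choice[OF this] obtain V where h: "\<And>i. h i \<in> smooth_funs M" "\<And>i. open (V i)" "\<And>i. p \<in> V
          i"
        "\<And>i. V i \<subseteq> B" "\<And>i q. q \<in> V i \<Longrightarrow> h i q = g i (x q)"
        by blast
      have h': "(\<lambda>q. (\<xi> i q - \<xi> i p) * h i q) \<in> smooth_funs M" for i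
        by (intro smooth_mult smooth_diff smooth_const \<xi> h(1))
      have "v f = v (\<lambda>q. f p + (\<Sum>i\<in>UNIV. (\<xi> i q - \<xi> i p) * h i q))"
      proof (rule tangent_local[OF v f, where N = "\<Inter>(range V)"])
        show "(\<lambda>q. f p + (\<Sum>i\<in>UNIV. (\<xi> i q - \<xi> i p) * h i q)) \<in> smooth_funs M"
          by (intro smooth_add smooth_sum smooth_const h')
        show "open (\<Inter>(range V))" using h(2) by (intro open_Inter) auto
        fix q assume q: "q \<in> \<Inter>(range V)"
        then have "q \<in> B" using h(4) by blast
        then show "f q = f p + (\<Sum>i\<in>UNIV. (\<xi> i q - \<xi> i p) * h i q)"
          using g(2)[of "x q"] q h(5) \<xi>_eq p c BU pB by (auto simp: B_def subset_iff)
      qed (use h in auto)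
      also have "\<dots> = (\<Sum>i\<in>UNIV. v (\<lambda>q. (\<xi> i q - \<xi> i p) * h i q))"
        using tangent_add[OF v smooth_const[of "f p"] smooth_sum[of UNIV "\<lambda>i q. (\<xi> i q - \<xi> i p) *
            h i q"]]
          tangent_sum[OF v, of UNIV "\<lambda>i q. (\<xi> i q - \<xi> i p) * h i q"] h' tangent_const[OF v] by simp
      also have "\<dots> = (\<Sum>i\<in>UNIV. v (\<xi> i) * E i p f)"
      proof (rule sum.cong[OF refl])
        fix i
        have "v (\<lambda>q. (\<xi> i q - \<xi> i p) * h i q) = h i p * v (\<xi> i)"
          using tangent_mult[OF v smooth_diff[OF \<xi> smooth_const[of "\<xi> i p"]] h(1)]
            tangent_diff[OF v \<xi> smooth_const] tangent_const[OF v] by simp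
        then show "v (\<lambda>q. (\<xi> i q - \<xi> i p) * h i q) = v (\<xi> i) * E i p f"
          using h(5)[OF h(3)] g(3) f p \<kappa>(4,7) by (auto simp: E_def)
      qed
      finally show ?thesis .
    qed (use tangent_outside[OF v] in \<open>simp add: E_def\<close>)
  qed
  have "local_frame M W E \<xi>"
    unfolding local_frame_def using \<kappa>(2) E \<xi> dual expand by blast
  then show ?thesis using that \<kappa>(3) by blast
qed

end

section \<open>Linear and multilinear forms\<close>

text \<open>Tangent vectors and covectors are both real functions with pointwise operations, so one
  notion of linearity on a set of functions serves the forms on either space.\<close>

definition lin :: "('x \<Rightarrow> real) set \<Rightarrow> (('x \<Rightarrow> real) \<Rightarrow> real) \<Rightarrow> bool" where
  "lin V h \<longleftrightarrow> (\<forall>v\<in>V. \<forall>w\<in>V. h (\<lambda>x. v x + w x) = h v + h w) \<and> (\<forall>c. \<forall>v\<in>V. h (\<lambda>x. c * v x) = c * h v)"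

definition fspace :: "('x \<Rightarrow> real) set \<Rightarrow> bool" where
  "fspace V \<longleftrightarrow> (\<lambda>x. 0) \<in> V \<and> (\<forall>v\<in>V. \<forall>w\<in>V. (\<lambda>x. v x + w x) \<in> V) \<and> (\<forall>c. \<forall>v\<in>V. (\<lambda>x. c * v x) \<in> V)"

definition mlin :: "('x \<Rightarrow> real) set \<Rightarrow> nat \<Rightarrow> (('x \<Rightarrow> real) list \<Rightarrow> real) \<Rightarrow> bool" where
  "mlin V k F \<longleftrightarrow> (\<forall>xs ys. set xs \<union> set ys \<subseteq> V \<and> Suc (length xs + length ys) = k \<longrightarrow> lin V (\<lambda>v. F (xs
      @ v # ys)))"

lemma lin_add: "lin V h \<Longrightarrow> v \<in> V \<Longrightarrow> w \<in> V \<Longrightarrow> h (\<lambda>x. v x + w x) = h v + h w"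
  and lin_cmult: "lin V h \<Longrightarrow> v \<in> V \<Longrightarrow> h (\<lambda>x. c * v x) = c * h v"
  by (auto simp: lin_def)

lemma fspace_sum: "fspace V \<Longrightarrow> (\<And>i. i \<in> I \<Longrightarrow> v i \<in> V) \<Longrightarrow> (\<lambda>x. \<Sum>i\<in>I. v i x) \<in> V"
  by (induction I rule: infinite_finite_induct) (auto simp: fspace_def)

lemma lin_zero: "fspace V \<Longrightarrow> lin V h \<Longrightarrow> h (\<lambda>x. 0) = 0"
  using lin_cmult[of V h "\<lambda>x. 0" 0] by (simp add: fspace_def)

lemma lin_sum:
  assumes "fspace V" "lin V h" "\<And>i. i \<in> I \<Longrightarrow> v i \<in> V"
  shows "h (\<lambda>x. \<Sum>i\<in>I. c i * v i x) = (\<Sum>i\<in>I. c i * h (v i))"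
  using assms(3)
proof (induction I rule: infinite_finite_induct)
  case (insert i I)
  have "(\<lambda>x. \<Sum>i\<in>I. c i * v i x) \<in> V" "(\<lambda>x. c i * v i x) \<in> V"
    using insert assms(1) by (auto intro!: fspace_sum simp: fspace_def)
  then show ?case using insert lin_add[OF assms(2), of "\<lambda>x. c i * v i x"] lin_cmult[OF assms(2)]
      by simp
qed (use lin_zero[OF assms(1,2)] in auto)

lemma mlin_Cons:
  assumes "mlin V (Suc k) F" "v \<in> V"
  shows "mlin V k (\<lambda>vs. F (v # vs))"
  unfolding mlin_def
proof clarify
  fix xs ys assume "set xs \<union> set ys \<subseteq> V" "k = Suc (length xs + length ys)"
  then show "lin V (\<lambda>u. F (v # xs @ u # ys))"
    using assms(1)[unfolded mlin_def, rule_format, of "v # xs" ys] assms(2) by simp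
qed

lemma mlin_hd: "mlin V (Suc k) F \<Longrightarrow> set vs \<subseteq> V \<Longrightarrow> length vs = k \<Longrightarrow> lin V (\<lambda>v. F (v # vs))"
  unfolding mlin_def by (drule spec[of _ "[]"], drule spec[of _ vs]) simp

context manifold begin

lemma fspace_tangent: "fspace (tangent_space M a)"
  unfolding fspace_def using tangent_space_add tangent_space_cmult tangent_space_zero by blast

lemma fspace_cotangent: "fspace (cotangent_space M a)"
  unfolding fspace_def cotangent_space_def by (auto simp: algebra_simps)

lemma cotangent_lin: "\<eta> \<in> cotangent_space M a \<Longrightarrow> lin (tangent_space M a) \<eta>"
  by (auto simp: cotangent_space_def lin_def)

lemma cotangent_outside: "\<eta> \<in> cotangent_space M a \<Longrightarrow> v \<notin> tangent_space M a \<Longrightarrow> \<eta> v = 0"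
  by (auto simp: cotangent_space_def)

lemma dfun_cotangent: "dfun M a f \<in> cotangent_space M a"
  using tangent_space_add tangent_space_cmult by (auto simp: dfun_def cotangent_space_def)

lemma dfun_apply: "v \<in> tangent_space M a \<Longrightarrow> dfun M a f v = v f"
  by (simp add: dfun_def)

lemma local_frameD:
  assumes "local_frame M N E \<xi>"
  shows "open N" "E i \<in> vfields M" "\<xi> i \<in> smooth_funs M"
    "p \<in> N \<Longrightarrow> E i p (\<xi> j) = (if i = j then 1 else 0)"
    "p \<in> N \<Longrightarrow> v \<in> tangent_space M p \<Longrightarrow> v f = (\<Sum>i\<in>UNIV. v (\<xi> i) * E i p f)"
proof -
  assume "p \<in> N" "v \<in> tangent_space M p"
  then have "v = (\<lambda>f. \<Sum>i\<in>UNIV. v (\<xi> i) * E i p f)" using assms unfolding local_frame_def by blast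
  then show "v f = (\<Sum>i\<in>UNIV. v (\<xi> i) * E i p f)" by (rule fun_cong)
qed (use assms in \<open>auto simp: local_frame_def\<close>)

text \<open>The combination of the coordinates \<open>\<xi> i\<close> with the constant coefficients
  \<open>\<eta> (E i a)\<close> has the prescribed differential.\<close>

lemma dfun_surj:
  assumes \<eta>: "\<eta> \<in> cotangent_space M a"
  obtains f where "f \<in> smooth_funs M" "dfun M a f = \<eta>"
proof -
  obtain N E \<xi> where F: "local_frame M N E \<xi>" and a: "a \<in> N" by (rule local_frame_exists)
  define f where "f p = (\<Sum>i\<in>UNIV. \<eta> (E i a) * \<xi> i p)" for p
  have f: "f \<in> smooth_funs M"
    unfolding f_def[abs_def] using local_frameD(3)[OF F] by (intro smooth_sum smooth_cmult)
  have "dfun M a f v = \<eta> v" for v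
  proof (cases "v \<in> tangent_space M a")
    case v: True
    have "v f = (\<Sum>i\<in>UNIV. \<eta> (E i a) * v (\<xi> i))"
      using tangent_sum[OF v, of UNIV "\<lambda>i p. \<eta> (E i a) * \<xi> i p"] local_frameD(3)[OF F]
        tangent_cmult[OF v] by (simp add: f_def[abs_def] smooth_cmult)
    also have "\<dots> = \<eta> (\<lambda>g. \<Sum>i\<in>UNIV. v (\<xi> i) * E i a g)"
      using lin_sum[OF fspace_tangent cotangent_lin[OF \<eta>], of UNIV "\<lambda>i. E i a"]
        vfields_tangent[OF local_frameD(2)[OF F]] by (simp add: mult.commute)
    also have "\<dots> = \<eta> v" by (intro arg_cong[where f = \<eta>] ext local_frameD(5)[OF F a v, symmetric])
    finally show ?thesis using v by (simp add: dfun_apply)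
  qed (use cotangent_outside[OF \<eta>] in \<open>simp add: dfun_def\<close>)
  then show ?thesis using that f by blast
qed

lemma dfun_surj_list:
  assumes "set \<eta>s \<subseteq> cotangent_space M a"
  obtains fs where "set fs \<subseteq> smooth_funs M" "map (dfun M a) fs = \<eta>s"
proof -
  have "\<exists>fs. set fs \<subseteq> smooth_funs M \<and> map (dfun M a) fs = \<eta>s"
    using assms
  proof (induction \<eta>s)
    case (Cons \<eta> \<eta>s)
    then obtain fs where "set fs \<subseteq> smooth_funs M" "map (dfun M a) fs = \<eta>s" by auto
    moreover obtain f where "f \<in> smooth_funs M" "dfun M a f = \<eta>"
      using dfun_surj Cons.prems by (metis list.set_intros(1) subsetD)
    ultimately show ?case by (intro exI[of _ "f # fs"]) auto
  qed auto
  then show ?thesis using that by blast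
qed

lemma vfield_extension:
  assumes v: "v \<in> tangent_space M a"
  shows "\<exists>X. X \<in> vfields M \<and> X a = v"
proof -
  obtain N E \<xi> where F: "local_frame M N E \<xi>" and a: "a \<in> N" by (rule local_frame_exists)
  have "(\<lambda>p f. \<Sum>i\<in>UNIV. v (\<xi> i) * E i p f) \<in> vfields M"
    using local_frameD(2)[OF F] by (intro vfields_sum vfields_cmult)
  moreover have "(\<lambda>f. \<Sum>i\<in>UNIV. v (\<xi> i) * E i a f) = v"
    by (intro ext local_frameD(5)[OF F a v, symmetric])
  ultimately show ?thesis by blast
qed

lemma extend_vfield: "v \<in> tangent_space M a \<Longrightarrow> extend M a v \<in> vfields M"
  and extend_at: "v \<in> tangent_space M a \<Longrightarrow> extend M a v a = v"
  using someI_ex[OF vfield_extension] unfolding extend_def by blast+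

text \<open>The usual argument for maps that are linear over smooth functions. The difference
  \<open>Z\<close> of the fields vanishes at \<open>a\<close>; by cutting off, it is written
  globally as a combination of fields whose smooth coefficients \<open>1 - \<kappa> p\<close> and
  \<open>\<kappa> p * Z p (\<xi> i)\<close> all vanish at \<open>a\<close>.\<close>

lemma tensorial:
  assumes add: "\<And>X Y. X \<in> vfields M \<Longrightarrow> Y \<in> vfields M \<Longrightarrow> F (\<lambda>p f. X p f + Y p f) = F X + F Y"
    and scale: "\<And>h X. h \<in> smooth_funs M \<Longrightarrow> X \<in> vfields M \<Longrightarrow> F (\<lambda>p f. h p * X p f) = h a * F X"
    and X: "X \<in> vfields M" and Y: "Y \<in> vfields M" and eq: "X a = Y a"
  shows "F X = (F Y :: real)"
proof -
  have F0: "F (\<lambda>p f. 0) = 0" using scale[of "\<lambda>p. 0" "\<lambda>p f. 0"] vfields_zero by simp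
  have Fsum: "F (\<lambda>p f. \<Sum>i\<in>I. Z i p f) = (\<Sum>i\<in>I. F (Z i))"
    if "finite I" "\<And>i. Z i \<in> vfields M" for I and Z :: "'n \<Rightarrow> 'm vfield"
    using that by (induction I) (auto simp: F0 add vfields_sum)
  define Z where "Z p f = X p f + (-1) * Y p f" for p f
  have Z: "Z \<in> vfields M"
    unfolding Z_def[abs_def] by (intro vfields_add X vfields_cmult Y)
  have FZ: "F Z = F X - F Y"
    using add[OF X vfields_cmult[OF Y, of "-1"]] scale[OF smooth_const[of "-1"] Y]
        by (simp add: Z_def[abs_def])
  obtain N E \<xi> where L: "local_frame M N E \<xi>" and a: "a \<in> N" by (rule local_frame_exists)
  obtain \<kappa> W K where \<kappa>: "\<kappa> \<in> smooth_funs M" "open W" "a \<in> W" "W \<subseteq> N" "closed K" "K \<subseteq> N"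
    "\<And>p. p \<in> W \<Longrightarrow> \<kappa> p = 1" "\<And>p. p \<notin> K \<Longrightarrow> \<kappa> p = 0"
    using bump[OF local_frameD(1)[OF L] a] by metis
  have 1: "(\<lambda>p. \<kappa> p * Z p (\<xi> i)) \<in> smooth_funs M" for i
    using \<kappa>(1) vfields_smooth[OF Z local_frameD(3)[OF L]] by (rule smooth_mult)
  have 2: "(\<lambda>p. 1 - \<kappa> p) \<in> smooth_funs M" using smooth_diff[OF smooth_const \<kappa>(1)] .
  have 3: "(\<lambda>p f. (\<kappa> p * Z p (\<xi> i)) * E i p f) \<in> vfields M" for i
    using 1 local_frameD(2)[OF L] by (rule vfields_fmult)
  have "Z p f = (1 - \<kappa> p) * Z p f + (\<Sum>i\<in>UNIV. (\<kappa> p * Z p (\<xi> i)) * E i p f)" for p f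
  proof (cases "p \<in> N")
    case True
    have "(\<Sum>i\<in>UNIV. (\<kappa> p * Z p (\<xi> i)) * E i p f) = \<kappa> p * Z p f"
      using local_frameD(5)[OF L True vfields_tangent[OF Z], of f]
          by (simp add: sum_distrib_left mult.assoc)
    then show ?thesis by (simp add: algebra_simps)
  next
    case False
    then have "p \<notin> K" using \<kappa>(6) by blast
    then show ?thesis by (simp add: \<kappa>(8))
  qed
  then have "F Z = F (\<lambda>p f. (1 - \<kappa> p) * Z p f + (\<Sum>i\<in>UNIV. (\<kappa> p * Z p (\<xi> i)) * E i p f))"
    by (intro arg_cong[where f = F] ext)
  also have "\<dots> = F (\<lambda>p f. (1 - \<kappa> p) * Z p f) + F (\<lambda>p f. \<Sum>i\<in>UNIV. (\<kappa> p * Z p (\<xi> i)) * E i p f)"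
    by (rule add[OF vfields_fmult[OF 2 Z] vfields_sum[OF 3]])
  also have "F (\<lambda>p f. (1 - \<kappa> p) * Z p f) = (1 - \<kappa> a) * F Z" by (rule scale[OF 2 Z])
  also have "F (\<lambda>p f. \<Sum>i\<in>UNIV. (\<kappa> p * Z p (\<xi> i)) * E i p f) =
      (\<Sum>i\<in>UNIV. F (\<lambda>p f. (\<kappa> p * Z p (\<xi> i)) * E i p f))"
    by (rule Fsum[OF finite 3])
  also have "\<dots> = 0"
    using scale[OF 1 local_frameD(2)[OF L]] eq by (simp add: Z_def)
  finally have "F Z = 0" using \<kappa>(3,7) by simp
  then show ?thesis using FZ by simp
qed

section \<open>Differential operators\<close>

lemma linear_operD:
  assumes "linear_oper M A" "f \<in> smooth_funs M"
  shows "A f \<in> smooth_funs M"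
    "g \<in> smooth_funs M \<Longrightarrow> A (\<lambda>p. f p + g p) = (\<lambda>p. A f p + A g p)"
    "A (\<lambda>p. c * f p) = (\<lambda>p. c * A f p)"
  using assms unfolding linear_oper_def by blast+

lemma diff_oper_linear: "diff_oper M k A \<Longrightarrow> linear_oper M A"
  by (cases k) auto

lemma linear_oper_commutator:
  assumes "linear_oper M A" "f \<in> smooth_funs M"
  shows "linear_oper M (commutator A f)"
proof -
  note L = linear_operD[OF assms(1)]
  have eq: "(\<lambda>q. f q * (g q + h q)) = (\<lambda>q. f q * g q + f q * h q)"
    "(\<lambda>q. f q * (c * g q)) = (\<lambda>q. c * (f q * g q))" for g h and c :: real
    by (auto simp: algebra_simps)
  show ?thesis
    unfolding linear_oper_def commutator_def eq
    using assms(2) L smooth_mult[OF assms(2)]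
    by (auto intro!: smooth_diff smooth_mult simp: algebra_simps)
qed

text \<open>Operators are compared on smooth functions only; their values elsewhere are arbitrary.
  The same convention recurs in the congruence rules below.\<close>

lemma linear_oper_cong:
  assumes "\<And>f. f \<in> smooth_funs M \<Longrightarrow> A f = B f" "linear_oper M A"
  shows "linear_oper M B"
proof -
  have "B f = A f" if "f \<in> smooth_funs M" for f using assms(1)[OF that] by simp
  then show ?thesis using assms(2) unfolding linear_oper_def by (auto simp: smooth_add smooth_cmult)
qed

lemma commutator_cong:
  assumes "\<And>f. f \<in> smooth_funs M \<Longrightarrow> A f = B f" "f \<in> smooth_funs M" "g \<in> smooth_funs M"
  shows "commutator A f g = commutator B f g"
  using assms by (simp add: commutator_def smooth_mult)

lemma diff_oper_cong:
  assumes "\<And>f. f \<in> smooth_funs M \<Longrightarrow> A f = B f" "diff_oper M k A"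
  shows "diff_oper M k B"
  using assms
proof (induction k arbitrary: A B)
  case 0
  then show ?case using linear_oper_cong[of A B] commutator_cong[of A B] by auto
next
  case (Suc k)
  have "diff_oper M k (commutator B f)" if "f \<in> smooth_funs M" for f
    using Suc.IH[of "commutator A f" "commutator B f"] commutator_cong[of A B, OF Suc.prems(1)
        that] Suc.prems(2) that
    by simp
  then show ?case using linear_oper_cong[of A B] Suc.prems by auto
qed

lemma linear_oper_add: "linear_oper M A \<Longrightarrow> linear_oper M B \<Longrightarrow> linear_oper M (\<lambda>f p. A f p + B f p)"
  unfolding linear_oper_def by (auto simp: algebra_simps smooth_add)

lemma linear_oper_fmult: "h \<in> smooth_funs M \<Longrightarrow> linear_oper M A \<Longrightarrow> linear_oper M (\<lambda>f p. h p * A f p)"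
  unfolding linear_oper_def by (auto simp: algebra_simps smooth_mult)

lemma linear_oper_zero: "linear_oper M (\<lambda>f p. 0)"
  unfolding linear_oper_def by auto

lemma commutator_add: "commutator (\<lambda>f p. A f p + B f p) g = (\<lambda>f p. commutator A g f p + commutator
    B g f p)"
  by (auto simp: commutator_def algebra_simps fun_eq_iff)

lemma commutator_fmult: "commutator (\<lambda>f p. h p * A f p) g = (\<lambda>f p. h p * commutator A g f p)"
  by (auto simp: commutator_def algebra_simps fun_eq_iff)

text \<open>The Jacobi identity, the multiplications by \<open>f\<close> and \<open>g\<close>
  commuting with each other.\<close>

lemma commutator_commute: "commutator (commutator A f) g = commutator (commutator A g) f"
  by (auto simp: commutator_def algebra_simps fun_eq_iff)

lemma diff_oper_add: "diff_oper M k A \<Longrightarrow> diff_oper M k B \<Longrightarrow> diff_oper M k (\<lambda>f p. A f p + B f p)"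
  by (induction k arbitrary: A B) (auto simp: commutator_add linear_oper_add)

lemma diff_oper_fmult: "h \<in> smooth_funs M \<Longrightarrow> diff_oper M k A \<Longrightarrow> diff_oper M k (\<lambda>f p. h p * A f p)"
  by (induction k arbitrary: A) (auto simp: commutator_fmult linear_oper_fmult)

lemma diff_oper_cmult: "diff_oper M k A \<Longrightarrow> diff_oper M k (\<lambda>f p. c * A f p)"
  using diff_oper_fmult[of "\<lambda>p. c"] by simp

lemma diff_oper_zero: "diff_oper M k (\<lambda>f p. 0)"
proof (induction k)
  case (Suc k)
  have "commutator (\<lambda>f p. 0) g = (\<lambda>f p. 0)" for g :: "'m \<Rightarrow> real" by (simp add: commutator_def)
  then show ?case using Suc linear_oper_zero by simp
qed (auto simp: linear_oper_zero commutator_def)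

lemma diff_oper_diff:
  assumes "diff_oper M k A" "diff_oper M k B"
  shows "diff_oper M k (\<lambda>f p. A f p - B f p)"
  using diff_oper_add[OF assms(1) diff_oper_cmult[OF assms(2), of "-1"]] by simp

lemma diff_oper_sum: "(\<And>i. i \<in> I \<Longrightarrow> diff_oper M k (A i)) \<Longrightarrow> diff_oper M k (\<lambda>f p. \<Sum>i\<in>I. A i f p)"
  by (induction I rule: infinite_finite_induct) (auto intro: diff_oper_add diff_oper_zero)

lemma diff_oper_Suc: "diff_oper M k A \<Longrightarrow> diff_oper M (Suc k) A"
proof (induction k arbitrary: A)
  case 0
  have "diff_oper M 0 (commutator A f)" if "f \<in> smooth_funs M" for f
    by (rule diff_oper_cong[OF _ diff_oper_zero]) (use 0 that in auto)
  then show ?case using 0 by auto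
qed auto

text \<open>Rests on [X \<circ> B, f] = X \<circ> [B, f] + X(f) B. By induction on the order of
  \<open>B\<close>, both terms on the right have at most the order of \<open>B\<close>.\<close>

lemma diff_oper_comp:
  assumes X: "X \<in> vfields M" and B: "diff_oper M k B"
  shows "diff_oper M (Suc k) (\<lambda>f p. X p (B f))"
  using B
proof (induction k arbitrary: B)
  have lin: "linear_oper M (\<lambda>f p. X p (B f))" if "linear_oper M B" for B
    using that vfields_smooth[OF X] unfolding linear_oper_def
    by (auto simp: tangent_add[OF vfields_tangent[OF X]] tangent_cmult[OF vfields_tangent[OF X]])
  have comm: "commutator (\<lambda>f p. X p (B f)) f g = (\<lambda>p. X p (commutator B f g) + X p f * B g p)"
    if "linear_oper M B" "f \<in> smooth_funs M" "g \<in> smooth_funs M" for B f g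
  proof
    fix p
    have "X p (commutator B f g) = X p (B (\<lambda>q. f q * g q)) - X p (\<lambda>p. f p * B g p)"
      unfolding commutator_def using that linear_operD(1)[OF that(1)] smooth_mult
      by (intro tangent_diff[OF vfields_tangent[OF X]]) auto
    also have "X p (\<lambda>p. f p * B g p) = f p * X p (B g) + B g p * X p f"
      using that linear_operD(1)[OF that(1)] by (intro tangent_mult[OF vfields_tangent[OF X]]) auto
    finally show "commutator (\<lambda>f p. X p (B f)) f g p = X p (commutator B f g) + X p f * B g p"
      by (simp add: commutator_def)
  qed
  {
    case 0
    have "diff_oper M 0 (commutator (\<lambda>f p. X p (B f)) f)" if f: "f \<in> smooth_funs M" for f
    proof (rule diff_oper_cong[OF _ diff_oper_fmult[OF vfields_smooth[OF X f] 0]])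
      fix g assume g: "g \<in> smooth_funs M"
      have "commutator B f g = (\<lambda>p. 0)" using 0 f g by simp
      then show "(\<lambda>p. X p f * B g p) = commutator (\<lambda>f p. X p (B f)) f g"
        using comm[OF _ f g] 0 tangent_const[OF vfields_tangent[OF X], of _ 0] by simp
    qed
    then show ?case using lin 0 by auto
  next
    case (Suc k)
    have "diff_oper M (Suc k) (commutator (\<lambda>f p. X p (B f)) f)" if f: "f \<in> smooth_funs M" for f
    proof (rule diff_oper_cong)
      show "diff_oper M (Suc k) (\<lambda>g p. X p (commutator B f g) + X p f * B g p)"
        using Suc.IH[of "commutator B f"] Suc.prems f
        by (intro diff_oper_add diff_oper_fmult[OF vfields_smooth[OF X f]]) auto
      show "(\<lambda>p. X p (commutator B f g) + X p f * B g p) = commutator (\<lambda>f p. X p (B f)) f g"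
        if "g \<in> smooth_funs M" for g
        using comm[OF diff_oper_linear[OF Suc.prems] f that] by simp
    qed
    then show ?case using lin[OF diff_oper_linear[OF Suc.prems]] by auto
  }
qed

lemma linear_oper_local:
  assumes "\<And>a. \<exists>B N. linear_oper M B \<and> open N \<and> a \<in> N \<and> (\<forall>f\<in>smooth_funs M. \<forall>p\<in>N. A f p = B f p)"
  shows "linear_oper M A"
  unfolding linear_oper_def
proof (intro conjI ballI allI ext)
  fix f assume f: "f \<in> smooth_funs M"
  show "A f \<in> smooth_funs M"
  proof (rule smooth_funs_local)
    fix a
    obtain B N where "linear_oper M B" "open N" "a \<in> N" "\<forall>f\<in>smooth_funs M. \<forall>p\<in>N. A f p = B f p"
      using assms by blast
    then show "\<exists>g N. g \<in> smooth_funs M \<and> open N \<and> a \<in> N \<and> (\<forall>p\<in>N. A f p = g p)"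
      using f linear_operD(1) by (intro exI[of _ "B f"] exI[of _ N]) auto
  qed
  fix p
  obtain B N where B: "linear_oper M B" "open N" "p \<in> N" "\<forall>f\<in>smooth_funs M. \<forall>p\<in>N. A f p = B f p"
    using assms by blast
  show "A (\<lambda>p. c * f p) p = c * A f p" for c
    using B linear_operD(3)[OF B(1) f] f smooth_cmult by auto
  show "A (\<lambda>p. f p + g p) p = A f p + A g p" if "g \<in> smooth_funs M" for g
    using B linear_operD(2)[OF B(1) f that] f that smooth_add by auto
qed

text \<open>Quantization has an explicit formula only relative to a frame on an open set, so its
  order has to be read off locally.\<close>

lemma diff_oper_local:
  assumes "\<And>a. \<exists>B N. diff_oper M k B \<and> open N \<and> a \<in> N \<and> (\<forall>f\<in>smooth_funs M. \<forall>p\<in>N. A f p = B f p)"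
  shows "diff_oper M k A"
  using assms
proof (induction k arbitrary: A)
  case 0
  have "linear_oper M A" by (rule linear_oper_local) (use 0 in fastforce)
  moreover have "commutator A f g a = 0" if "f \<in> smooth_funs M" "g \<in> smooth_funs M" for f g a
  proof -
    obtain B N where B: "diff_oper M 0 B" "a \<in> N" "\<forall>f\<in>smooth_funs M. \<forall>p\<in>N. A f p = B f p"
      using 0 by blast
    have "commutator A f g a = commutator B f g a"
      using B(2,3) that smooth_mult by (auto simp: commutator_def)
    moreover have "commutator B f g = (\<lambda>p. 0)" using B(1) that by simp
    ultimately show ?thesis by simp
  qed
  ultimately show ?case by auto
next
  case (Suc k)
  have "linear_oper M A" by (rule linear_oper_local) (use Suc.prems diff_oper_linear in blast)
  moreover have "diff_oper M k (commutator A f)" if f: "f \<in> smooth_funs M" for f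
  proof (rule Suc.IH)
    fix a
    obtain B N where B: "diff_oper M (Suc k) B" "open N" "a \<in> N" "\<forall>f\<in>smooth_funs M. \<forall>p\<in>N. A f p =
        B f p"
      using Suc.prems by blast
    have "\<forall>g\<in>smooth_funs M. \<forall>p\<in>N. commutator A f g p = commutator B f g p"
      using B(4) f smooth_mult by (auto simp: commutator_def)
    then show "\<exists>B N. diff_oper M k B \<and> open N \<and> a \<in> N \<and> (\<forall>g\<in>smooth_funs M. \<forall>p\<in>N. commutator A f g
        p = B g p)"
      using B f by (intro exI[of _ "commutator B f"] exI[of _ N]) auto
  qed
  ultimately show ?case by auto
qed

end

section \<open>Iterated commutators and principal symbols\<close>

definition commutators :: "'m oper \<Rightarrow> ('m \<Rightarrow> real) list \<Rightarrow> 'm oper" where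
  "commutators A fs = fold (\<lambda>f B. commutator B f) fs A"

lemma commutators_Nil [simp]: "commutators A [] = A"
  and commutators_Cons [simp]: "commutators A (f # fs) = commutators (commutator A f) fs"
  and commutators_snoc: "commutators A (fs @ [f]) = commutator (commutators A fs) f"
  by (simp_all add: commutators_def)

context manifold begin

lemma commutators_mset: "mset fs = mset gs \<Longrightarrow> commutators A fs = commutators A gs"
  unfolding commutators_def
  by (rule fun_cong[OF fold_multiset_equiv]) (auto simp: commutator_commute fun_eq_iff)

lemma commutators_hd: "commutators A (f # fs) = commutator (commutators A fs) f"
  using commutators_mset[of "f # fs" "fs @ [f]" A] by (simp only: commutators_snoc) simp

lemma commutators_cong:
  assumes "\<And>f. f \<in> smooth_funs M \<Longrightarrow> A f = B f" "set fs \<subseteq> smooth_funs M" "g \<in> smooth_funs M"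
  shows "commutators A fs g = commutators B fs g"
  using assms(1,2)
proof (induction fs arbitrary: A B)
  case (Cons f fs)
  have "commutator A f h = commutator B f h" if "h \<in> smooth_funs M" for h
    using Cons.prems that by (intro commutator_cong) auto
  then show ?case using Cons.IH[of "commutator A f" "commutator B f"] Cons.prems(2) by simp
qed (use assms(3) in simp)

lemma diff_oper_commutators:
  "diff_oper M (length fs + r) A \<Longrightarrow> set fs \<subseteq> smooth_funs M \<Longrightarrow> diff_oper M r (commutators A fs)"
  by (induction fs arbitrary: A) auto

lemma linear_oper_commutators:
  "linear_oper M A \<Longrightarrow> set fs \<subseteq> smooth_funs M \<Longrightarrow> linear_oper M (commutators A fs)"
  by (induction fs arbitrary: A) (auto simp: linear_oper_commutator)

lemma commutators_add:
  "commutators (\<lambda>f p. A f p + B f p) fs = (\<lambda>f p. commutators A fs f p + commutators B fs f p)"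
  by (induction fs arbitrary: A B) (auto simp: commutator_add)

lemma commutators_fmult: "commutators (\<lambda>f p. h p * A f p) fs = (\<lambda>f p. h p * commutators A fs f p)"
  by (induction fs arbitrary: A) (auto simp: commutator_fmult)

lemma commutators_diff:
  "commutators (\<lambda>f p. A f p - B f p) fs = (\<lambda>f p. commutators A fs f p - commutators B fs f p)"
  using commutators_add[of A "\<lambda>f p. (-1) * B f p" fs] commutators_fmult[of "\<lambda>p. -1" B fs] by simp

lemma commutators_zero: "commutators (\<lambda>f p. 0) fs = (\<lambda>f p. 0)"
  using commutators_fmult[of "\<lambda>p. 0" "\<lambda>f p. 0" fs] by simp

lemma commutators_sum:
  "commutators (\<lambda>f p. \<Sum>i\<in>I. A i f p) fs = (\<lambda>f p. \<Sum>i\<in>I. commutators (A i) fs f p)"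
  by (induction I rule: infinite_finite_induct) (auto simp: commutators_zero commutators_add)

lemma commutators_vanish:
  assumes "diff_oper M k A" "set fs \<subseteq> smooth_funs M" "length fs > k" "g \<in> smooth_funs M"
  shows "commutators A fs g = (\<lambda>p. 0)"
  using assms
proof (induction fs arbitrary: A k)
  case (Cons f fs)
  show ?case
  proof (cases k)
    case 0
    have "commutator A f h = (\<lambda>p. 0)" if "h \<in> smooth_funs M" for h using Cons.prems that 0 by simp
    then have "commutators (commutator A f) fs g = commutators (\<lambda>f p. 0) fs g"
      using Cons.prems by (intro commutators_cong) auto
    then show ?thesis by (simp add: commutators_zero)
  next
    case (Suc j)
    then show ?thesis using Cons by auto
  qed
qed simp

lemma order_zero_oper:
  assumes "diff_oper M 0 A" "g \<in> smooth_funs M"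
  shows "A g p = g p * A (\<lambda>p. 1) p"
proof -
  have "commutator A g (\<lambda>p. 1) = (\<lambda>p. 0)" using assms by simp
  from fun_cong[OF this, of p] show ?thesis by (simp add: commutator_def)
qed

text \<open>The vector field part of an operator of order at most 1, extracted by applying its
  commutator with \<open>f\<close> to the function 1. The value 0 on non-smooth functions is again
  the convention of \<open>tangent_space\<close>.\<close>

definition deriv_of :: "'m oper \<Rightarrow> 'm vfield" where
  "deriv_of B a f = (if f \<in> smooth_funs M then commutator B f (\<lambda>p. 1) a else 0)"

text \<open>As [B, f] has order 0, it is multiplication by a function; this turns the commutator
  with a product into the Leibniz rule.\<close>

lemma deriv_of_tangent:
  assumes B: "diff_oper M (Suc 0) B"
  shows "deriv_of B a \<in> tangent_space M a"
proof -
  note L = linear_operD[OF diff_oper_linear[OF B]]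
  have "commutator B (\<lambda>p. f p * g p) (\<lambda>p. 1) a = f a * commutator B g (\<lambda>p. 1) a + g a * commutator
      B f (\<lambda>p. 1) a"
    if "f \<in> smooth_funs M" "g \<in> smooth_funs M" for f g
  proof -
    have "diff_oper M 0 (commutator B f)" using B that by (simp del: diff_oper.simps(1))
    from order_zero_oper[OF this that(2), of a] show ?thesis
        by (simp add: commutator_def algebra_simps)
  qed
  moreover have "commutator B (\<lambda>p. f p + g p) (\<lambda>p. 1) a = commutator B f (\<lambda>p. 1) a + commutator B
      g (\<lambda>p. 1) a"
    if "f \<in> smooth_funs M" "g \<in> smooth_funs M" for f g
    using L(2)[OF that] by (simp add: commutator_def algebra_simps)
  moreover have "commutator B (\<lambda>p. c * f p) (\<lambda>p. 1) a = c * commutator B f (\<lambda>p. 1) a"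
    if "f \<in> smooth_funs M" for f c
    using L(3)[OF that] by (simp add: commutator_def right_diff_distrib)
  ultimately show ?thesis
    by (simp add: tangent_space_def deriv_of_def smooth_add smooth_mult smooth_cmult)
qed

text \<open>Commutators may be taken in any order, so \<open>f\<close> can come last; by then the
  others have reduced \<open>A\<close> to order at most 1, where the commutator is a derivation in
  \<open>f\<close>.\<close>

lemma commutators_deriv_of:
  assumes "diff_oper M (Suc (length fs)) A" "set fs \<subseteq> smooth_funs M" "f \<in> smooth_funs M"
  shows "commutators A (f # fs) (\<lambda>p. 1) a = deriv_of (commutators A fs) a f"
    "deriv_of (commutators A fs) a \<in> tangent_space M a"
  using assms diff_oper_commutators[of fs "Suc 0" A]
  by (auto simp: commutators_hd deriv_of_def deriv_of_tangent simp del: commutators_Cons)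

text \<open>Tangent vectors are derivations, and an iterated commutator of full length is a derivation in
  each of its functions. So it depends on their differentials only, without any Taylor expansion.\<close>

lemma commutators_dfun_cong:
  assumes "diff_oper M (length fs) A" "set fs \<subseteq> smooth_funs M" "set gs \<subseteq> smooth_funs M"
    and "map (dfun M a) fs = map (dfun M a) gs"
  shows "commutators A fs (\<lambda>p. 1) a = commutators A gs (\<lambda>p. 1) a"
  using assms
proof (induction fs arbitrary: gs A)
  case (Cons f fs)
  obtain g gs' where gs: "gs = g # gs'" using Cons.prems(4) by (cases gs) auto
  have len: "length gs' = length fs" using map_eq_imp_length_eq[OF Cons.prems(4)] gs by simp
  have A: "diff_oper M (Suc (length gs')) A" using Cons.prems len by simp
  have "commutators A (f # fs) (\<lambda>p. 1) a = commutators A (f # gs') (\<lambda>p. 1) a"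
    using Cons gs by simp
  also have "\<dots> = deriv_of (commutators A gs') a f"
    using commutators_deriv_of[OF A] Cons.prems gs by simp
  also have "\<dots> = deriv_of (commutators A gs') a g"
  proof -
    have w: "deriv_of (commutators A gs') a \<in> tangent_space M a"
      using commutators_deriv_of(2)[OF A, of g] Cons.prems gs by simp
    have "dfun M a f = dfun M a g" using Cons.prems(4) gs by simp
    then show ?thesis using dfun_apply[OF w, of f] dfun_apply[OF w, of g] by simp
  qed
  also have "\<dots> = commutators A (g # gs') (\<lambda>p. 1) a"
    using commutators_deriv_of[OF A] Cons.prems gs by simp
  finally show ?case using gs by simp
qed simp

text \<open>Frees \<open>symbol\<close> from its \<open>SOME\<close>: the representatives chosen
  there may be exchanged for any functions with the same differentials.\<close>

lemma symbol_dfun: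
  assumes "diff_oper M k A" "set fs \<subseteq> smooth_funs M" "length fs = k"
  shows "symbol M k A a (map (dfun M a) fs) = commutators A fs (\<lambda>p. 1) a / fact k"
proof -
  define s where "s \<eta> = (SOME f. f \<in> smooth_funs M \<and> dfun M a f = \<eta>)" for \<eta>
  have s: "s (dfun M a f) \<in> smooth_funs M \<and> dfun M a (s (dfun M a f)) = dfun M a f"
      if "f \<in> smooth_funs M" for f
    using that someI[of "\<lambda>g. g \<in> smooth_funs M \<and> dfun M a g = dfun M a f" f] by (simp add: s_def)
  have "symbol M k A a (map (dfun M a) fs) = commutators A (map (\<lambda>f. s (dfun M a f)) fs) (\<lambda>p. 1) a
      / fact k"
    using assms(3) dfun_cotangent
    by (auto simp: symbol_def commutators_def fold_map comp_def s_def)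
  also have "commutators A (map (\<lambda>f. s (dfun M a f)) fs) (\<lambda>p. 1) a = commutators A fs (\<lambda>p. 1) a"
    using assms s by (intro commutators_dfun_cong) auto
  finally show ?thesis .
qed

lemma symbol_outside: "\<not> (length \<eta>s = k \<and> set \<eta>s \<subseteq> cotangent_space M a) \<Longrightarrow> symbol M k A a \<eta>s = 0"
  by (auto simp: symbol_def)

lemma symbol_mset:
  assumes "mset \<eta>s = mset \<zeta>s"
  shows "symbol M k A a \<eta>s = symbol M k A a \<zeta>s"
proof -
  have "fold (\<lambda>\<xi> B. commutator B (s \<xi>)) \<eta>s = fold (\<lambda>\<xi> B. commutator B (s \<xi>)) \<zeta>s"
      for s :: "'m covec \<Rightarrow> 'm \<Rightarrow> real"
    using assms by (intro fold_multiset_equiv) (auto simp: commutator_commute fun_eq_iff)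
  then show ?thesis
    using mset_eq_length[OF assms] mset_eq_setD[OF assms] by (simp add: symbol_def)
qed

text \<open>With all covectors but one fixed, the symbol evaluates the remaining covector at a
  single tangent vector \<open>?w\<close> and divides by k!, which is visibly linear.\<close>

lemma mlin_symbol:
  assumes A: "diff_oper M k A"
  shows "mlin (cotangent_space M a) k (symbol M k A a)"
  unfolding mlin_def
proof (intro allI impI)
  fix xs ys assume *: "set xs \<union> set ys \<subseteq> cotangent_space M a \<and> Suc (length xs + length ys) = k"
  then have V: "set xs \<union> set ys \<subseteq> cotangent_space M a" and k: "k = Suc (length xs + length ys)" by
      auto
  obtain fs where fs: "set fs \<subseteq> smooth_funs M" "map (dfun M a) fs = xs @ ys"
    using dfun_surj_list[of "xs @ ys"] V by auto
  have len: "Suc (length fs) = k" using arg_cong[OF fs(2), of length] k by simp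
  let ?w = "deriv_of (commutators A fs) a"
  have w: "?w \<in> tangent_space M a" using commutators_deriv_of(2)[of fs A "\<lambda>p. 0"] A len fs(1) by
      simp
  have "symbol M k A a (xs @ \<eta> # ys) = \<eta> ?w / fact k" if \<eta>: "\<eta> \<in> cotangent_space M a" for \<eta>
  proof -
    obtain f where f: "f \<in> smooth_funs M" "dfun M a f = \<eta>" using dfun_surj[OF \<eta>] .
    have "symbol M k A a (xs @ \<eta> # ys) = symbol M k A a (map (dfun M a) (f # fs))"
      by (rule symbol_mset) (use f fs in simp)
    also have "\<dots> = commutators A (f # fs) (\<lambda>p. 1) a / fact k"
      by (rule symbol_dfun) (use A f fs len in auto)
    also have "\<dots> = \<eta> ?w / fact k"
      using commutators_deriv_of(1)[of fs A f a] A len fs(1) f dfun_apply[OF w, of f] by simp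
    finally show ?thesis .
  qed
  then show "lin (cotangent_space M a) (\<lambda>\<eta>. symbol M k A a (xs @ \<eta> # ys))"
    using fspace_cotangent[of a] by (auto simp: lin_def fspace_def add_divide_distrib)
qed

text \<open>After \<open>k + 1\<close> commutators an operator of order at most \<open>k + 1\<close>
  is multiplication by its value on the function 1. If that value is zero, so is the operator, which
  is what order at most \<open>k\<close> requires.\<close>

lemma diff_oper_reduce:
  assumes "diff_oper M (Suc k) D"
    and "\<And>fs a. set fs \<subseteq> smooth_funs M \<Longrightarrow> length fs = Suc k \<Longrightarrow> commutators D fs (\<lambda>p. 1) a = 0"
  shows "diff_oper M k D"
  using assms
proof (induction k arbitrary: D)
  case 0
  have "commutator D f g p = 0" if "f \<in> smooth_funs M" "g \<in> smooth_funs M" for f g p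
    using order_zero_oper[of "commutator D f" g p] 0(1) 0(2)[of "[f]" p] that by simp
  then show ?case using 0(1) by auto
next
  case (Suc k)
  have "diff_oper M k (commutator D f)" if f: "f \<in> smooth_funs M" for f
  proof (rule Suc.IH)
    show "diff_oper M (Suc k) (commutator D f)" using Suc.prems(1) f by simp
    show "commutators (commutator D f) fs (\<lambda>p. 1) a = 0"
        if "set fs \<subseteq> smooth_funs M" "length fs = Suc k" for fs a
      using Suc.prems(2)[of "f # fs" a] f that by simp
  qed
  then show ?case using Suc.prems(1) by auto
qed

end

section \<open>Covariant differentials\<close>

lemma mlin_update:
  assumes "mlin V k F" "set vs \<subseteq> V" "length vs = k" "j < k"
  shows "lin V (\<lambda>v. F (vs[j := v]))"
proof -
  have "set (take j vs) \<union> set (drop (Suc j) vs) \<subseteq> V"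
    using assms(2) set_take_subset[of j vs] set_drop_subset[of "Suc j" vs] by blast
  moreover have "Suc (length (take j vs) + length (drop (Suc j) vs)) = k" using assms(3,4) by simp
  ultimately have "lin V (\<lambda>v. F (take j vs @ v # drop (Suc j) vs))"
      using assms(1) unfolding mlin_def by blast
  then show ?thesis using assms(3,4) by (simp add: upd_conv_take_nth_drop)
qed

lemma permute_list_update:
  assumes "\<pi> permutes {..<length zs}" "m < length zs"
  shows "permute_list \<pi> (zs[m := v]) = (permute_list \<pi> zs)[inv \<pi> m := v]"
proof (rule nth_equalityI)
  fix i assume i: "i < length (permute_list \<pi> (zs[m := v]))"
  have "\<pi> i < length zs" using i permutes_in_image[OF assms(1), of i] by simp
  moreover have iff: "inv \<pi> m = i \<longleftrightarrow> \<pi> i = m" using permutes_inverses[OF assms(1)] by metis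
  ultimately show "permute_list \<pi> (zs[m := v]) ! i = (permute_list \<pi> zs)[inv \<pi> m := v] ! i"
  proof (cases "\<pi> i = m")
    case True
    then have "inv \<pi> m = i" "(zs[m := v]) ! \<pi> i = v" using iff assms(2) by simp_all
    then show ?thesis using i assms(1) by (simp add: permute_list_nth)
  qed (use assms i iff in \<open>simp add: permute_list_nth\<close>)
qed simp

text \<open>Permuting the arguments moves the free slot from \<open>length xs\<close> to
  \<open>inv \<pi> (length xs)\<close>. The vector \<open>v0\<close> is only a placeholder in that
  slot.\<close>

lemma mlin_permute:
  assumes "mlin V k F" "\<pi> permutes {..<k}"
  shows "mlin V k (\<lambda>vs. F (permute_list \<pi> vs))"
  unfolding mlin_def
proof (intro allI impI)
  fix xs ys assume *: "set xs \<union> set ys \<subseteq> V \<and> Suc (length xs + length ys) = k"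
  show "lin V (\<lambda>v. F (permute_list \<pi> (xs @ v # ys)))"
  proof (cases "V = {}")
    case False
    then obtain v0 where v0: "v0 \<in> V" by blast
    define zs where "zs = xs @ v0 # ys"
    have k: "length zs = k" using * by (simp add: zs_def)
    have zs: "set (permute_list \<pi> zs) \<subseteq> V" using * v0 assms(2) k by (simp add: zs_def)
    have m: "inv \<pi> (length xs) < k"
      using permutes_in_image[OF permutes_inv[OF assms(2)], of "length xs"] * by auto
    have "permute_list \<pi> (xs @ v # ys) = (permute_list \<pi> zs)[inv \<pi> (length xs) := v]" for v
      using permute_list_update[of \<pi> zs "length xs" v] assms(2) k * by (simp add: zs_def)
    then show ?thesis using mlin_update[OF assms(1) zs _ m] k by simp
  qed (simp add: lin_def)
qed

lemma lin_zero_fun: "lin V (\<lambda>v. 0)"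
  by (simp add: lin_def)

lemma lin_plus: "lin V f \<Longrightarrow> lin V g \<Longrightarrow> lin V (\<lambda>v. f v + g v)"
  by (simp add: lin_def algebra_simps)

lemma lin_scale: "lin V f \<Longrightarrow> lin V (\<lambda>v. c * f v)"
  by (simp add: lin_def algebra_simps)

lemma lin_setsum: "(\<And>i. i \<in> I \<Longrightarrow> lin V (f i)) \<Longrightarrow> lin V (\<lambda>v. \<Sum>i\<in>I. f i v)"
  by (induction I rule: infinite_finite_induct) (auto intro: lin_plus lin_zero_fun)

lemma mlin_symmetrize:
  assumes "mlin V k (T a)"
  shows "mlin V k (symmetrization T a)"
  unfolding mlin_def
proof (intro allI impI)
  fix xs ys assume *: "set xs \<union> set ys \<subseteq> V \<and> Suc (length xs + length ys) = k"
  have "lin V (\<lambda>v. (1 / fact k) * (\<Sum>\<pi> | \<pi> permutes {..<k}. T a (permute_list \<pi> (xs @ v # ys))))"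
    using mlin_permute[OF assms] * unfolding mlin_def by (intro lin_scale lin_setsum) auto
  then show "lin V (\<lambda>v. symmetrization T a (xs @ v # ys))"
    using * by (simp add: symmetrization_def)
qed

abbreviation at_point :: "'m vfield list \<Rightarrow> 'm \<Rightarrow> 'm tvec list" where
  "at_point Ys a \<equiv> map (\<lambda>Y. Y a) Ys"

context manifold begin

text \<open>Smoothness is tested on vector fields. Symmetry is not demanded, because a covariant
  differential is not symmetric before \<open>symmetrization\<close> is applied.\<close>

definition cov_tensor :: "nat \<Rightarrow> 'm cov_field \<Rightarrow> bool" where
  "cov_tensor k T \<longleftrightarrow> (\<forall>a. mlin (tangent_space M a) k (T a)) \<and>
     (\<forall>Ys. set Ys \<subseteq> vfields M \<and> length Ys = k \<longrightarrow> (\<lambda>p. T p (at_point Ys p)) \<in> smooth_funs M)"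

lemma at_point_tangent: "set Ys \<subseteq> vfields M \<Longrightarrow> set (at_point Ys a) \<subseteq> tangent_space M a"
  using vfields_tangent by auto

lemma extend_list:
  assumes "set vs \<subseteq> tangent_space M a"
  shows "set (map (extend M a) vs) \<subseteq> vfields M" "at_point (map (extend M a) vs) a = vs"
proof -
  have "(extend M a v) a = v" if "v \<in> set vs" for v using assms that extend_at by blast
  then show "at_point (map (extend M a) vs) a = vs" by (simp add: comp_def map_idI)
qed (use assms extend_vfield in auto)

end

section \<open>Tensoriality of the covariant derivative of a tensor field\<close>

locale connection = manifold M
  for M :: "('m::{t2_space,second_countable_topology}, 'n::finite) atlas" +
  fixes nab :: "'m conn"
  assumes conn: "affine_connection M nab"
begin

lemma conn_vfield [intro]: "X \<in> vfields M \<Longrightarrow> Y \<in> vfields M \<Longrightarrow> nab X Y \<in> vfields M"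
  using conn unfolding affine_connection_def by (elim conjE) simp

lemma conn_add1: "X \<in> vfields M \<Longrightarrow> X' \<in> vfields M \<Longrightarrow> Y \<in> vfields M \<Longrightarrow>
    nab (\<lambda>a h. X a h + X' a h) Y = (\<lambda>a h. nab X Y a h + nab X' Y a h)"
  using conn unfolding affine_connection_def by (elim conjE) simp

lemma conn_fmult1: "f \<in> smooth_funs M \<Longrightarrow> X \<in> vfields M \<Longrightarrow> Y \<in> vfields M \<Longrightarrow>
    nab (\<lambda>a h. f a * X a h) Y = (\<lambda>a h. f a * nab X Y a h)"
  using conn unfolding affine_connection_def by (elim conjE) simp

lemma conn_add2: "X \<in> vfields M \<Longrightarrow> Y \<in> vfields M \<Longrightarrow> Y' \<in> vfields M \<Longrightarrow>
    nab X (\<lambda>a h. Y a h + Y' a h) = (\<lambda>a h. nab X Y a h + nab X Y' a h)"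
  using conn unfolding affine_connection_def by (elim conjE) simp

lemma conn_fmult2: "f \<in> smooth_funs M \<Longrightarrow> X \<in> vfields M \<Longrightarrow> Y \<in> vfields M \<Longrightarrow>
    nab X (\<lambda>a h. f a * Y a h) = (\<lambda>a h. X a f * Y a h + f a * nab X Y a h)"
  using conn unfolding affine_connection_def by (elim conjE) simp

text \<open>The covariant derivative computed with given vector fields.
  \<open>cov_differential\<close> is this expression for the extensions chosen by
  \<open>extend\<close>, and tensoriality removes the choice.\<close>

definition cd :: "'m cov_field \<Rightarrow> 'm vfield \<Rightarrow> 'm vfield list \<Rightarrow> 'm \<Rightarrow> real" where
  "cd T X Ys a = X a (\<lambda>p. T p (at_point Ys p)) -
     (\<Sum>j<length Ys. T a ((at_point Ys a)[j := nab X (Ys ! j) a]))"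

context
  fixes k T
  assumes T: "cov_tensor k T"
begin

lemma tensor_smooth: "set Ys \<subseteq> vfields M \<Longrightarrow> length Ys = k \<Longrightarrow> (\<lambda>p. T p (at_point Ys p)) \<in> smooth_funs
    M"
  using T unfolding cov_tensor_def by blast

lemma tensor_slot: "set vs \<subseteq> tangent_space M a \<Longrightarrow> length vs = k \<Longrightarrow> j < k \<Longrightarrow>
    lin (tangent_space M a) (\<lambda>v. T a (vs[j := v]))"
  using T mlin_update unfolding cov_tensor_def by blast

lemma cd_add1:
  assumes "X \<in> vfields M" "X' \<in> vfields M" "set Ys \<subseteq> vfields M" "length Ys = k"
  shows "cd T (\<lambda>p f. X p f + X' p f) Ys a = cd T X Ys a + cd T X' Ys a"
proof -
  have "T a ((at_point Ys a)[j := nab (\<lambda>p f. X p f + X' p f) (Ys ! j) a]) =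
      T a ((at_point Ys a)[j := nab X (Ys ! j) a]) + T a ((at_point Ys a)[j := nab X' (Ys ! j) a])"
    if "j < k" for j
  proof -
    have Y: "Ys ! j \<in> vfields M" using assms that by auto
    show ?thesis
      using lin_add[OF tensor_slot[OF at_point_tangent[OF assms(3), of a] _ that]] assms Y
        vfields_tangent conn_vfield by (simp add: conn_add1)
  qed
  then have "(\<Sum>j<k. T a ((at_point Ys a)[j := nab (\<lambda>p f. X p f + X' p f) (Ys ! j) a])) =
      (\<Sum>j<k. T a ((at_point Ys a)[j := nab X (Ys ! j) a])) +
      (\<Sum>j<k. T a ((at_point Ys a)[j := nab X' (Ys ! j) a]))"
    by (simp add: sum.distrib)
  then show ?thesis using assms(4) by (simp add: cd_def)
qed

lemma cd_fmult1:
  assumes "h \<in> smooth_funs M" "X \<in> vfields M" "set Ys \<subseteq> vfields M" "length Ys = k"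
  shows "cd T (\<lambda>p f. h p * X p f) Ys a = h a * cd T X Ys a"
proof -
  have "T a ((at_point Ys a)[j := nab (\<lambda>p f. h p * X p f) (Ys ! j) a]) =
      h a * T a ((at_point Ys a)[j := nab X (Ys ! j) a])"
    if "j < k" for j
  proof -
    have Y: "Ys ! j \<in> vfields M" using assms that by auto
    show ?thesis
      using lin_cmult[OF tensor_slot[OF at_point_tangent[OF assms(3), of a] _ that]] assms Y
        vfields_tangent conn_vfield by (simp add: conn_fmult1)
  qed
  then have "(\<Sum>j<k. T a ((at_point Ys a)[j := nab (\<lambda>p f. h p * X p f) (Ys ! j) a])) =
      h a * (\<Sum>j<k. T a ((at_point Ys a)[j := nab X (Ys ! j) a]))"
    by (simp add: sum_distrib_left)
  then show ?thesis using assms(4) by (simp add: cd_def right_diff_distrib)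
qed

text \<open>Separates the three ways in which the field in slot \<open>m\<close> enters: through the
  derivative along \<open>X\<close>, through its own covariant derivative, and as a mere argument in
  the other summands.\<close>

lemma cd_slot:
  assumes "X \<in> vfields M" "set Ys \<subseteq> vfields M" "length Ys = k" "m < k" "Y \<in> vfields M"
  shows "cd T X (Ys[m := Y]) a = X a (\<lambda>p. T p ((at_point Ys p)[m := Y p])) -
      (T a ((at_point Ys a)[m := nab X Y a]) +
       (\<Sum>j\<in>{..<k} - {m}. T a ((at_point Ys a)[j := nab X (Ys ! j) a, m := Y a])))"
proof -
  have "(\<Sum>j<k. T a ((at_point (Ys[m := Y]) a)[j := nab X (Ys[m := Y] ! j) a])) =
     T a ((at_point Ys a)[m := nab X Y a]) +
     (\<Sum>j\<in>{..<k} - {m}. T a ((at_point (Ys[m := Y]) a)[j := nab X (Ys[m := Y] ! j) a]))"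
    using assms by (subst sum.remove[of _ m]) (auto simp: map_update)
  also have "(\<Sum>j\<in>{..<k} - {m}. T a ((at_point (Ys[m := Y]) a)[j := nab X (Ys[m := Y] ! j) a])) =
      (\<Sum>j\<in>{..<k} - {m}. T a ((at_point Ys a)[j := nab X (Ys ! j) a, m := Y a]))"
    by (rule sum.cong[OF refl]) (auto simp: map_update list_update_swap)
  finally show ?thesis using assms by (simp add: cd_def map_update)
qed

lemma tensor_update_smooth:
  assumes "set Ys \<subseteq> vfields M" "length Ys = k" "Y \<in> vfields M"
  shows "(\<lambda>p. T p ((at_point Ys p)[m := Y p])) \<in> smooth_funs M"
  using tensor_smooth[of "Ys[m := Y]"] assms set_update_subset_insert[of Ys m Y]
  by (simp add: map_update) blast

lemma tensor_slots:
  assumes "set Ys \<subseteq> vfields M" "length Ys = k" "Y \<in> vfields M" "m < k"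
  shows "lin (tangent_space M a) (\<lambda>v. T a ((at_point Ys a)[j := Y a, m := v]))"
  using at_point_tangent[of "Ys[j := Y]" a] assms set_update_subset_insert[of Ys j Y]
  by (intro tensor_slot) (auto simp: map_update)

lemma cd_add2:
  assumes X: "X \<in> vfields M" and Ys: "set Ys \<subseteq> vfields M" "length Ys = k" and m: "m < k"
    and Y: "Y \<in> vfields M" "Y' \<in> vfields M"
  shows "cd T X (Ys[m := (\<lambda>p f. Y p f + Y' p f)]) a = cd T X (Ys[m := Y]) a + cd T X (Ys[m := Y'])
      a"
proof -
  note l = lin_add[OF tensor_slot[OF at_point_tangent[OF Ys(1)]]]
  have "(\<lambda>p. T p ((at_point Ys p)[m := \<lambda>f. Y p f + Y' p f])) =
      (\<lambda>p. T p ((at_point Ys p)[m := Y p]) + T p ((at_point Ys p)[m := Y' p]))"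
    using l Ys m Y vfields_tangent by (intro ext) simp
  then have 1: "X a (\<lambda>p. T p ((at_point Ys p)[m := \<lambda>f. Y p f + Y' p f])) =
      X a (\<lambda>p. T p ((at_point Ys p)[m := Y p])) + X a (\<lambda>p. T p ((at_point Ys p)[m := Y' p]))"
    using tangent_add[OF vfields_tangent[OF X]] tensor_update_smooth[OF Ys] Y by simp
  have 2: "T a ((at_point Ys a)[m := nab X (\<lambda>p f. Y p f + Y' p f) a]) =
      T a ((at_point Ys a)[m := nab X Y a]) + T a ((at_point Ys a)[m := nab X Y' a])"
    unfolding conn_add2[OF X Y]
    using l[of a m "nab X Y a" "nab X Y' a"] Ys m vfields_tangent[OF conn_vfield[OF X Y(1)]]
      vfields_tangent[OF conn_vfield[OF X Y(2)]] by simp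
  have 3: "T a ((at_point Ys a)[j := nab X (Ys ! j) a, m := \<lambda>f. Y a f + Y' a f]) =
      T a ((at_point Ys a)[j := nab X (Ys ! j) a, m := Y a]) +
      T a ((at_point Ys a)[j := nab X (Ys ! j) a, m := Y' a])" if "j < k" for j
    using lin_add[OF tensor_slots[OF Ys _ m]] X Y Ys that vfields_tangent conn_vfield
        by (auto simp: subset_iff)
  show ?thesis
    using assms 1 2 3 by (simp add: cd_slot vfields_add sum.distrib)
qed

text \<open>Differentiating the value of the tensor produces a term X(h) T(..., Y, ...), and the
  Leibniz rule of the connection in slot \<open>m\<close> produces the same term; the two
  cancel.\<close>

lemma cd_fmult2:
  assumes X: "X \<in> vfields M" and Ys: "set Ys \<subseteq> vfields M" "length Ys = k" and m: "m < k"
    and h: "h \<in> smooth_funs M" and Y: "Y \<in> vfields M"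
  shows "cd T X (Ys[m := (\<lambda>p f. h p * Y p f)]) a = h a * cd T X (Ys[m := Y]) a"
proof -
  note l = tensor_slot[OF at_point_tangent[OF Ys(1)]]
  have "(\<lambda>p. T p ((at_point Ys p)[m := \<lambda>f. h p * Y p f])) = (\<lambda>p. h p * T p ((at_point Ys p)[m := Y
      p]))"
    using lin_cmult[OF l] Ys m Y vfields_tangent by (intro ext) simp
  then have 1: "X a (\<lambda>p. T p ((at_point Ys p)[m := \<lambda>f. h p * Y p f])) =
      h a * X a (\<lambda>p. T p ((at_point Ys p)[m := Y p])) + T a ((at_point Ys a)[m := Y a]) * X a h"
    using tangent_mult[OF vfields_tangent[OF X] h tensor_update_smooth[OF Ys Y]] by simp
  have 2: "T a ((at_point Ys a)[m := nab X (\<lambda>p f. h p * Y p f) a]) =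
      X a h * T a ((at_point Ys a)[m := Y a]) + h a * T a ((at_point Ys a)[m := nab X Y a])"
    unfolding conn_fmult2[OF h X Y]
    using lin_add[OF l, of a m "\<lambda>f. X a h * Y a f" "\<lambda>f. h a * nab X Y a f"] lin_cmult[OF l, of a
        m] Ys m
      tangent_space_cmult[OF vfields_tangent] X Y vfields_tangent conn_vfield by simp
  have 3: "T a ((at_point Ys a)[j := nab X (Ys ! j) a, m := \<lambda>f. h a * Y a f]) =
      h a * T a ((at_point Ys a)[j := nab X (Ys ! j) a, m := Y a])" if "j < k" for j
    using lin_cmult[OF tensor_slots[OF Ys _ m]] X Y Ys that vfields_tangent conn_vfield
        by (auto simp: subset_iff)
  have 4: "(\<Sum>j\<in>{..<k} - {m}. T a ((at_point Ys a)[j := nab X (Ys ! j) a, m := \<lambda>f. h a * Y a f])) =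
      h a * (\<Sum>j\<in>{..<k} - {m}. T a ((at_point Ys a)[j := nab X (Ys ! j) a, m := Y a]))"
    unfolding sum_distrib_left using 3 by (intro sum.cong) auto
  show ?thesis
    unfolding cd_slot[OF X Ys m vfields_fmult[OF h Y]] cd_slot[OF X Ys m Y] 1 2 4
    by (simp add: algebra_simps)
qed

text \<open>The fields are exchanged one at a time, with \<open>tensorial\<close> applied to each
  slot; in the hybrid list \<open>Z n\<close> the first \<open>n\<close> of them are already
  exchanged.\<close>

lemma cd_cong:
  assumes X: "X \<in> vfields M" "X' \<in> vfields M" "X a = X' a"
    and Ys: "set Ys \<subseteq> vfields M" "length Ys = k"
    and Ys': "set Ys' \<subseteq> vfields M" "at_point Ys a = at_point Ys' a"
  shows "cd T X Ys a = cd T X' Ys' a"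
proof -
  have len: "length Ys' = k" using map_eq_imp_length_eq[OF Ys'(2)] Ys(2) by simp
  have 1: "cd T X Ys a = cd T X' Ys a"
    by (rule tensorial[where F = "\<lambda>X. cd T X Ys a", OF _ _ X]) (use cd_add1 cd_fmult1 Ys in auto)
  define Z where "Z n = take n Ys' @ drop n Ys" for n
  have Z: "set (Z n) \<subseteq> vfields M" "length (Z n) = k" if "n \<le> k" for n
    using Ys Ys'(1) len that set_take_subset[of n Ys'] set_drop_subset[of n Ys]
        by (auto simp: Z_def)
  have step: "cd T X' (Z n) a = cd T X' (Z (Suc n)) a" if n: "n < k" for n
  proof -
    have i: "Ys ! n \<in> vfields M" "Ys' ! n \<in> vfields M" using n Ys Ys'(1) len by auto
    have at: "(Ys ! n) a = (Ys' ! n) a"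
      using arg_cong[OF Ys'(2), of "\<lambda>l. l ! n"] n Ys(2) len by simp
    have "Z n ! n = Ys ! n" using n Ys(2) len by (simp add: Z_def nth_append)
    then have e1: "Z n = (Z n)[n := Ys ! n]" by (metis list_update_id)
    have e2: "Z (Suc n) = (Z n)[n := Ys' ! n]"
      using n Ys(2) len by (simp add: Z_def list_update_append take_Suc_conv_app_nth
          Cons_nth_drop_Suc[symmetric])
    have "cd T X' ((Z n)[n := Ys ! n]) a = cd T X' ((Z n)[n := Ys' ! n]) a"
      by (rule tensorial[where F = "\<lambda>Y. cd T X' ((Z n)[n := Y]) a", OF _ _ i at])
        (use cd_add2[OF X(2) Z] cd_fmult2[OF X(2) Z] n in auto)
    then show ?thesis using e1 e2 by simp
  qed
  have "cd T X' (Z 0) a = cd T X' (Z n) a" if "n \<le> k" for n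
    using that step by (induction n) auto
  from this[of k] have "cd T X' Ys a = cd T X' Ys' a" using len Ys(2) by (simp add: Z_def)
  with 1 show ?thesis by simp
qed

lemma cov_differential_eq:
  assumes X: "X \<in> vfields M" and Ys: "set Ys \<subseteq> vfields M" "length Ys = k"
  shows "cov_differential M nab T a (X a # at_point Ys a) = cd T X Ys a"
proof -
  note e = extend_list[OF at_point_tangent[OF Ys(1), of a]]
  have "cov_differential M nab T a (X a # at_point Ys a) =
      cd T (extend M a (X a)) (map (extend M a) (at_point Ys a)) a"
    unfolding cov_differential_def cd_def Let_def e(2) by (simp add: comp_def)
  also have "\<dots> = cd T X Ys a"
    using e extend_vfield[OF vfields_tangent[OF X, of a]] extend_at[OF vfields_tangent[OF X, of
        a]] Ys
    by (intro cd_cong X) auto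
  finally show ?thesis .
qed

lemma cd_smooth:
  assumes X: "X \<in> vfields M" and Ys: "set Ys \<subseteq> vfields M" "length Ys = k"
  shows "cd T X Ys \<in> smooth_funs M"
proof -
  have "(\<lambda>a. X a (\<lambda>p. T p (at_point Ys p)) - (\<Sum>j<k. T a ((at_point Ys a)[j := nab X (Ys ! j) a])))
      \<in> smooth_funs M"
    using Ys by (intro smooth_diff smooth_sum vfields_smooth[OF X] tensor_smooth
        tensor_update_smooth conn_vfield X) auto
  then show ?thesis using Ys(2) by (simp add: cd_def[abs_def])
qed

text \<open>Vectors are extended to fields, for which \<open>cd\<close> is additive and homogeneous.
  Since the extension does not matter, the sum of two extensions may be used in place of the chosen
  extension of the sum.\<close>

lemma cov_tensor_cov_differential: "cov_tensor (Suc k) (cov_differential M nab T)"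
  unfolding cov_tensor_def
proof (intro conjI allI impI)
  fix Ys assume *: "set Ys \<subseteq> vfields M \<and> length Ys = Suc k"
  then obtain X Zs where "Ys = X # Zs" by (cases Ys) auto
  then show "(\<lambda>p. cov_differential M nab T p (at_point Ys p)) \<in> smooth_funs M"
    using cov_differential_eq cd_smooth * by simp
next
  fix a
  let ?V = "tangent_space M a" and ?D = "cov_differential M nab T a" and ?e = "extend M a"
  have D: "?D (X a # at_point Ys a) = cd T X Ys a"
    if "X \<in> vfields M" "set Ys \<subseteq> vfields M" "length Ys = k" for X Ys
    using cov_differential_eq that by blast
  show "mlin ?V (Suc k) ?D"
    unfolding mlin_def
  proof (intro allI impI)
    fix xs ys assume *: "set xs \<union> set ys \<subseteq> ?V \<and> Suc (length xs + length ys) = Suc k"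
    show "lin ?V (\<lambda>v. ?D (xs @ v # ys))"
    proof (cases xs)
      case Nil
      define Ys where "Ys = map ?e ys"
      have Ys: "set Ys \<subseteq> vfields M" "length Ys = k" "at_point Ys a = ys"
        using extend_list[of ys a] * Nil by (auto simp: Ys_def)
      have eq: "?D (X a # ys) = cd T X Ys a" if "X \<in> vfields M" for X
        using D[OF that Ys(1,2)] Ys(3) by simp
      have "?D ((\<lambda>f. v f + w f) # ys) = ?D (v # ys) + ?D (w # ys)" if v: "v \<in> ?V" and w: "w \<in> ?V"
          for v w
        using eq[OF vfields_add[OF extend_vfield[OF v] extend_vfield[OF w]]]
          eq[OF extend_vfield[OF v]] eq[OF extend_vfield[OF w]] extend_at[OF v] extend_at[OF w]
          cd_add1[OF extend_vfield[OF v] extend_vfield[OF w] Ys(1,2)] by simp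
      moreover have "?D ((\<lambda>f. c * v f) # ys) = c * ?D (v # ys)" if v: "v \<in> ?V" for v c
        using eq[OF vfields_cmult[OF extend_vfield[OF v]]] eq[OF extend_vfield[OF v]] extend_at[OF
            v]
          cd_fmult1[OF smooth_const extend_vfield[OF v] Ys(1,2)] by simp
      ultimately show ?thesis using Nil by (simp add: lin_def)
    next
      case (Cons x xs')
      define Ys where "Ys v = map ?e (xs' @ v # ys)" for v
      \<comment> \<open>The zero vector only marks the slot under consideration;
        \<open>[?m := Y]\<close> overwrites it.\<close>
      let ?m = "length xs'" and ?X = "?e x" and ?Z = "map ?e (xs' @ (\<lambda>f. 0) # ys)"
      have x: "x \<in> ?V" using * Cons by auto
      have m: "?m < k" using * Cons by simp
      have Z: "set ?Z \<subseteq> vfields M" "length ?Z = k"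
        using * Cons extend_list(1)[of "xs' @ (\<lambda>f. 0) # ys" a] tangent_space_zero by auto
      have eq: "?D (xs @ Y a # ys) = cd T ?X (?Z[?m := Y]) a" if Y: "Y \<in> vfields M" for Y
      proof -
        have "set (?Z[?m := Y]) \<subseteq> vfields M" using Z Y set_update_subset_insert[of ?Z ?m Y] by blast
        moreover have "at_point (?Z[?m := Y]) a = xs' @ Y a # ys"
          using extend_list(2)[of xs' a] extend_list(2)[of ys a] * Cons
              by (simp add: list_update_append)
        ultimately show ?thesis using D[OF extend_vfield[OF x], of "?Z[?m := Y]"] Z extend_at[OF
            x] Cons by simp
      qed
      have "?D (xs @ (\<lambda>f. v f + w f) # ys) = ?D (xs @ v # ys) + ?D (xs @ w # ys)" if v: "v \<in> ?V"
          and w: "w \<in> ?V" for v w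
        using eq[OF vfields_add[OF extend_vfield[OF v] extend_vfield[OF w]]]
          eq[OF extend_vfield[OF v]] eq[OF extend_vfield[OF w]] extend_at[OF v] extend_at[OF w]
          cd_add2[OF extend_vfield[OF x] Z m extend_vfield[OF v] extend_vfield[OF w]] by simp
      moreover have "?D (xs @ (\<lambda>f. c * v f) # ys) = c * ?D (xs @ v # ys)" if v: "v \<in> ?V" for v c
        using eq[OF vfields_cmult[OF extend_vfield[OF v]]] eq[OF extend_vfield[OF v]] extend_at[OF
            v]
          cd_fmult2[OF extend_vfield[OF x] Z m smooth_const extend_vfield[OF v]] by simp
      ultimately show ?thesis by (simp add: lin_def)
    qed
  qed
qed

lemma cov_tensor_symmetrization: "cov_tensor k (symmetrization T)"
  unfolding cov_tensor_def
proof (intro conjI allI impI)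
  fix a show "mlin (tangent_space M a) k (symmetrization T a)"
    using T unfolding cov_tensor_def by (intro mlin_symmetrize) blast
next
  fix Ys assume *: "set Ys \<subseteq> vfields M \<and> length Ys = k"
  have "(\<lambda>p. T p (at_point (permute_list \<pi> Ys) p)) \<in> smooth_funs M" if "\<pi> permutes {..<k}" for \<pi>
    using * that by (intro tensor_smooth) auto
  then have "(\<lambda>p. T p (permute_list \<pi> (at_point Ys p))) \<in> smooth_funs M"
      if "\<pi> permutes {..<k}" for \<pi>
    using * that by (simp add: permute_list_map)
  then have "(\<lambda>p. (\<Sum>\<pi> | \<pi> permutes {..<k}. T p (permute_list \<pi> (at_point Ys p))) / fact k) \<in>
      smooth_funs M"
    by (intro smooth_divide smooth_sum) auto
  then show "(\<lambda>p. symmetrization T p (at_point Ys p)) \<in> smooth_funs M"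
    using * by (simp add: symmetrization_def)
qed

end

lemma cov_tensor_sym_deriv: "cov_tensor k T \<Longrightarrow> cov_tensor (Suc k) (sym_deriv M nab T)"
  unfolding sym_deriv_def by (intro cov_tensor_symmetrization cov_tensor_cov_differential)

lemma cov_tensor_iterate: "f \<in> smooth_funs M \<Longrightarrow> cov_tensor i ((sym_deriv M nab ^^ i) (fun_field f))"
  by (induction i) (auto simp: cov_tensor_sym_deriv, auto simp: cov_tensor_def mlin_def
      fun_field_def)

end

section \<open>Quantization\<close>

lemma sum_lists_Suc:
  fixes g :: "'n::finite list \<Rightarrow> 'a::comm_monoid_add"
  shows "(\<Sum>is | length is = Suc k. g is) = (\<Sum>i\<in>UNIV. \<Sum>js | length js = k. g (i # js))"
proof -
  have "(\<Sum>is | length is = Suc k. g is) = (\<Sum>(i, js)\<in>UNIV \<times> {js. length js = k}. g (i # js))"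
    by (rule sum.reindex_bij_witness[where i = "\<lambda>(i, js). i # js" and j = "\<lambda>is. (hd is, tl is)"])
      (auto simp: length_Suc_conv)
  then show ?thesis by (simp add: sum.cartesian_product)
qed

lemma sum_lists_permute:
  fixes g :: "'n::finite list \<Rightarrow> 'a::comm_monoid_add"
  assumes "\<pi> permutes {..<k}"
  shows "(\<Sum>is | length is = k. g (permute_list \<pi> is)) = (\<Sum>is | length is = k. g is)"
proof -
  have c: "permute_list \<sigma> (permute_list \<tau> is) = is"
    if "\<sigma> permutes {..<k}" "\<tau> permutes {..<k}" "\<tau> \<circ> \<sigma> = id" "length is = k"
        for \<sigma> \<tau> and "is" :: "'n list"
    using permute_list_compose[of \<sigma> "is" \<tau>] that by simp
  show ?thesis
    by (rule sum.reindex_bij_witness[where i = "permute_list (inv \<pi>)" and j = "permute_list \<pi>"])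
      (use assms permutes_inv[OF assms] permutes_inv_o[OF assms] in \<open>auto simp: c\<close>)
qed

text \<open>Easier to establish than \<open>is_frame\<close> together with \<open>coframe\<close>:
  the covectors are given, so the differentials of the coordinates of a local frame qualify without
  a definite description, and so do their images under a diffeomorphism.\<close>

definition dual_basis ::
    "('m::topological_space, 'n::finite) atlas \<Rightarrow> 'm \<Rightarrow> ('n \<Rightarrow> 'm tvec) \<Rightarrow> ('n \<Rightarrow> 'm covec) \<Rightarrow> bool" where
  "dual_basis M a e \<epsilon> \<longleftrightarrow> (\<forall>i. e i \<in> tangent_space M a) \<and> (\<forall>i. \<epsilon> i \<in> cotangent_space M a) \<and>
     (\<forall>v\<in>tangent_space M a. v = (\<lambda>f. \<Sum>i\<in>UNIV. \<epsilon> i v * e i f))"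

context manifold begin

lemma dual_basis_vec:
  assumes "dual_basis M a e \<epsilon>" "v \<in> tangent_space M a"
  shows "(\<lambda>f. \<Sum>i\<in>UNIV. \<epsilon> i v * e i f) = v"
  using assms unfolding dual_basis_def by metis

lemma dual_basis_covec:
  assumes "dual_basis M a e \<epsilon>" "\<eta> \<in> cotangent_space M a"
  shows "(\<lambda>v. \<Sum>i\<in>UNIV. \<eta> (e i) * \<epsilon> i v) = \<eta>"
proof
  fix v
  show "(\<Sum>i\<in>UNIV. \<eta> (e i) * \<epsilon> i v) = \<eta> v"
  proof (cases "v \<in> tangent_space M a")
    case True
    have "\<eta> v = \<eta> (\<lambda>f. \<Sum>i\<in>UNIV. \<epsilon> i v * e i f)" using dual_basis_vec[OF assms(1) True] by simp
    also have "\<dots> = (\<Sum>i\<in>UNIV. \<epsilon> i v * \<eta> (e i))"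
      using assms(1) by (intro lin_sum[OF fspace_tangent cotangent_lin[OF assms(2)]]) (auto simp:
          dual_basis_def)
    finally show ?thesis by (simp add: mult.commute)
  next
    case False
    then have "\<epsilon> i v = 0" for i
      using assms(1) cotangent_outside[of "\<epsilon> i" a v] by (simp add: dual_basis_def)
    then show ?thesis using False cotangent_outside[OF assms(2)] by simp
  qed
qed

lemma dual_basis_local_frame:
  assumes "local_frame M N E \<xi>" "p \<in> N"
  shows "dual_basis M p (\<lambda>i. E i p) (\<lambda>i. dfun M p (\<xi> i))"
  unfolding dual_basis_def
proof (intro conjI allI ballI)
  fix v assume v: "v \<in> tangent_space M p"
  show "v = (\<lambda>f. \<Sum>i\<in>UNIV. dfun M p (\<xi> i) v * E i p f)"
    unfolding dfun_apply[OF v] by (intro ext local_frameD(5)[OF assms v])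
qed (use local_frameD(2)[OF assms(1)] vfields_tangent dfun_cotangent in auto)

text \<open>Guarantees that the \<open>SOME\<close> in \<open>pairing\<close> picks a genuine
  frame.\<close>

lemma frame_exists: "\<exists>e. is_frame M a e"
proof -
  obtain N E \<xi> where F: "local_frame M N E \<xi>" and a: "a \<in> N" by (rule local_frame_exists)
  note D = dual_basis_local_frame[OF F a]
  have "is_frame M a (\<lambda>i. E i a)"
    unfolding is_frame_def
  proof (intro conjI allI ballI)
    show "E i a \<in> tangent_space M a" for i using vfields_tangent[OF local_frameD(2)[OF F]] .
    fix v assume v: "v \<in> tangent_space M a"
    show "\<exists>!c::'n \<Rightarrow> real. v = (\<lambda>f. \<Sum>i\<in>UNIV. c i * E i a f)"
    proof (rule ex1I)
      show "v = (\<lambda>f. \<Sum>i\<in>UNIV. dfun M a (\<xi> i) v * E i a f)" using dual_basis_vec[OF D v] by simp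
      fix c :: "'n \<Rightarrow> real" assume c: "v = (\<lambda>f. \<Sum>i\<in>UNIV. c i * E i a f)"
      show "c = (\<lambda>i. dfun M a (\<xi> i) v)"
      proof
        fix j
        have "v (\<xi> j) = (\<Sum>i\<in>UNIV. c i * E i a (\<xi> j))" using fun_cong[OF c, of "\<xi> j"] .
        also have "\<dots> = (\<Sum>i\<in>UNIV. if i = j then c i else 0)"
          using local_frameD(4)[OF F a] by (intro sum.cong) auto
        finally show "c j = dfun M a (\<xi> j) v" using dfun_apply[OF v] by simp
      qed
    qed
  qed
  then show ?thesis by blast
qed

lemma dual_basis_coframe:
  assumes "is_frame M a e"
  shows "dual_basis M a e (coframe M a e)"
proof -
  define P where "P v c \<longleftrightarrow> v = (\<lambda>f. \<Sum>i\<in>UNIV. c i * e i f)" for v and c :: "'n \<Rightarrow> real"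
  have ex: "\<exists>!c. P v c" if "v \<in> tangent_space M a" for v
    using assms that unfolding is_frame_def P_def by blast
  have P: "P v (\<lambda>i. coframe M a e i v)" if v: "v \<in> tangent_space M a" for v
    using theI'[OF ex[OF v]] v by (simp add: coframe_def P_def)
  have uniq: "coframe M a e i v = c i" if "v \<in> tangent_space M a" "P v c" for v c i
    using ex[OF that(1)] P[OF that(1)] that(2) by metis
  have "coframe M a e i \<in> cotangent_space M a" for i
    unfolding cotangent_space_def
  proof (intro CollectI conjI ballI allI impI)
    fix v w assume v: "v \<in> tangent_space M a" and w: "w \<in> tangent_space M a"
    have "P (\<lambda>f. v f + w f) (\<lambda>i. coframe M a e i v + coframe M a e i w)"
      using P[OF v] P[OF w] unfolding P_def by (auto simp: fun_eq_iff algebra_simps sum.distrib)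
    then show "coframe M a e i (\<lambda>f. v f + w f) = coframe M a e i v + coframe M a e i w"
      using uniq[OF tangent_space_add[OF v w]] by simp
  next
    fix c v assume v: "v \<in> tangent_space M a"
    have "P (\<lambda>f. c * v f) (\<lambda>i. c * coframe M a e i v)"
      using P[OF v] unfolding P_def by (auto simp: fun_eq_iff sum_distrib_left mult.assoc)
    then show "coframe M a e i (\<lambda>f. c * v f) = c * coframe M a e i v"
      using uniq[OF tangent_space_cmult[OF v]] by simp
  qed (simp add: coframe_def)
  then show ?thesis
    using assms P unfolding dual_basis_def is_frame_def P_def by blast
qed

text \<open>The basis is changed slot by slot: the induction hypothesis treats the tail, and
  \<open>one\<close> is the invariance of the contraction of two linear forms.\<close>

lemma contraction_basis:
  assumes D: "dual_basis M a e \<epsilon>" "dual_basis M a e' \<epsilon>'"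
    and "mlin (cotangent_space M a) k H" "mlin (tangent_space M a) k T"
  shows "(\<Sum>is | length is = k. H (map \<epsilon> is) * T (map e is)) =
    (\<Sum>is | length is = k. H (map \<epsilon>' is) * T (map e' is))"
  using assms(3,4)
proof (induction k arbitrary: H T)
  case (Suc k)
  let ?V = "tangent_space M a" and ?W = "cotangent_space M a"
  have V: "e i \<in> ?V" "e' i \<in> ?V" "\<epsilon> i \<in> ?W" "\<epsilon>' i \<in> ?W" for i using D by (auto simp: dual_basis_def)
  have one: "(\<Sum>i\<in>UNIV. h (\<epsilon> i) * t (e i)) = (\<Sum>i\<in>UNIV. h (\<epsilon>' i) * t (e' i))"
    if h: "lin ?W h" and t: "lin ?V t" for h t
  proof -
    have "(\<Sum>j\<in>UNIV. h (\<epsilon>' j) * t (e' j)) = (\<Sum>j\<in>UNIV. h (\<epsilon>' j) * t (\<lambda>f. \<Sum>i\<in>UNIV. \<epsilon> i (e' j) * e i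
        f))"
      using dual_basis_vec[OF D(1) V(2)] by simp
    also have "\<dots> = (\<Sum>j\<in>UNIV. \<Sum>i\<in>UNIV. \<epsilon> i (e' j) * h (\<epsilon>' j) * t (e i))"
      unfolding lin_sum[OF fspace_tangent t V(1)] by (simp add: sum_distrib_left mult_ac)
    also have "\<dots> = (\<Sum>i\<in>UNIV. (\<Sum>j\<in>UNIV. \<epsilon> i (e' j) * h (\<epsilon>' j)) * t (e i))"
      by (subst sum.swap) (simp add: sum_distrib_right)
    also have "\<dots> = (\<Sum>i\<in>UNIV. h (\<lambda>v. \<Sum>j\<in>UNIV. \<epsilon> i (e' j) * \<epsilon>' j v) * t (e i))"
      using lin_sum[OF fspace_cotangent h, of UNIV \<epsilon>'] V by simp
    also have "\<dots> = (\<Sum>i\<in>UNIV. h (\<epsilon> i) * t (e i))"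
      using dual_basis_covec[OF D(2) V(3)] by simp
    finally show ?thesis by simp
  qed
  have "(\<Sum>is | length is = Suc k. H (map \<epsilon> is) * T (map e is)) =
      (\<Sum>i\<in>UNIV. \<Sum>js | length js = k. H (\<epsilon> i # map \<epsilon>' js) * T (e i # map e' js))"
    unfolding sum_lists_Suc list.map
    by (intro sum.cong refl Suc.IH mlin_Cons[OF Suc.prems(1)] mlin_Cons[OF Suc.prems(2)] V)
  also have "\<dots> = (\<Sum>js | length js = k. \<Sum>i\<in>UNIV. H (\<epsilon> i # map \<epsilon>' js) * T (e i # map e' js))"
    by (rule sum.swap)
  also have "\<dots> = (\<Sum>js | length js = k. \<Sum>i\<in>UNIV. H (\<epsilon>' i # map \<epsilon>' js) * T (e' i # map e' js))"
    by (intro sum.cong refl one mlin_hd[OF Suc.prems(1)] mlin_hd[OF Suc.prems(2)]) (use V in auto)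
  also have "\<dots> = (\<Sum>is | length is = Suc k. H (map \<epsilon>' is) * T (map e' is))"
    unfolding sum_lists_Suc list.map by (rule sum.swap)
  finally show ?case .
qed simp

lemma pairing_eq:
  assumes "dual_basis M a e \<epsilon>" "mlin (cotangent_space M a) k (H a)" "mlin (tangent_space M a) k (T
      a)"
  shows "pairing M k H T a = fact k * (\<Sum>is | length is = k. H a (map \<epsilon> is) * T a (map e is))"
proof -
  have "is_frame M a (SOME e. is_frame M a e)" using someI_ex[OF frame_exists] .
  from contraction_basis[OF dual_basis_coframe[OF this] assms] show ?thesis
    by (simp add: pairing_def Let_def)
qed

text \<open>An iterated commutator at \<open>p\<close> uses only values of the operator at
  \<open>p\<close>. Hence coefficients may be frozen at one point, even if the resulting operators
  agree nowhere else.\<close>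

lemma commutators_cong_at:
  assumes "\<And>f. f \<in> smooth_funs M \<Longrightarrow> A f p = B f p" "set fs \<subseteq> smooth_funs M" "g \<in> smooth_funs M"
  shows "commutators A fs g p = commutators B fs g p"
  using assms(1,2)
proof (induction fs arbitrary: A B)
  case (Cons f fs)
  have "commutator A f h p = commutator B f h p" if "h \<in> smooth_funs M" for h
    using Cons.prems that smooth_mult[of f h] by (simp add: commutator_def)
  then show ?case using Cons.IH[of "commutator A f" "commutator B f"] Cons.prems(2) by simp
qed (use assms(3) in simp)

text \<open>Iterates [X \<circ> B, f] = X \<circ> [B, f] + X(f) B. At most one of the functions is
  consumed by the derivation \<open>X\<close>, and the index \<open>l\<close> says which.\<close>

lemma commutators_comp:
  assumes X: "X \<in> vfields M" and "linear_oper M B" "set fs \<subseteq> smooth_funs M" "g \<in> smooth_funs M"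
  shows "commutators (\<lambda>f p. X p (B f)) fs g p = X p (commutators B fs g) +
    (\<Sum>l<length fs. X p (fs ! l) * commutators B (take l fs @ drop (Suc l) fs) g p)"
  using assms(2,3)
proof (induction fs arbitrary: B)
  case (Cons f fs)
  note XT = vfields_tangent[OF X]
  have f: "f \<in> smooth_funs M" and fs: "set fs \<subseteq> smooth_funs M" using Cons.prems by auto
  have comm: "commutator (\<lambda>f p. X p (B f)) f h q = X q (commutator B f h) + X q f * B h q"
    if h: "h \<in> smooth_funs M" for h q
  proof -
    have "X q (commutator B f h) = X q (B (\<lambda>q. f q * h q)) - X q (\<lambda>p. f p * B h p)"
      unfolding commutator_def
      by (intro tangent_diff[OF XT] linear_operD(1)[OF Cons.prems(1)] smooth_mult f h)
    also have "X q (\<lambda>p. f p * B h p) = f q * X q (B h) + B h q * X q f"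
      by (intro tangent_mult[OF XT] linear_operD(1)[OF Cons.prems(1)] f h)
    finally show ?thesis by (simp add: commutator_def)
  qed
  have "commutators (\<lambda>f p. X p (B f)) (f # fs) g p =
      commutators (\<lambda>h q. X q (commutator B f h) + X q f * B h q) fs g p"
    unfolding commutators_Cons by (rule commutators_cong_at[OF comm fs assms(4)])
  also have "\<dots> = commutators (\<lambda>h q. X q (commutator B f h)) fs g p + X p f * commutators B fs g p"
    by (simp add: commutators_add commutators_fmult)
  also have "commutators (\<lambda>h q. X q (commutator B f h)) fs g p = X p (commutators B (f # fs) g) +
      (\<Sum>l<length fs. X p (fs ! l) * commutators B (f # (take l fs @ drop (Suc l) fs)) g p)"
    using Cons.IH[OF linear_oper_commutator[OF Cons.prems(1) f] fs] by simp
  finally show ?case by (simp add: sum.lessThan_Suc_shift del: sum.lessThan_Suc)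
qed simp

end

section \<open>The order and the symbol of a quantization\<close>

context connection begin

text \<open>The \<open>i\<close>-th iterate of d^s evaluated on fixed fields and read as an operator
  in \<open>f\<close>; a quantization is locally a combination of these with coefficients taken from
  the symbol.\<close>

definition jet_oper :: "nat \<Rightarrow> 'm vfield list \<Rightarrow> 'm oper" where
  "jet_oper i Ys f p = ((sym_deriv M nab ^^ i) (fun_field f)) p (at_point Ys p)"

text \<open>The step before symmetrization: the covariant differential of the \<open>i\<close>-th
  iterate, with the head of \<open>Zs\<close> as direction. The subtracted connection terms have
  order at most \<open>i\<close> only.\<close>

definition cd_oper :: "nat \<Rightarrow> 'm vfield list \<Rightarrow> 'm oper" where
  "cd_oper i Zs f p = hd Zs p (jet_oper i (tl Zs) f) -
     (\<Sum>j<i. jet_oper i ((tl Zs)[j := nab (hd Zs) (tl Zs ! j)]) f p)"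

lemma jet_oper_Suc:
  assumes f: "f \<in> smooth_funs M" and Ys: "set Ys \<subseteq> vfields M" "length Ys = Suc i"
  shows "jet_oper (Suc i) Ys f p = (\<Sum>\<pi> | \<pi> permutes {..<Suc i}. cd_oper i (permute_list \<pi> Ys) f p)
      / fact (Suc i)"
proof -
  let ?T = "(sym_deriv M nab ^^ i) (fun_field f)"
  note T = cov_tensor_iterate[OF f, of i]
  have "cov_differential M nab ?T p (permute_list \<pi> (at_point Ys p)) = cd_oper i (permute_list \<pi>
      Ys) f p"
    if \<pi>: "\<pi> permutes {..<Suc i}" for \<pi>
  proof -
    have len: "length (permute_list \<pi> Ys) = Suc i" and set: "set (permute_list \<pi> Ys) \<subseteq> vfields M"
      using Ys \<pi> by auto
    obtain X Zs where Z: "permute_list \<pi> Ys = X # Zs" using len by (cases "permute_list \<pi> Ys") auto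
    have "permute_list \<pi> (at_point Ys p) = X p # at_point Zs p"
      using permute_list_map[of \<pi> Ys "\<lambda>Y. Y p"] \<pi> Ys(2) Z by simp
    then have "cov_differential M nab ?T p (permute_list \<pi> (at_point Ys p)) = cd ?T X Zs p"
      using cov_differential_eq[OF T, of X Zs p] len set Z by simp
    also have "\<dots> = cd_oper i (X # Zs) f p"
      using len Z by (simp add: cd_def cd_oper_def jet_oper_def[abs_def] map_update)
    finally show ?thesis using Z by simp
  qed
  then show ?thesis using Ys(2) by (simp add: jet_oper_def sym_deriv_def symmetrization_def)
qed

text \<open>The two bounds are proved together: an iterate is an average of \<open>cd_oper\<close>
  terms over permutations, and each of these is a derivation applied to the previous iterate minus
  terms of lower order.\<close>

lemma diff_oper_jet: "set Ys \<subseteq> vfields M \<Longrightarrow> length Ys = i \<Longrightarrow> diff_oper M i (jet_oper i Ys)"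
  and diff_oper_cd: "set Zs \<subseteq> vfields M \<Longrightarrow> length Zs = Suc i \<Longrightarrow> diff_oper M (Suc i) (cd_oper i Zs)"
proof (induction i arbitrary: Ys Zs)
  have cd: "diff_oper M (Suc i) (cd_oper i Zs)"
    if J: "\<And>Ys. set Ys \<subseteq> vfields M \<Longrightarrow> length Ys = i \<Longrightarrow> diff_oper M i (jet_oper i Ys)"
      and Z: "set Zs \<subseteq> vfields M" "length Zs = Suc i" for i Zs
  proof -
    obtain X Ys where Zs: "Zs = X # Ys" using Z by (cases Zs) auto
    have "set (Ys[j := nab X (Ys ! j)]) \<subseteq> vfields M" if "j < i" for j
      using Z that Zs by (intro set_update_subsetI conn_vfield) auto
    then show ?thesis unfolding cd_oper_def[abs_def] using Z Zs
      by (intro diff_oper_diff diff_oper_comp diff_oper_sum diff_oper_Suc J) auto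
  qed
  {
    case 0
    {
      case 1
      have "commutator (\<lambda>f. f) f g = (\<lambda>p. 0)" for f g :: "'m \<Rightarrow> real" by (simp add: commutator_def)
      then have "diff_oper M 0 (\<lambda>f. f)" by (simp add: linear_oper_def)
      moreover have "jet_oper 0 [] = (\<lambda>f. f)" by (simp add: jet_oper_def[abs_def] fun_field_def)
      ultimately show ?case using 1 by simp
    }
    note J0 = this
    case 2 then show ?case by (intro cd J0)
  next
    case (Suc i)
    {
      case (1 Ys)
      have "diff_oper M (Suc i) (\<lambda>f p. (1 / fact (Suc i)) * (\<Sum>\<pi> | \<pi> permutes {..<Suc i}. cd_oper i
          (permute_list \<pi> Ys) f p))"
        using 1 by (intro diff_oper_cmult diff_oper_sum Suc.IH(2)) auto
      then show ?case
        by (rule diff_oper_cong[rotated]) (use jet_oper_Suc[OF _ 1] in \<open>auto simp: fun_eq_iff\<close>)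
    }
    note J = this
    case 2 then show ?case by (intro cd J)
  }
qed

text \<open>The computation behind the fact that Q(H) has symbol H. In the induction step
  symmetrization is absorbed by the symmetry of \<open>H\<close>, and the connection terms, being of
  order \<open>k\<close>, are killed by \<open>k + 1\<close> commutators. The remaining derivation
  is applied to one of the \<open>k + 1\<close> functions, and each choice contributes k! times the
  same value.\<close>

lemma jet_oper_contraction:
  assumes D: "dual_basis M a (\<lambda>i. E i a) \<epsilon>" and E: "\<And>i. E i \<in> vfields M"
    and "mlin (cotangent_space M a) k H" "\<And>\<eta>s \<zeta>s. mset \<eta>s = mset \<zeta>s \<Longrightarrow> H \<eta>s = H \<zeta>s"
    and "set fs \<subseteq> smooth_funs M" "length fs = k"
  shows "(\<Sum>is | length is = k. H (map \<epsilon> is) * commutators (jet_oper k (map E is)) fs (\<lambda>p. 1) a) =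
    fact k * H (map (dfun M a) fs)"
  using assms(3-)
proof (induction k arbitrary: H fs)
  case 0
  from 0(4) show ?case by (simp add: jet_oper_def fun_field_def)
next
  case (Suc k)
  let ?C = "\<lambda>B fs. commutators B fs (\<lambda>p. 1) a"
  note fs = Suc.prems(3,4)
  have Es: "set (map E is) \<subseteq> vfields M" for "is" using E by auto
  have \<epsilon>: "\<epsilon> i \<in> cotangent_space M a" for i using D by (simp add: dual_basis_def)
  \<comment> \<open>The same contraction without symmetrization; \<open>red\<close> will show that
    symmetrizing does not change it.\<close>
  define S where "S = (\<Sum>is | length is = Suc k. H (map \<epsilon> is) * ?C (cd_oper k (map E is)) fs)"
  have "?C (jet_oper (Suc k) (map E is)) fs =
      (\<Sum>\<pi> | \<pi> permutes {..<Suc k}. ?C (cd_oper k (permute_list \<pi> (map E is))) fs) / fact (Suc k)"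
    if len: "length is = Suc k" for "is"
  proof -
    have "?C (jet_oper (Suc k) (map E is)) fs =
        ?C (\<lambda>f p. (1 / fact (Suc k)) * (\<Sum>\<pi> | \<pi> permutes {..<Suc k}. cd_oper k (permute_list \<pi> (map
            E is)) f p)) fs"
      using jet_oper_Suc[OF _ Es] len fs(1) by (intro commutators_cong_at) auto
    then show ?thesis by (simp only: commutators_fmult commutators_sum) simp
  qed
  then have "(\<Sum>is | length is = Suc k. H (map \<epsilon> is) * ?C (jet_oper (Suc k) (map E is)) fs) =
      (\<Sum>is | length is = Suc k. \<Sum>\<pi> | \<pi> permutes {..<Suc k}.
         H (map \<epsilon> is) * ?C (cd_oper k (permute_list \<pi> (map E is))) fs / fact (Suc k))"
    by (intro sum.cong) (auto simp: sum_distrib_left sum_divide_distrib)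
  also have "\<dots> = (\<Sum>\<pi> | \<pi> permutes {..<Suc k}. \<Sum>is | length is = Suc k.
         H (map \<epsilon> is) * ?C (cd_oper k (permute_list \<pi> (map E is))) fs / fact (Suc k))"
    by (rule sum.swap)
  also have "\<dots> = (\<Sum>\<pi> | \<pi> permutes {..<Suc k}. S / fact (Suc k))"
  proof (intro sum.cong refl)
    fix \<pi> assume "\<pi> \<in> {\<pi>. \<pi> permutes {..<Suc k}}"
    then have \<pi>: "\<pi> permutes {..<Suc k}" by simp
    have "H (map \<epsilon> is) * ?C (cd_oper k (permute_list \<pi> (map E is))) fs =
        H (map \<epsilon> (permute_list \<pi> is)) * ?C (cd_oper k (map E (permute_list \<pi> is))) fs"
      if "length is = Suc k" for "is"
    proof -
      have "mset (map \<epsilon> is) = mset (map \<epsilon> (permute_list \<pi> is))" using \<pi> that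
          by (simp add: mset_permute_list)
      then show ?thesis using Suc.prems(2) permute_list_map[of \<pi> "is" E] \<pi> that by metis
    qed
    then have "(\<Sum>is | length is = Suc k. H (map \<epsilon> is) * ?C (cd_oper k (permute_list \<pi> (map E is)))
        fs / fact (Suc k)) =
        (\<Sum>is | length is = Suc k. H (map \<epsilon> (permute_list \<pi> is)) * ?C (cd_oper k (map E
            (permute_list \<pi> is))) fs / fact (Suc k))"
      by (intro sum.cong) auto
    also have "\<dots> = S / fact (Suc k)"
      unfolding S_def sum_divide_distrib by (rule sum_lists_permute[OF \<pi>])
    finally show "(\<Sum>is | length is = Suc k. H (map \<epsilon> is) * ?C (cd_oper k (permute_list \<pi> (map E
        is))) fs / fact (Suc k)) = S / fact (Suc k)" .
  qed
  \<comment> \<open>There are (k + 1)! permutations with equal contributions, which cancels the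
    averaging factor.\<close>
  also have "\<dots> = S"
    using card_permutations[of "{..<Suc k}" "Suc k"] by (simp del: fact_Suc)
  finally have red: "(\<Sum>is | length is = Suc k. H (map \<epsilon> is) * ?C (jet_oper (Suc k) (map E is)) fs)
      = S" .
  let ?r = "\<lambda>l. take l fs @ drop (Suc l) fs"
  have r: "set (?r l) \<subseteq> smooth_funs M" for l
    using fs set_take_subset[of l fs] set_drop_subset[of "Suc l" fs] by auto
  have r_len: "length (?r l) = k" if "l < Suc k" for l
    using fs(2) that by simp
  have r_mset: "mset (fs ! l # ?r l) = mset fs" if "l < Suc k" for l
  proof -
    have "mset fs = mset (take l fs @ fs ! l # drop (Suc l) fs)"
      by (rule arg_cong[where f = mset], rule id_take_nth_drop) (use that fs in simp)
    then show ?thesis by (simp only: mset_append mset.simps) simp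
  qed
  \<comment> \<open>All operators of order \<open>k\<close> are annihilated by the
    \<open>k + 1\<close> commutators (\<open>van\<close>). In the Leibniz expansion only those terms
    survive in which the derivation acts on some \<open>fs ! l\<close>, leaving \<open>k\<close>
    functions for an operator of order \<open>k\<close>.\<close>
  have top: "?C (cd_oper k (E i # map E js)) fs = (\<Sum>l<Suc k. E i a (fs ! l) * ?C (jet_oper k (map
      E js)) (?r l))"
    if js: "length js = k" for i js
  proof -
    have J: "diff_oper M k (jet_oper k Ys)" if "set Ys \<subseteq> vfields M" "length Ys = k" for Ys
      using diff_oper_jet that by blast
    have van: "commutators (jet_oper k Ys) fs (\<lambda>p. 1) = (\<lambda>p. 0)"
        if "set Ys \<subseteq> vfields M" "length Ys = k" for Ys
      using commutators_vanish[OF J[OF that] fs(1)] fs(2) by simp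
    have upd: "set ((map E js)[j := nab (E i) (map E js ! j)]) \<subseteq> vfields M" if "j < k" for j
      using E js that by (intro set_update_subsetI conn_vfield) auto
    have "?C (cd_oper k (E i # map E js)) fs = ?C (\<lambda>f p. E i p (jet_oper k (map E js) f)) fs -
        (\<Sum>j<k. ?C (jet_oper k ((map E js)[j := nab (E i) (map E js ! j)])) fs)"
      by (simp add: cd_oper_def[abs_def] commutators_diff commutators_sum)
    also have "(\<Sum>j<k. ?C (jet_oper k ((map E js)[j := nab (E i) (map E js ! j)])) fs) = 0"
      using van[OF upd] js by simp
    also have "?C (\<lambda>f p. E i p (jet_oper k (map E js) f)) fs = (\<Sum>l<Suc k. E i a (fs ! l) * ?C
        (jet_oper k (map E js)) (?r l))"
      using commutators_comp[OF E diff_oper_linear[OF J[OF Es[of js]]] fs(1), of "\<lambda>p. 1" i a] js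
          van[OF Es[of js]] fs(2)
        tangent_const[OF vfields_tangent[OF E], where c = 0] by simp
    finally show ?thesis by simp
  qed
  \<comment> \<open>Summation over the direction index rebuilds the differential of \<open>f\<close>
    in the first slot of \<open>H\<close>.\<close>
  have hd: "(\<Sum>i\<in>UNIV. E i a f * H (\<epsilon> i # map \<epsilon> js)) = H (dfun M a f # map \<epsilon> js)"
    if js: "length js = k" for f js
  proof -
    have "H ((\<lambda>v. \<Sum>i\<in>UNIV. dfun M a f (E i a) * \<epsilon> i v) # map \<epsilon> js) = (\<Sum>i\<in>UNIV. dfun M a f (E i a)
        * H (\<epsilon> i # map \<epsilon> js))"
      using \<epsilon> js by (intro lin_sum[OF fspace_cotangent mlin_hd[OF Suc.prems(1)]]) auto
    then show ?thesis
      using dual_basis_covec[OF D dfun_cotangent] dfun_apply[OF vfields_tangent[OF E]] by simp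
  qed
  have "S = (\<Sum>i\<in>UNIV. \<Sum>js | length js = k. \<Sum>l<Suc k.
      E i a (fs ! l) * H (\<epsilon> i # map \<epsilon> js) * ?C (jet_oper k (map E js)) (?r l))"
    unfolding S_def sum_lists_Suc by (intro sum.cong refl) (auto simp: top sum_distrib_left
        mult_ac simp del: sum.lessThan_Suc)
  also have "\<dots> = (\<Sum>js | length js = k. \<Sum>i\<in>UNIV. \<Sum>l<Suc k.
      E i a (fs ! l) * H (\<epsilon> i # map \<epsilon> js) * ?C (jet_oper k (map E js)) (?r l))"
    by (rule sum.swap)
  also have "\<dots> = (\<Sum>js | length js = k. \<Sum>l<Suc k. \<Sum>i\<in>UNIV.
      E i a (fs ! l) * H (\<epsilon> i # map \<epsilon> js) * ?C (jet_oper k (map E js)) (?r l))"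
    by (intro sum.cong refl sum.swap)
  also have "\<dots> = (\<Sum>l<Suc k. \<Sum>js | length js = k. \<Sum>i\<in>UNIV.
      E i a (fs ! l) * H (\<epsilon> i # map \<epsilon> js) * ?C (jet_oper k (map E js)) (?r l))"
    by (rule sum.swap)
  also have "\<dots> = (\<Sum>l<Suc k. \<Sum>js | length js = k.
      H (dfun M a (fs ! l) # map \<epsilon> js) * ?C (jet_oper k (map E js)) (?r l))"
    by (intro sum.cong refl) (auto simp: hd[symmetric] sum_distrib_right)
  also have "\<dots> = (\<Sum>l<Suc k. fact k * H (map (dfun M a) fs))"
  proof (intro sum.cong refl)
    fix l assume "l \<in> {..<Suc k}"
    then have l: "l < Suc k" by simp
    have "(\<Sum>js | length js = k. H (dfun M a (fs ! l) # map \<epsilon> js) * ?C (jet_oper k (map E js)) (?r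
        l)) =
        fact k * H (dfun M a (fs ! l) # map (dfun M a) (?r l))"
      using Suc.prems(2) by (intro Suc.IH mlin_Cons[OF Suc.prems(1) dfun_cotangent] r r_len[OF l])
          auto
    also have "H (dfun M a (fs ! l) # map (dfun M a) (?r l)) = H (map (dfun M a) fs)"
    proof (rule Suc.prems(2))
      have "mset (map (dfun M a) (fs ! l # ?r l)) = mset (map (dfun M a) fs)"
        unfolding mset_map r_mset[OF l] ..
      then show "mset (dfun M a (fs ! l) # map (dfun M a) (?r l)) = mset (map (dfun M a) fs)" by
          simp
    qed
    finally show "(\<Sum>js | length js = k. H (dfun M a (fs ! l) # map \<epsilon> js) * ?C (jet_oper k (map E
        js)) (?r l)) =
        fact k * H (map (dfun M a) fs)" .
  qed
  also have "\<dots> = fact (Suc k) * H (map (dfun M a) fs)" by simp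
  finally show ?case using red by simp
qed

text \<open>The k! of \<open>pairing\<close> cancels the 1/k! of \<open>quantization\<close>, and
  the frame picked in \<open>pairing\<close> is exchanged for the values at \<open>p\<close> of
  global fields, so that the \<open>jet_oper\<close> operators appear.\<close>

lemma quantization_eq:
  assumes "dual_basis M p (\<lambda>i. E i p) \<epsilon>" "mlin (cotangent_space M p) k (H p)" "f \<in> smooth_funs M"
  shows "quantization M nab k H f p = (\<Sum>is | length is = k. H p (map \<epsilon> is) * jet_oper k (map E is)
      f p)"
proof -
  have "mlin (tangent_space M p) k ((sym_deriv M nab ^^ k) (fun_field f) p)"
    using cov_tensor_iterate[OF assms(3)] unfolding cov_tensor_def by blast
  from pairing_eq[where H = H and T = "(sym_deriv M nab ^^ k) (fun_field f)", OF assms(1,2) this]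
      show ?thesis
    by (simp add: quantization_def jet_oper_def comp_def)
qed

text \<open>In a local frame the coefficients are full commutators of \<open>A\<close> with the
  coordinates, divided by k!. These are global smooth functions, so the order is that of the
  \<open>jet_oper\<close> factors.\<close>

lemma diff_oper_quantization:
  assumes A: "diff_oper M k A"
  shows "diff_oper M k (quantization M nab k (symbol M k A))"
proof (rule diff_oper_local)
  fix a
  obtain N E \<xi> where F: "local_frame M N E \<xi>" and a: "a \<in> N" by (rule local_frame_exists)
  note E = local_frameD(2)[OF F] and \<xi> = local_frameD(3)[OF F]
  define B where "B f p = (\<Sum>is | length is = k. (commutators A (map \<xi> is) (\<lambda>p. 1) p / fact k) *
      jet_oper k (map E is) f p)" for f p
  have "(\<lambda>p. commutators A (map \<xi> is) (\<lambda>p. 1) p / fact k) \<in> smooth_funs M" for "is"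
    using \<xi> by (intro smooth_divide linear_operD(1)[OF linear_oper_commutators[OF
        diff_oper_linear[OF A]]]) auto
  then have "diff_oper M k B"
    unfolding B_def[abs_def] using E by (intro diff_oper_sum diff_oper_fmult diff_oper_jet) auto
  moreover have "quantization M nab k (symbol M k A) f p = B f p"
      if "f \<in> smooth_funs M" "p \<in> N" for f p
  proof -
    have "symbol M k A p (map (\<lambda>i. dfun M p (\<xi> i)) is) = commutators A (map \<xi> is) (\<lambda>p. 1) p / fact
        k"
      if "length is = k" for "is"
    proof -
      have "set (map \<xi> is) \<subseteq> smooth_funs M" using \<xi> by auto
      from symbol_dfun[OF A this, of p] show ?thesis using that by (simp add: comp_def)
    qed
    then show ?thesis
      using quantization_eq[where E = E and H = "symbol M k A",
          OF dual_basis_local_frame[OF F that(2)] mlin_symbol[OF A] that(1)]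
      by (simp add: B_def)
  qed
  ultimately show "\<exists>B N. diff_oper M k B \<and> open N \<and> a \<in> N \<and>
      (\<forall>f\<in>smooth_funs M. \<forall>p\<in>N. quantization M nab k (symbol M k A) f p = B f p)"
    using a local_frameD(1)[OF F] by blast
qed

text \<open>Freezing the coefficients at \<open>a\<close> reduces this to
  \<open>jet_oper_contraction\<close>; the k! obtained there cancels the 1/k! in
  \<open>symbol\<close>.\<close>

lemma commutators_quantization:
  assumes A: "diff_oper M k A" and fs: "set fs \<subseteq> smooth_funs M" "length fs = k"
  shows "commutators (quantization M nab k (symbol M k A)) fs (\<lambda>p. 1) a = commutators A fs (\<lambda>p. 1)
      a"
proof -
  obtain N E \<xi> where F: "local_frame M N E \<xi>" and a: "a \<in> N" by (rule local_frame_exists)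
  note D = dual_basis_local_frame[OF F a]
  let ?\<epsilon> = "\<lambda>i. dfun M a (\<xi> i)"
  have "commutators (quantization M nab k (symbol M k A)) fs (\<lambda>p. 1) a =
      commutators (\<lambda>f p. \<Sum>is | length is = k. symbol M k A a (map ?\<epsilon> is) * jet_oper k (map E is) f
          p) fs (\<lambda>p. 1) a"
    using quantization_eq[where E = E and H = "symbol M k A", OF D mlin_symbol[OF A]] fs(1) by
        (intro commutators_cong_at) auto
  also have "\<dots> = (\<Sum>is | length is = k. symbol M k A a (map ?\<epsilon> is) * commutators (jet_oper k (map E
      is)) fs (\<lambda>p. 1) a)"
    by (simp add: commutators_sum commutators_fmult)
  also have "\<dots> = fact k * symbol M k A a (map (dfun M a) fs)"
    by (rule jet_oper_contraction[OF D local_frameD(2)[OF F] mlin_symbol[OF A] symbol_mset fs])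
  also have "\<dots> = commutators A fs (\<lambda>p. 1) a" using symbol_dfun[OF A fs] by simp
  finally show ?thesis .
qed

text \<open>Makes the recursion of \<open>total_symbol\<close> meaningful: the operator handed on
  really has order at most \<open>k\<close>.\<close>

lemma diff_oper_remainder:
  assumes A: "diff_oper M (Suc k) A"
  shows "diff_oper M k (\<lambda>f p. A f p - quantization M nab (Suc k) (symbol M (Suc k) A) f p)"
  using diff_oper_diff[OF A diff_oper_quantization[OF A]]
  by (rule diff_oper_reduce) (simp add: commutators_diff commutators_quantization[OF A])

end

section \<open>Diffeomorphisms\<close>

context manifold begin

lemma smooth_pmap_pullback:
  assumes \<phi>: "smooth_pmap M \<phi>" and f: "f \<in> smooth_funs M"
  shows "smooth_near M (dom \<phi>) (\<lambda>p. f (the (\<phi> p)))"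
proof (rule smooth_near_local)
  fix a assume a: "a \<in> dom \<phi>"
  have dom: "open (dom \<phi>)" "continuous_on (dom \<phi>) (the \<circ> \<phi>)" using \<phi> by (auto simp: smooth_pmap_def)
  obtain U x where c: "(U, x) \<in> M" and aU: "a \<in> U" by (rule chart_cover)
  obtain V y where d: "(V, y) \<in> M" and bV: "the (\<phi> a) \<in> V" by (rule chart_cover)
  define W where "W = {p \<in> U \<inter> dom \<phi>. the (\<phi> p) \<in> V}"
  have "W = U \<inter> (dom \<phi> \<inter> (the \<circ> \<phi>) -` V)" by (auto simp: W_def)
  then have W: "open W" "W \<subseteq> U"
    using continuous_open_preimage[OF dom(2,1) chartD(1)[OF d]] chartD(1)[OF c] by auto
  have xW: "open (x ` W)" using chart_image_open'[OF c W] .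
  have s: "smooth_on (x ` W) (y \<circ> the \<circ> \<phi> \<circ> inv_into U x)"
  proof -
    have "\<forall>(U, x)\<in>M. \<forall>(V, y)\<in>M.
        smooth_on (x ` {a \<in> U \<inter> dom \<phi>. the (\<phi> a) \<in> V}) (y \<circ> the \<circ> \<phi> \<circ> inv_into U x)"
      using \<phi> unfolding smooth_pmap_def by (elim conjE)
    from bspec[OF this c] d show ?thesis unfolding W_def by fast
  qed
  have "smooth_on (x ` W) (\<lambda>z. (f \<circ> inv_into V y) ((y \<circ> the \<circ> \<phi> \<circ> inv_into U x) z))"
    by (rule smooth_on_compose[OF xW chartD(2)[OF d] _ s smooth_funs_chart[OF f d]])
      (use c W in \<open>auto simp: W_def\<close>)
  then have "smooth_on (x ` W) ((\<lambda>p. f (the (\<phi> p))) \<circ> inv_into U x)"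
    by (rule smooth_on_cong[OF _ xW]) (use c d W in \<open>auto simp: W_def\<close>)
  then have "smooth_near M W (\<lambda>p. f (the (\<phi> p)))" by (rule smooth_near_chart[OF c W])
  then show "\<exists>W. open W \<and> a \<in> W \<and> smooth_near M W (\<lambda>p. f (the (\<phi> p)))"
    using W(1) a aU bV by (intro exI[of _ W]) (auto simp: W_def)
qed

lemma local_pullback:
  assumes "smooth_pmap M \<phi>" "f \<in> smooth_funs M" "a \<in> dom \<phi>"
  obtains g W where "g \<in> smooth_funs M" "open W" "a \<in> W" "W \<subseteq> dom \<phi>"
    "\<And>p. p \<in> W \<Longrightarrow> g p = f (the (\<phi> p))"
proof -
  have "open (dom \<phi>)" using assms(1) by (simp add: smooth_pmap_def)
  from smooth_extension[OF this assms(3) smooth_pmap_pullback[OF assms(1,2)] that] show ?thesis .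
qed

text \<open>Derivations are local, so the function picked by \<open>SOME\<close> in
  \<open>differential\<close> may be exchanged for any convenient one with the same germ.\<close>

lemma differential_eq:
  assumes v: "v \<in> tangent_space M a" and f: "f \<in> smooth_funs M" and g: "g \<in> smooth_funs M"
    and W: "open W" "a \<in> W" "\<And>p. p \<in> W \<Longrightarrow> g p = f (the (\<phi> p))"
  shows "differential M \<phi> a v f = v g"
proof -
  let ?P = "\<lambda>g. g \<in> smooth_funs M \<and> (\<forall>\<^sub>F p in nhds a. g p = f (the (\<phi> p)))"
  have "?P g" using g W unfolding eventually_nhds by blast
  then have s: "?P (Eps ?P)" by (rule someI[of ?P])
  then obtain V where V: "open V" "a \<in> V" "\<And>p. p \<in> V \<Longrightarrow> Eps ?P p = f (the (\<phi> p))"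
    unfolding eventually_nhds by blast
  have "v (Eps ?P) = v g"
    by (rule tangent_local[OF v _ g, of _ "V \<inter> W"]) (use s V W in auto)
  then show ?thesis using v f by (simp add: differential_def)
qed

lemma path_smooth:
  assumes f: "f \<in> smooth_funs M" and S: "open S" "continuous_on S \<gamma>"
    and charts: "\<And>U x. (U, x) \<in> M \<Longrightarrow> smooth_on {t \<in> S. \<gamma> t \<in> U} (x \<circ> \<gamma>)"
  shows "smooth_on S (f \<circ> \<gamma>)"
proof (rule smooth_on_local)
  fix t assume t: "t \<in> S"
  obtain U x where c: "(U, x) \<in> M" and U: "\<gamma> t \<in> U" by (rule chart_cover)
  have "{t \<in> S. \<gamma> t \<in> U} = S \<inter> \<gamma> -` U" by auto
  then have o: "open {t \<in> S. \<gamma> t \<in> U}" using continuous_open_preimage[OF S(2,1) chartD(1)[OF c]]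
      by simp
  have "smooth_on {t \<in> S. \<gamma> t \<in> U} (\<lambda>t. (f \<circ> inv_into U x) ((x \<circ> \<gamma>) t))"
    by (rule smooth_on_compose[OF o chartD(2)[OF c] _ charts[OF c] smooth_funs_chart[OF f c]]) auto
  then have "smooth_on {t \<in> S. \<gamma> t \<in> U} (f \<circ> \<gamma>)"
    by (rule smooth_on_cong[OF _ o]) (use c in auto)
  then show "\<exists>T. open T \<and> t \<in> T \<and> smooth_on T (f \<circ> \<gamma>)" using o t U by blast
qed

text \<open>Near each point of the path the coordinate functions agree with global smooth functions.
  Testing on the latter avoids charts when a path is pushed forward.\<close>

lemma path_smooth_charts:
  assumes S: "open S" "continuous_on S \<gamma>" and f: "\<And>f. f \<in> smooth_funs M \<Longrightarrow> smooth_on S (f \<circ> \<gamma>)"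
    and c: "(U, x) \<in> M"
  shows "smooth_on {t \<in> S. \<gamma> t \<in> U} (x \<circ> \<gamma>)"
proof (rule smooth_on_local)
  fix t assume t: "t \<in> {t \<in> S. \<gamma> t \<in> U}"
  have "\<exists>g W. g \<in> smooth_funs M \<and> open W \<and> \<gamma> t \<in> W \<and> (\<forall>p\<in>W. g p = x p $ i)" for i
  proof -
    have "\<gamma> t \<in> U" using t by simp
    then show ?thesis
      by (rule smooth_extension[OF chartD(1)[OF c] _ smooth_near_coord[OF c]]) blast
  qed
  then have "\<forall>i. \<exists>g W. g \<in> smooth_funs M \<and> open W \<and> \<gamma> t \<in> W \<and> (\<forall>p\<in>W. g p = x p $ i)" by blast
  from choice[OF this] obtain g where "\<forall>i. \<exists>W. g i \<in> smooth_funs M \<and> open W \<and> \<gamma> t \<in> W \<and> (\<forall>p\<in>W. g i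
      p = x p $ i)"
    by blast
  from choice[OF this] obtain W where g: "\<And>i. g i \<in> smooth_funs M" "\<And>i. open (W i)" "\<And>i. \<gamma> t \<in> W i"
    "\<And>i p. p \<in> W i \<Longrightarrow> g i p = x p $ i" by blast
  define T where "T = S \<inter> \<gamma> -` (\<Inter>(range W))"
  have "open (\<Inter>(range W))" using g(2) by (intro open_Inter) auto
  then have T: "open T" unfolding T_def by (rule continuous_open_preimage[OF S(2,1)])
  have "smooth_on T (\<lambda>t. \<Sum>i\<in>UNIV. (g i \<circ> \<gamma>) t *\<^sub>R axis i 1)"
    by (intro smooth_on_sum smooth_on_linear[OF bounded_linear_scaleR_left] T smooth_on_subset[OF
        f[OF g(1)]])
      (auto simp: T_def)
  then have "smooth_on T (x \<circ> \<gamma>)"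
  proof (rule smooth_on_cong[OF _ T])
    fix s assume "s \<in> T"
    then have "(\<Sum>i\<in>UNIV. (g i \<circ> \<gamma>) s *\<^sub>R axis i 1) = (\<Sum>i\<in>UNIV. x (\<gamma> s) $ i *s axis i 1)"
      using g(4) by (auto simp: T_def scalar_mult_eq_scaleR)
    then show "(\<Sum>i\<in>UNIV. (g i \<circ> \<gamma>) s *\<^sub>R axis i 1) = (x \<circ> \<gamma>) s" by (simp add: basis_expansion)
  qed
  then show "\<exists>T. open T \<and> t \<in> T \<and> smooth_on T (x \<circ> \<gamma>)"
    using T t g(3) by (intro exI[of _ T]) (auto simp: T_def)
qed

end

section \<open>Pushforward along a diffeomorphism of the whole manifold\<close>

definition push :: "('m \<Rightarrow> 'm) \<Rightarrow> 'm tvec \<Rightarrow> 'm tvec" where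
  "push \<Psi> v f = v (f \<circ> \<Psi>)"

definition push_vfield :: "('m \<Rightarrow> 'm) \<Rightarrow> ('m \<Rightarrow> 'm) \<Rightarrow> 'm vfield \<Rightarrow> 'm vfield" where
  "push_vfield \<Psi> \<Theta> X b = push \<Psi> (X (\<Theta> b))"

definition push_op :: "('m \<Rightarrow> 'm) \<Rightarrow> ('m \<Rightarrow> 'm) \<Rightarrow> 'm oper \<Rightarrow> 'm oper" where
  "push_op \<Psi> \<Theta> A f = A (f \<circ> \<Psi>) \<circ> \<Theta>"

definition related_conns ::
    "('m::topological_space, 'n::finite) atlas \<Rightarrow> ('m \<Rightarrow> 'm) \<Rightarrow> ('m \<Rightarrow> 'm) \<Rightarrow> 'm conn \<Rightarrow> 'm conn \<Rightarrow> bool"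
        where
  "related_conns M \<Psi> \<Theta> nab nab' \<longleftrightarrow> (\<forall>X\<in>vfields M. \<forall>Y\<in>vfields M.
     nab' (push_vfield \<Psi> \<Theta> X) (push_vfield \<Psi> \<Theta> Y) = push_vfield \<Psi> \<Theta> (nab X Y))"

text \<open>A global diffeomorphism as a pair of mutually inverse total maps, detached from partial
  maps. The assumptions are symmetric in \<open>\<Psi>\<close> and \<open>\<Theta>\<close>, so every
  result is available for the inverse as well.\<close>

locale diffeo = manifold M
  for M :: "('m::{t2_space,second_countable_topology}, 'n::finite) atlas" +
  fixes \<Psi> \<Theta> :: "'m \<Rightarrow> 'm"
  assumes inv [simp]: "\<Theta> (\<Psi> p) = p" "\<Psi> (\<Theta> p) = p"
    and smooth_comp: "f \<in> smooth_funs M \<Longrightarrow> f \<circ> \<Psi> \<in> smooth_funs M" "f \<in> smooth_funs M \<Longrightarrow> f \<circ> \<Theta> \<in>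
        smooth_funs M"
    and cont: "continuous_on UNIV \<Psi>" "continuous_on UNIV \<Theta>"
begin

lemma inverse_diffeo: "diffeo M \<Theta> \<Psi>"
  by (intro diffeo.intro manifold_axioms diffeo_axioms.intro) (auto simp: smooth_comp cont)

lemma inv_comp [simp]: "f \<circ> \<Psi> \<circ> \<Theta> = f" "f \<circ> \<Theta> \<circ> \<Psi> = f"
  by (auto simp: fun_eq_iff)

lemma smooth_comp_iff: "f \<circ> \<Psi> \<in> smooth_funs M \<longleftrightarrow> f \<in> smooth_funs M"
  using smooth_comp[of f] smooth_comp(2)[of "f \<circ> \<Psi>"] by auto

lemma push_tangent:
  assumes v: "v \<in> tangent_space M a"
  shows "push \<Psi> v \<in> tangent_space M (\<Psi> a)"
proof -
  have "v ((\<lambda>p. f p + g p) \<circ> \<Psi>) = v (f \<circ> \<Psi>) + v (g \<circ> \<Psi>)"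
    "v ((\<lambda>p. f p * g p) \<circ> \<Psi>) = f (\<Psi> a) * v (g \<circ> \<Psi>) + g (\<Psi> a) * v (f \<circ> \<Psi>)"
    if "f \<in> smooth_funs M" "g \<in> smooth_funs M" for f g
    using tangent_add[OF v smooth_comp(1)[OF that(1)] smooth_comp(1)[OF that(2)]]
      tangent_mult[OF v smooth_comp(1)[OF that(1)] smooth_comp(1)[OF that(2)]]
          by (simp_all add: comp_def)
  moreover have "v ((\<lambda>p. c * f p) \<circ> \<Psi>) = c * v (f \<circ> \<Psi>)" if "f \<in> smooth_funs M" for f c
    using tangent_cmult[OF v smooth_comp(1)[OF that], of c] by (simp add: comp_def)
  moreover have "v (f \<circ> \<Psi>) = 0" if "f \<notin> smooth_funs M" for f
    using tangent_outside[OF v] smooth_comp_iff that by simp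
  ultimately show ?thesis unfolding tangent_space_def[of M "\<Psi> a"] push_def by blast
qed

lemma push_inv [simp]: "push \<Theta> (push \<Psi> v) = v" "push \<Psi> (push \<Theta> v) = v"
  by (auto simp: push_def fun_eq_iff)

lemma push_tangent': "w \<in> tangent_space M (\<Psi> a) \<Longrightarrow> push \<Theta> w \<in> tangent_space M a"
  using diffeo.push_tangent[OF inverse_diffeo, of w "\<Psi> a"] by simp

lemma push_vfield_at [simp]: "push_vfield \<Psi> \<Theta> X (\<Psi> a) = push \<Psi> (X a)"
  by (simp add: push_vfield_def)

lemma push_vfields:
  assumes X: "X \<in> vfields M"
  shows "push_vfield \<Psi> \<Theta> X \<in> vfields M"
proof -
  have "(\<lambda>b. push_vfield \<Psi> \<Theta> X b f) \<in> smooth_funs M" if "f \<in> smooth_funs M" for f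
    using smooth_comp(2)[OF vfields_smooth[OF X smooth_comp(1)[OF that]]]
    by (simp add: push_vfield_def push_def comp_def)
  moreover have "push_vfield \<Psi> \<Theta> X b \<in> tangent_space M b" for b
    using push_tangent[OF vfields_tangent[OF X], of "\<Theta> b"] by (simp add: push_vfield_def)
  ultimately show ?thesis by (simp add: vfields_def)
qed

lemma push_vfield_inv [simp]: "push_vfield \<Theta> \<Psi> (push_vfield \<Psi> \<Theta> X) = X"
  "push_vfield \<Psi> \<Theta> (push_vfield \<Theta> \<Psi> X) = X"
  by (auto simp: push_vfield_def fun_eq_iff)

lemma dual_basis_push:
  assumes "local_frame M N E \<xi>" "a \<in> N"
  shows "dual_basis M (\<Psi> a) (\<lambda>i. push_vfield \<Psi> \<Theta> (E i) (\<Psi> a)) (\<lambda>i. dfun M (\<Psi> a) (\<xi> i \<circ> \<Theta>))"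
  unfolding dual_basis_def
proof (intro conjI allI ballI ext)
  fix w f assume w: "w \<in> tangent_space M (\<Psi> a)"
  have "w f = push \<Theta> w (f \<circ> \<Psi>)" by (simp add: push_def)
  also have "\<dots> = (\<Sum>i\<in>UNIV. push \<Theta> w (\<xi> i) * E i a (f \<circ> \<Psi>))"
    by (rule local_frameD(5)[OF assms push_tangent'[OF w]])
  also have "\<dots> = (\<Sum>i\<in>UNIV. dfun M (\<Psi> a) (\<xi> i \<circ> \<Theta>) w * push_vfield \<Psi> \<Theta> (E i) (\<Psi> a) f)"
    using dfun_apply[OF w] by (simp add: push_def)
  finally show "w f = (\<Sum>i\<in>UNIV. dfun M (\<Psi> a) (\<xi> i \<circ> \<Theta>) w * push_vfield \<Psi> \<Theta> (E i) (\<Psi> a) f)" .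
qed (use local_frameD(2)[OF assms(1)] vfields_tangent push_vfields dfun_cotangent in blast)+

lemma commutator_push: "commutator (push_op \<Psi> \<Theta> A) f = push_op \<Psi> \<Theta> (commutator A (f \<circ> \<Psi>))"
  by (auto simp: commutator_def push_op_def fun_eq_iff comp_def)

lemma commutators_push: "commutators (push_op \<Psi> \<Theta> A) fs = push_op \<Psi> \<Theta> (commutators A (map (\<lambda>f. f \<circ>
    \<Psi>) fs))"
  by (induction fs arbitrary: A) (auto simp: commutator_push)

lemma linear_oper_push:
  assumes A: "linear_oper M A"
  shows "linear_oper M (push_op \<Psi> \<Theta> A)"
proof -
  note L = linear_operD[OF A]
  have "A ((\<lambda>p. f p + g p) \<circ> \<Psi>) \<circ> \<Theta> = (\<lambda>p. (A (f \<circ> \<Psi>) \<circ> \<Theta>) p + (A (g \<circ> \<Psi>) \<circ> \<Theta>) p)"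
    if "f \<in> smooth_funs M" "g \<in> smooth_funs M" for f g
    using L(2)[OF smooth_comp(1)[OF that(1)] smooth_comp(1)[OF that(2)]] by (simp add: comp_def)
  moreover have "A ((\<lambda>p. c * f p) \<circ> \<Psi>) \<circ> \<Theta> = (\<lambda>p. c * (A (f \<circ> \<Psi>) \<circ> \<Theta>) p)"
      if "f \<in> smooth_funs M" for f c
    using L(3)[OF smooth_comp(1)[OF that], of c] by (simp add: comp_def)
  moreover have "A (f \<circ> \<Psi>) \<circ> \<Theta> \<in> smooth_funs M" if "f \<in> smooth_funs M" for f
    using smooth_comp(2)[OF L(1)[OF smooth_comp(1)[OF that]]] .
  ultimately show ?thesis unfolding linear_oper_def push_op_def by blast
qed

lemma diff_oper_push: "diff_oper M k A \<Longrightarrow> diff_oper M k (push_op \<Psi> \<Theta> A)"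
proof (induction k arbitrary: A)
  case 0
  have "push_op \<Psi> \<Theta> (commutator A (f \<circ> \<Psi>)) g = (\<lambda>p. 0)"
      if "f \<in> smooth_funs M" "g \<in> smooth_funs M" for f g
    using 0 that smooth_comp by (simp add: push_op_def comp_def)
  then show ?case using 0 by (simp add: linear_oper_push commutator_push)
next
  case (Suc k)
  then show ?case by (simp add: linear_oper_push commutator_push smooth_comp)
qed

lemma symbol_push:
  assumes A: "diff_oper M k A" and fs: "set fs \<subseteq> smooth_funs M" "length fs = k"
  shows "symbol M k (push_op \<Psi> \<Theta> A) (\<Psi> a) (map (dfun M (\<Psi> a)) fs) =
    symbol M k A a (map (dfun M a) (map (\<lambda>f. f \<circ> \<Psi>) fs))"
proof -
  have "set (map (\<lambda>f. f \<circ> \<Psi>) fs) \<subseteq> smooth_funs M" using fs(1) smooth_comp by auto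
  then show ?thesis
    using symbol_dfun[OF diff_oper_push[OF A] fs] symbol_dfun[OF A, of "map (\<lambda>f. f \<circ> \<Psi>) fs"] fs(2)
    by (simp add: commutators_push) (simp add: push_op_def comp_def)
qed

lemma symbol_cong:
  assumes A: "diff_oper M k A" and eq: "\<And>f. f \<in> smooth_funs M \<Longrightarrow> A f = B f"
  shows "symbol M k A = symbol M k B"
proof (intro ext)
  fix a \<eta>s
  show "symbol M k A a \<eta>s = symbol M k B a \<eta>s"
  proof (cases "length \<eta>s = k \<and> set \<eta>s \<subseteq> cotangent_space M a")
    case True
    then obtain fs where fs: "set fs \<subseteq> smooth_funs M" "map (dfun M a) fs = \<eta>s"
        using dfun_surj_list by blast
    have len: "length fs = k" using True arg_cong[OF fs(2), of length] by simp
    have "commutators A fs (\<lambda>p. 1) = commutators B fs (\<lambda>p. 1)"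
      using eq fs(1) by (intro commutators_cong) auto
    then show ?thesis
      using symbol_dfun[OF A fs(1) len, of a] symbol_dfun[OF diff_oper_cong[OF eq A] fs(1) len, of
          a] fs(2)
      by simp
  qed (simp add: symbol_outside)
qed

text \<open>This is \<open>push_field\<close> with the differential of the partial map replaced by
  \<open>push\<close>; restricting \<open>push\<close> to the tangent space matches the restriction
  in \<open>differential\<close>.\<close>

definition push_contra :: "'m contra_field \<Rightarrow> 'm contra_field" where
  "push_contra H b = act M (\<Theta> b) b (\<lambda>v\<in>tangent_space M (\<Theta> b). push \<Psi> v) (H (\<Theta> b))"

lemma pull_covector:
  "(\<lambda>v. if v \<in> tangent_space M a then dfun M (\<Psi> a) f ((\<lambda>v\<in>tangent_space M a. push \<Psi> v) v) else 0)
      = dfun M a (f \<circ> \<Psi>)"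
proof
  fix v show "(if v \<in> tangent_space M a then dfun M (\<Psi> a) f ((\<lambda>v\<in>tangent_space M a. push \<Psi> v) v)
      else 0) = dfun M a (f \<circ> \<Psi>) v"
    using dfun_apply[OF push_tangent[of v a], of f] by (simp add: dfun_def push_def)
qed

lemma push_contra_symbol:
  assumes A: "diff_oper M k A"
  shows "push_contra (symbol M k A) = symbol M k (push_op \<Psi> \<Theta> A)"
proof (intro ext)
  fix b \<eta>s
  define a where "a = \<Theta> b"
  have b: "b = \<Psi> a" by (simp add: a_def)
  show "push_contra (symbol M k A) b \<eta>s = symbol M k (push_op \<Psi> \<Theta> A) b \<eta>s"
  proof (cases "length \<eta>s = k \<and> set \<eta>s \<subseteq> cotangent_space M b")
    case True
    then obtain fs where fs: "set fs \<subseteq> smooth_funs M" "map (dfun M b) fs = \<eta>s"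
        using dfun_surj_list by blast
    have len: "length fs = k" using True arg_cong[OF fs(2), of length] by simp
    have "push_contra (symbol M k A) b \<eta>s = symbol M k A a (map (dfun M a) (map (\<lambda>f. f \<circ> \<Psi>) fs))"
      using True fs(2)[symmetric] pull_covector[of a]
          by (simp add: push_contra_def act_def b comp_def)
    also have "\<dots> = symbol M k (push_op \<Psi> \<Theta> A) b \<eta>s"
      using symbol_push[OF A fs(1) len, of a] fs(2) b by simp
    finally show ?thesis .
  next
    case False
    then show ?thesis by (auto simp: symbol_outside push_contra_def act_def)
  qed
qed

lemma symmetrization_push:
  assumes T: "\<And>us. set us \<subseteq> tangent_space M a \<Longrightarrow> length us = length vs \<Longrightarrow> T' (\<Psi> a) (map (push \<Psi>) us)
      = T a us"
    and vs: "set vs \<subseteq> tangent_space M a"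
  shows "symmetrization T' (\<Psi> a) (map (push \<Psi>) vs) = symmetrization T a vs"
proof -
  have "T' (\<Psi> a) (permute_list \<pi> (map (push \<Psi>) vs)) = T a (permute_list \<pi> vs)"
    if "\<pi> permutes {..<length vs}" for \<pi>
    using T[of "permute_list \<pi> vs"] vs that by (simp add: permute_list_map)
  then show ?thesis by (simp add: symmetrization_def)
qed

end

section \<open>Naturality of covariant differentials, quantization and total symbols\<close>

locale related_connections = diffeo M \<Psi> \<Theta> + C: connection M nab + C': connection M nab'
  for M :: "('m::{t2_space,second_countable_topology}, 'n::finite) atlas"
  and \<Psi> \<Theta> :: "'m \<Rightarrow> 'm" and nab nab' :: "'m conn" +
  assumes related: "related_conns M \<Psi> \<Theta> nab nab'"
begin

text \<open>On pushed fields every ingredient of \<open>cd\<close> is carried along: the values of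
  the tensors by \<open>rel\<close>, the connections by relatedness. Independence of extensions is
  essential, because \<open>extend\<close> chooses the extension of a pushed vector without regard
  to that of the vector itself.\<close>

lemma cov_differential_push:
  assumes T: "cov_tensor k T" and T': "cov_tensor k T'"
    and rel: "\<And>a us. set us \<subseteq> tangent_space M a \<Longrightarrow> length us = k \<Longrightarrow> T' (\<Psi> a) (map (push \<Psi>) us) = T a
        us"
    and vs: "set vs \<subseteq> tangent_space M a" "length vs = Suc k"
  shows "cov_differential M nab' T' (\<Psi> a) (map (push \<Psi>) vs) = cov_differential M nab T a vs"
proof -
  let ?P = "push_vfield \<Psi> \<Theta>"
  obtain v us where vus: "vs = v # us" using vs(2) by (cases vs) auto
  define X where "X = extend M a v"
  define Ys where "Ys = map (extend M a) us"
  have X: "X \<in> vfields M" "X a = v" using vs vus extend_vfield extend_at by (auto simp: X_def)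
  have Ys: "set Ys \<subseteq> vfields M" "length Ys = k" "at_point Ys a = us"
    using vs vus extend_list[of us a] by (auto simp: Ys_def)
  have PYs: "set (map ?P Ys) \<subseteq> vfields M" using Ys(1) push_vfields by auto
  have at: "at_point (map ?P Ys) (\<Psi> p) = map (push \<Psi>) (at_point Ys p)" for p by simp
  have "cov_differential M nab' T' (\<Psi> a) (map (push \<Psi>) vs) = C'.cd T' (?P X) (map ?P Ys) (\<Psi> a)"
    using C'.cov_differential_eq[OF T' push_vfields[OF X(1)] PYs, of "\<Psi> a"] X(2) Ys(2,3) vus at[of
        a] by simp
  also have "\<dots> = C.cd T X Ys a"
  proof -
    have "(\<lambda>q. T' q (at_point (map ?P Ys) q)) \<circ> \<Psi> = (\<lambda>p. T p (at_point Ys p))"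
      using rel[OF at_point_tangent[OF Ys(1)]] Ys(2) at by (intro ext) (simp del: map_map)
    then have 1: "?P X (\<Psi> a) (\<lambda>q. T' q (at_point (map ?P Ys) q)) = X a (\<lambda>p. T p (at_point Ys p))"
      by (simp add: push_def del: map_map)
    have 2: "T' (\<Psi> a) ((at_point (map ?P Ys) (\<Psi> a))[j := nab' (?P X) (map ?P Ys ! j) (\<Psi> a)]) =
        T a ((at_point Ys a)[j := nab X (Ys ! j) a])" if j: "j < k" for j
    proof -
      have Y: "Ys ! j \<in> vfields M" using Ys j by auto
      have "nab' (?P X) (map ?P Ys ! j) (\<Psi> a) = push \<Psi> (nab X (Ys ! j) a)"
        using related X(1) Y Ys(2) j by (simp add: related_conns_def)
      moreover have "set ((at_point Ys a)[j := nab X (Ys ! j) a]) \<subseteq> tangent_space M a"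
        using at_point_tangent[OF Ys(1)] vfields_tangent[OF C.conn_vfield[OF X(1) Y]]
            by (intro set_update_subsetI) auto
      ultimately show ?thesis using rel[of "(at_point Ys a)[j := nab X (Ys ! j) a]" a] Ys(2)
        unfolding at by (simp add: map_update)
    qed
    show ?thesis unfolding C.cd_def C'.cd_def 1 using 2 Ys(2) by simp
  qed
  also have "\<dots> = cov_differential M nab T a vs"
    using C.cov_differential_eq[OF T X(1) Ys(1,2), of a] X(2) Ys(3) vus by simp
  finally show ?thesis .
qed

lemma sym_deriv_push:
  assumes f: "f \<in> smooth_funs M" and "set vs \<subseteq> tangent_space M a" "length vs = i"
  shows "(sym_deriv M nab' ^^ i) (fun_field f) (\<Psi> a) (map (push \<Psi>) vs) =
    (sym_deriv M nab ^^ i) (fun_field (f \<circ> \<Psi>)) a vs"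
  using assms(2,3)
proof (induction i arbitrary: a vs)
  case 0
  then show ?case by (simp add: fun_field_def)
next
  case (Suc i)
  let ?T = "(sym_deriv M nab ^^ i) (fun_field (f \<circ> \<Psi>))" and ?T' = "(sym_deriv M nab' ^^ i)
      (fun_field f)"
  have "cov_differential M nab' ?T' (\<Psi> a) (map (push \<Psi>) us) = cov_differential M nab ?T a us"
    if "set us \<subseteq> tangent_space M a" "length us = length vs" for us
    by (rule cov_differential_push[OF C.cov_tensor_iterate[OF smooth_comp(1)[OF f]]
          C'.cov_tensor_iterate[OF f] Suc.IH that(1)]) (use that Suc.prems in auto)
  note symmetrization_push[where a = a and vs = vs and T = "cov_differential M nab ?T"
      and T' = "cov_differential M nab' ?T'", OF this Suc.prems(1)]
  moreover have "(sym_deriv M n ^^ Suc i) x = symmetrization (cov_differential M n ((sym_deriv M n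
      ^^ i) x))" for n x
    unfolding funpow.simps(2) comp_apply sym_deriv_def[of M n "(sym_deriv M n ^^ i) x"] ..
  ultimately show ?case by (simp only:)
qed

text \<open>One side is expanded in a local frame around \<open>a\<close>, the other in the image of
  that frame; the two sums then agree term by term.\<close>

lemma quantization_push:
  assumes A: "diff_oper M k A" and f: "f \<in> smooth_funs M"
  shows "quantization M nab' k (symbol M k (push_op \<Psi> \<Theta> A)) f (\<Psi> a) =
    quantization M nab k (symbol M k A) (f \<circ> \<Psi>) a"
proof -
  obtain N E \<xi> where F: "local_frame M N E \<xi>" and a: "a \<in> N" by (rule local_frame_exists)
  let ?P = "push_vfield \<Psi> \<Theta>"
  note E = local_frameD(2)[OF F]
  have "symbol M k (push_op \<Psi> \<Theta> A) (\<Psi> a) (map (\<lambda>i. dfun M (\<Psi> a) (\<xi> i \<circ> \<Theta>)) is) * C'.jet_oper k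
      (map (\<lambda>i. ?P (E i)) is) f (\<Psi> a) =
      symbol M k A a (map (\<lambda>i. dfun M a (\<xi> i)) is) * C.jet_oper k (map E is) (f \<circ> \<Psi>) a"
    if len: "length is = k" for "is"
  proof -
    have "set (map (\<lambda>i. \<xi> i \<circ> \<Theta>) is) \<subseteq> smooth_funs M"
        using smooth_comp local_frameD(3)[OF F] by auto
    from symbol_push[OF A this] have "symbol M k (push_op \<Psi> \<Theta> A) (\<Psi> a) (map (\<lambda>i. dfun M (\<Psi> a) (\<xi> i
        \<circ> \<Theta>)) is) =
        symbol M k A a (map (\<lambda>i. dfun M a (\<xi> i)) is)" using len by (simp add: comp_def)
    moreover have "C'.jet_oper k (map (\<lambda>i. ?P (E i)) is) f (\<Psi> a) = C.jet_oper k (map E is) (f \<circ> \<Psi>)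
        a"
      using sym_deriv_push[OF f at_point_tangent[of "map E is" a], of k] E len
      by (auto simp: C.jet_oper_def C'.jet_oper_def comp_def)
    ultimately show ?thesis by simp
  qed
  then show ?thesis
    using C'.quantization_eq[where E = "\<lambda>i. ?P (E i)" and H = "symbol M k (push_op \<Psi> \<Theta> A)",
        OF dual_basis_push[OF F a] mlin_symbol[OF diff_oper_push[OF A]] f]
      C.quantization_eq[where E = E and H = "symbol M k A",
        OF dual_basis_local_frame[OF F a] mlin_symbol[OF A] smooth_comp(1)[OF f]]
    by simp
qed

text \<open>\<open>A'\<close> only has to agree with the pushed operator on smooth functions.
  Equivalence of operators gives no more, and the remainders in the recursion satisfy this weaker
  condition again.\<close>

lemma total_symbol_push:
  assumes "diff_oper M k A" "\<And>f. f \<in> smooth_funs M \<Longrightarrow> A' f = push_op \<Psi> \<Theta> A f"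
  shows "map push_contra (total_symbol M nab k A) = total_symbol M nab' k A'"
  using assms
proof (induction k arbitrary: A A')
  case 0
  have "symbol M 0 A' = symbol M 0 (push_op \<Psi> \<Theta> A)"
    using symbol_cong[OF diff_oper_push[OF 0(1)], of A'] 0(2) by simp
  then show ?case using push_contra_symbol[OF 0(1)] by simp
next
  case (Suc k)
  have \<sigma>: "symbol M (Suc k) A' = symbol M (Suc k) (push_op \<Psi> \<Theta> A)"
    using symbol_cong[OF diff_oper_push[OF Suc.prems(1)], of A'] Suc.prems(2) by simp
  let ?R = "\<lambda>f p. A f p - quantization M nab (Suc k) (symbol M (Suc k) A) f p"
  let ?R' = "\<lambda>f p. A' f p - quantization M nab' (Suc k) (symbol M (Suc k) A') f p"
  have "map push_contra (total_symbol M nab k ?R) = total_symbol M nab' k ?R'"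
  proof (rule Suc.IH[OF C.diff_oper_remainder[OF Suc.prems(1)]])
    fix f assume f: "f \<in> smooth_funs M"
    show "?R' f = push_op \<Psi> \<Theta> ?R f"
    proof
      fix p
      show "?R' f p = push_op \<Psi> \<Theta> ?R f p"
        using quantization_push[OF Suc.prems(1) f, of "\<Theta> p"] Suc.prems(2)[OF f] \<sigma>
            by (simp add: push_op_def)
    qed
  qed
  then show ?case using push_contra_symbol[OF Suc.prems(1)] \<sigma> by simp
qed

end

text \<open>Equal leading symbols have equal quantizations, so the remainders have equal total
  symbols and the induction applies; at order 0 an operator is multiplication by its symbol.\<close>

lemma (in connection) total_symbol_inj:
  assumes "diff_oper M k A" "diff_oper M k B" "total_symbol M nab k A = total_symbol M nab k B" "f
      \<in> smooth_funs M"
  shows "A f = B f"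
  using assms(1-3)
proof (induction k arbitrary: A B)
  case 0
  have "symbol M 0 A p [] = symbol M 0 B p []" for p using 0(3) by simp
  then have "A (\<lambda>p. 1) p = B (\<lambda>p. 1) p" for p by (simp add: symbol_def)
  then show ?case using order_zero_oper[OF 0(1) assms(4)] order_zero_oper[OF 0(2) assms(4)] by
      (intro ext) simp
next
  case (Suc k)
  let ?R = "\<lambda>A f p. A f p - quantization M nab (Suc k) (symbol M (Suc k) A) f p"
  have "?R A f = ?R B f"
    using Suc.prems(3) by (intro Suc.IH diff_oper_remainder Suc.prems) auto
  moreover have "symbol M (Suc k) A = symbol M (Suc k) B" using Suc.prems(3) by simp
  ultimately show ?case by (auto simp: fun_eq_iff)
qed

section \<open>Linear ordinary differential equations\<close>

text \<open>Gronwall's argument: |c|^2 exp(-2Kt) does not increase and starts at 0.\<close>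

lemma linear_ode_unique:
  fixes c :: "real \<Rightarrow> 'a::real_inner"
  assumes ab: "a \<le> b"
    and c: "\<And>t. t \<in> {a..b} \<Longrightarrow> (c has_vector_derivative L t (c t)) (at t within {a..b})"
    and K: "\<And>t x. t \<in> {a..b} \<Longrightarrow> norm (L t x) \<le> K * norm x"
    and "c a = 0"
  shows "c b = 0"
proof -
  define g where "g t = (c t \<bullet> c t) * exp (- (2 * K) * t)" for t
  have cont: "continuous_on {a..b} c"
    using c has_vector_derivative_continuous by (force simp: continuous_on_eq_continuous_within)
  have "g b \<le> g a"
  proof (rule DERIV_nonpos_imp_decreasing_open[OF ab])
    fix t assume t: "a < t" "t < b"
    then have "(c has_vector_derivative L t (c t)) (at t)"
      using c[of t] by (simp add: at_within_Icc_at)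
    then have "((\<lambda>t. c t \<bullet> c t) has_vector_derivative (c t \<bullet> L t (c t) + L t (c t) \<bullet> c t)) (at t)"
      by (intro bounded_bilinear.has_vector_derivative[OF bounded_bilinear_inner])
    then have 1: "((\<lambda>t. c t \<bullet> c t) has_real_derivative 2 * (c t \<bullet> L t (c t))) (at t)"
      by (simp add: has_real_derivative_iff_has_vector_derivative inner_commute)
    have 2: "(g has_real_derivative (2 * (c t \<bullet> L t (c t)) - 2 * K * (c t \<bullet> c t)) * exp (- (2 * K)
        * t)) (at t)"
      unfolding g_def[abs_def] by (auto intro!: derivative_eq_intros 1 simp: algebra_simps)
    have "c t \<bullet> L t (c t) \<le> norm (c t) * norm (L t (c t))" by (rule norm_cauchy_schwarz)
    also have "\<dots> \<le> norm (c t) * (K * norm (c t))" using K[of t "c t"] t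
        by (intro mult_left_mono) auto
    finally have "c t \<bullet> L t (c t) \<le> K * (c t \<bullet> c t)"
        by (simp add: dot_square_norm power2_eq_square mult_ac)
    then have "(2 * (c t \<bullet> L t (c t)) - 2 * K * (c t \<bullet> c t)) * exp (- (2 * K) * t) \<le> 0"
      by (intro mult_nonpos_nonneg) auto
    with 2 show "\<exists>y. (g has_real_derivative y) (at t) \<and> y \<le> 0" by blast
  next
    show "continuous_on {a..b} g" unfolding g_def[abs_def] by (intro continuous_intros cont)
  qed
  then have "(c b \<bullet> c b) * exp (- (2 * K) * b) \<le> 0" using assms(4) by (simp add: g_def)
  then have "c b \<bullet> c b \<le> 0" by (simp add: mult_le_0_iff)
  then show ?thesis by (metis inner_gt_zero_iff not_le)
qed

text \<open>Picard iteration on an interval so short that the integral operator is a contraction,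
  which is the condition \<open>K * (b - a) < 1\<close>. To work in the complete space of bounded
  continuous functions, curves on \<open>{a..b}\<close> are extended constantly by
  \<open>clamp\<close>.\<close>

lemma linear_ode_exists:
  fixes c0 :: "'a::euclidean_space"
  assumes ab: "a \<le> b"
    and lin: "\<And>t x y. t \<in> {a..b} \<Longrightarrow> L t (x - y) = L t x - L t y"
    and K: "\<And>t x. t \<in> {a..b} \<Longrightarrow> norm (L t x) \<le> K * norm x" "K \<ge> 0" "K * (b - a) < 1"
    and cont: "\<And>c. continuous_on {a..b} c \<Longrightarrow> continuous_on {a..b} (\<lambda>t. L t (c t))"
  obtains c where "c a = c0" "\<And>t. t \<in> {a..b} \<Longrightarrow> (c has_vector_derivative L t (c t)) (at t within
      {a..b})"
proof -
  have cb: "continuous_on {a..b} (\<lambda>s. L s (apply_bcontfun c s))" for c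
    by (rule cont) (simp add: continuous_on_apply_bcontfun)
  have sub: "continuous_on {a..t} (\<lambda>s. L s (apply_bcontfun c s))" if "t \<le> b" for c t
    by (rule continuous_on_subset[OF cb]) (use that in auto)
  have "\<exists>g. \<forall>x. apply_bcontfun g x = c0 + integral {a..clamp a b x} (\<lambda>s. L s (apply_bcontfun c
      s))" for c
  proof -
    have "continuous_on (cbox a b) (\<lambda>x. c0 + integral {a..x} (\<lambda>s. L s (apply_bcontfun c s)))"
      by (auto intro!: continuous_intros indefinite_integral_continuous_1
          integrable_continuous_real cb)
    from continuous_on_cbox_bcontfunE[OF this] show ?thesis by metis
  qed
  then obtain T where T: "\<And>c x. apply_bcontfun (T c) x = c0 + integral {a..clamp a b x} (\<lambda>s. L s
      (apply_bcontfun c s))"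
    by metis
  have clamp: "clamp a b x \<in> {a..b}" for x :: real
    using clamp_in_interval[of a b x] ab by simp
  have "dist (T c) (T d) \<le> (K * (b - a)) * dist c d" for c d
  proof (rule dist_bound)
    fix x
    let ?y = "clamp a b x"
    have y: "a \<le> ?y" "?y \<le> b" using clamp[of x] by auto
    have "dist (apply_bcontfun (T c) x) (apply_bcontfun (T d) x) =
        norm (integral {a..?y} (\<lambda>s. L s (apply_bcontfun c s)) - integral {a..?y} (\<lambda>s. L s
            (apply_bcontfun d s)))"
      by (simp add: T dist_norm)
    also have "\<dots> = norm (integral {a..?y} (\<lambda>s. L s (apply_bcontfun c s) - L s (apply_bcontfun d
        s)))"
      by (subst integral_diff) (auto intro!: integrable_continuous_real sub y)
    also have "\<dots> \<le> (K * dist c d) * (?y - a)"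
    proof (rule integral_bound[OF y(1)])
      show "continuous_on {a..?y} (\<lambda>s. L s (apply_bcontfun c s) - L s (apply_bcontfun d s))"
        by (intro continuous_on_diff sub y)
      fix t assume "t \<in> {a..?y}"
      then have t: "t \<in> {a..b}" using y by auto
      have "norm (L t (apply_bcontfun c t) - L t (apply_bcontfun d t)) \<le> K * dist (apply_bcontfun
          c t) (apply_bcontfun d t)"
        using K(1)[OF t, of "apply_bcontfun c t - apply_bcontfun d t"] lin[OF t]
            by (simp add: dist_norm)
      also have "\<dots> \<le> K * dist c d" by (intro mult_left_mono dist_bounded K)
      finally show "norm (L t (apply_bcontfun c t) - L t (apply_bcontfun d t)) \<le> K * dist c d" .
    qed
    also have "\<dots> \<le> (K * dist c d) * (b - a)" using y K by (intro mult_left_mono) auto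
    finally show "dist (apply_bcontfun (T c) x) (apply_bcontfun (T d) x) \<le> (K * (b - a)) * dist c
        d" by (simp add: mult_ac)
  qed
  then obtain c where c: "T c = c"
    using banach_fix_type[of "K * (b - a)" T] K ab by auto
  have eq: "apply_bcontfun c t = c0 + integral {a..t} (\<lambda>s. L s (apply_bcontfun c s))"
      if "t \<in> {a..b}" for t
    using T[of c t] c that by (simp add: clamp_cancel_cbox)
  show ?thesis
  proof (rule that)
    show "apply_bcontfun c a = c0" using eq[of a] ab by simp
    fix t assume t: "t \<in> {a..b}"
    have "((\<lambda>u. integral {a..u} (\<lambda>s. L s (apply_bcontfun c s))) has_vector_derivative L t
        (apply_bcontfun c t)) (at t within {a..b})"
      by (rule integral_has_vector_derivative[OF cb t])
    then have "((\<lambda>u. c0 + integral {a..u} (\<lambda>s. L s (apply_bcontfun c s))) has_vector_derivative L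
        t (apply_bcontfun c t)) (at t within {a..b})"
      by (auto intro!: derivative_eq_intros)
    then show "(apply_bcontfun c has_vector_derivative L t (apply_bcontfun c t)) (at t within
        {a..b})"
      by (rule has_vector_derivative_transform[OF t, rotated]) (simp add: eq)
  qed
qed

section \<open>Parallel transport\<close>

context connection begin

lemma conn_zero2:
  assumes X: "X \<in> vfields M"
  shows "nab X (\<lambda>p f. 0) = (\<lambda>p f. 0)"
  using conn_fmult2[OF smooth_const[of 0] X vfields_zero] tangent_const[OF vfields_tangent[OF X]]
      by simp

lemma conn_sum2:
  assumes X: "X \<in> vfields M" and g: "\<And>i. i \<in> I \<Longrightarrow> g i \<in> smooth_funs M" and Y: "\<And>i. i \<in> I \<Longrightarrow> Y i \<in>
      vfields M"
  shows "nab X (\<lambda>p f. \<Sum>i\<in>I. g i p * Y i p f) = (\<lambda>p f. \<Sum>i\<in>I. X p (g i) * Y i p f + g i p * nab X (Y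
      i) p f)"
  using g Y
proof (induction I rule: infinite_finite_induct)
  case (insert i I)
  have 1: "(\<lambda>p f. g i p * Y i p f) \<in> vfields M" and 2: "(\<lambda>p f. \<Sum>i\<in>I. g i p * Y i p f) \<in> vfields M"
    using insert.prems by (auto intro!: vfields_fmult vfields_sum)
  have "nab X (\<lambda>p f. \<Sum>i\<in>insert i I. g i p * Y i p f) = nab X (\<lambda>p f. g i p * Y i p f + (\<Sum>i\<in>I. g i p
      * Y i p f))"
    using insert.hyps by simp
  also have "\<dots> = (\<lambda>p f. nab X (\<lambda>p f. g i p * Y i p f) p f + nab X (\<lambda>p f. \<Sum>i\<in>I. g i p * Y i p f) p
      f)"
    by (rule conn_add2[OF X 1 2])
  finally show ?case
    using insert conn_fmult2[OF _ X, of "g i" "Y i"] by simp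
qed (simp_all add: conn_zero2[OF X])

text \<open>Multiplication by a bump function makes the two fields equal everywhere. At
  \<open>a\<close> the Leibniz rule gives back their covariant derivatives plus the same extra term
  on both sides.\<close>

lemma conn_local2:
  assumes X: "X \<in> vfields M" and Y: "Y \<in> vfields M" "Y' \<in> vfields M"
    and N: "open N" "a \<in> N" "\<And>p. p \<in> N \<Longrightarrow> Y p = Y' p"
  shows "nab X Y a = nab X Y' a"
proof
  fix f
  obtain \<kappa> W K where \<kappa>: "\<kappa> \<in> smooth_funs M" "open W" "a \<in> W" "W \<subseteq> N" "closed K" "K \<subseteq> N"
    "\<And>p. p \<in> W \<Longrightarrow> \<kappa> p = 1" "\<And>p. p \<notin> K \<Longrightarrow> \<kappa> p = 0"
    using bump[OF N(1,2)] by metis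
  have eq: "\<kappa> p * Y p f = \<kappa> p * Y' p f" for p f
    using N(3)[of p] \<kappa>(6) \<kappa>(8)[of p] by (cases "p \<in> K") auto
  then have "(\<lambda>p f. \<kappa> p * Y p f) = (\<lambda>p f. \<kappa> p * Y' p f)" by (intro ext)
  then have "nab X (\<lambda>p f. \<kappa> p * Y p f) a f = nab X (\<lambda>p f. \<kappa> p * Y' p f) a f" by simp
  then show "nab X Y a f = nab X Y' a f"
    using conn_fmult2[OF \<kappa>(1) X Y(1)] conn_fmult2[OF \<kappa>(1) X Y(2)] N(3)[OF N(2)] \<kappa>(3,7) by simp
qed

lemma conn_tensorial1:
  assumes "X \<in> vfields M" "X' \<in> vfields M" "X a = X' a" "Y \<in> vfields M"
  shows "nab X Y a f = nab X' Y a f"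
  by (rule tensorial[where F = "\<lambda>X. nab X Y a f", OF _ _ assms(1-3)])
    (use assms(4) in \<open>auto simp: conn_add1 conn_fmult1\<close>)

lemma conn_sum1:
  assumes "\<And>i. i \<in> I \<Longrightarrow> X i \<in> vfields M" "Y \<in> vfields M" "finite I"
  shows "nab (\<lambda>p f. \<Sum>i\<in>I. c i * X i p f) Y = (\<lambda>p f. \<Sum>i\<in>I. c i * nab (X i) Y p f)"
  using assms(3,1)
proof (induction I)
  case empty
  show ?case using conn_fmult1[OF smooth_const[of 0] vfields_zero assms(2)] by simp
next
  case (insert i I)
  have "(\<lambda>p f. c i * X i p f) \<in> vfields M" "(\<lambda>p f. \<Sum>i\<in>I. c i * X i p f) \<in> vfields M"
    using insert.prems by (auto intro!: vfields_cmult vfields_sum)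
  from conn_add1[OF this assms(2)] show ?case
    using insert conn_fmult1[OF smooth_const[of "c i"] _ assms(2), of "X i"] by simp
qed

text \<open>The value at \<open>a\<close> depends on \<open>X a\<close> only, so \<open>X\<close> is
  replaced by the combination of the \<open>E i\<close> with constant coefficients
  \<open>X a (\<xi> i)\<close>.\<close>

lemma conn_frame1:
  assumes F: "local_frame M N E \<xi>" and a: "a \<in> N" and X: "X \<in> vfields M" and Y: "Y \<in> vfields M"
  shows "nab X Y a f = (\<Sum>i\<in>UNIV. X a (\<xi> i) * nab (E i) Y a f)"
proof -
  note E = local_frameD(2)[OF F]
  let ?X = "\<lambda>p f. \<Sum>i\<in>UNIV. X a (\<xi> i) * E i p f"
  have "?X \<in> vfields M" using E by (intro vfields_sum vfields_cmult)
  moreover have "X a = ?X a" by (intro ext local_frameD(5)[OF F a vfields_tangent[OF X]])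
  ultimately have "nab X Y a f = nab ?X Y a f" by (rule conn_tensorial1[OF X _ _ Y])
  then show ?thesis using conn_sum1[of UNIV E Y "\<lambda>i. X a (\<xi> i)"] E Y by simp
qed

lemma conn_frame2:
  assumes F: "local_frame M N E \<xi>" and a: "a \<in> N" and X: "X \<in> vfields M" and Y: "Y \<in> vfields M"
  shows "nab X Y a f = (\<Sum>j\<in>UNIV. X a (\<lambda>p. Y p (\<xi> j)) * E j a f + Y a (\<xi> j) * nab X (E j) a f)"
proof -
  note E = local_frameD(2)[OF F] and \<xi> = local_frameD(3)[OF F]
  let ?Y = "\<lambda>p f. \<Sum>j\<in>UNIV. Y p (\<xi> j) * E j p f"
  have g: "(\<lambda>p. Y p (\<xi> j)) \<in> smooth_funs M" for j by (rule vfields_smooth[OF Y \<xi>])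
  have Y': "?Y \<in> vfields M" using E g by (intro vfields_sum vfields_fmult)
  have "nab X Y a = nab X ?Y a"
    by (rule conn_local2[OF X Y Y' local_frameD(1)[OF F] a])
      (intro ext local_frameD(5)[OF F _ vfields_tangent[OF Y]])
  then show ?thesis using conn_sum2[OF X, of UNIV "\<lambda>j p. Y p (\<xi> j)" E] g E by simp
qed

context
  fixes \<gamma> :: "real \<Rightarrow> 'm"
  assumes path: "smooth_path M \<gamma>"
begin

lemma path_domain:
  obtains S where "open S" "{0..1} \<subseteq> S" "continuous_on S \<gamma>"
    "\<And>f. f \<in> smooth_funs M \<Longrightarrow> smooth_on S (f \<circ> \<gamma>)"
proof -
  obtain S where S: "open S" "{0..1} \<subseteq> S" "continuous_on S \<gamma>"
    "\<forall>(U, x)\<in>M. smooth_on {t \<in> S. \<gamma> t \<in> U} (x \<circ> \<gamma>)"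
    using path unfolding smooth_path_def by blast
  have "smooth_on S (f \<circ> \<gamma>)" if "f \<in> smooth_funs M" for f
    using S(4) by (intro path_smooth[OF that S(1,3)]) blast
  with S show ?thesis using that by blast
qed

abbreviation vel :: "real \<Rightarrow> 'm tvec" where "vel t \<equiv> velocity M \<gamma> t"

lemma path_deriv:
  assumes f: "f \<in> smooth_funs M" and t: "t \<in> {0..1}"
  shows "((\<lambda>s. f (\<gamma> s)) has_real_derivative vel t f) (at t within I)"
proof -
  obtain S where S: "open S" "{0..1} \<subseteq> S" "continuous_on S \<gamma>"
    "\<And>f. f \<in> smooth_funs M \<Longrightarrow> smooth_on S (f \<circ> \<gamma>)" by (rule path_domain) (rule that)
  have "(f \<circ> \<gamma> has_derivative frechet_derivative (f \<circ> \<gamma>) (at t)) (at t)"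
    using smooth_on_has_derivative[OF S(4)[OF f]] S(2) t by blast
  then have "f \<circ> \<gamma> differentiable (at t)" by (auto simp: differentiable_def)
  then have "(f \<circ> \<gamma> has_real_derivative deriv (f \<circ> \<gamma>) t) (at t)"
    using DERIV_deriv_iff_real_differentiable by blast
  then show ?thesis using f by (simp add: velocity_def comp_def has_field_derivative_at_within)
qed

lemma vel_continuous:
  assumes f: "f \<in> smooth_funs M"
  shows "continuous_on {0..1} (\<lambda>t. vel t f)"
proof -
  obtain S where S: "open S" "{0..1} \<subseteq> S" "continuous_on S \<gamma>"
    "\<And>f. f \<in> smooth_funs M \<Longrightarrow> smooth_on S (f \<circ> \<gamma>)" by (rule path_domain) (rule that)
  have "continuous_on {0..1} (\<lambda>t. frechet_derivative (f \<circ> \<gamma>) (at t) 1)"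
    by (rule continuous_on_subset[OF smooth_on_imp_continuous_on[OF smooth_on_frechet[OF S(4)[OF
        f]]] S(2)])
  moreover have "frechet_derivative (f \<circ> \<gamma>) (at t) 1 = vel t f" if "t \<in> {0..1}" for t
  proof -
    have "(f \<circ> \<gamma> has_derivative (\<lambda>h. vel t f * h)) (at t)"
      using path_deriv[OF f that, of UNIV] by (simp add: has_field_derivative_def comp_def)
    then have "frechet_derivative (f \<circ> \<gamma>) (at t) = (\<lambda>h. vel t f * h)"
        using frechet_derivative_at by metis
    then show ?thesis by simp
  qed
  ultimately show ?thesis by (rule continuous_on_eq)
qed

lemma path_continuous: "continuous_on {0..1} \<gamma>"
  using path_domain continuous_on_subset by metis

lemma vel_tangent:
  assumes t: "t \<in> {0..1}"
  shows "vel t \<in> tangent_space M (\<gamma> t)"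
proof -
  note D = path_deriv[OF _ t, of _ UNIV]
  have "vel t (\<lambda>p. f p + g p) = vel t f + vel t g" if "f \<in> smooth_funs M" "g \<in> smooth_funs M"
      for f g
    using DERIV_unique[OF D[OF smooth_add[OF that]] DERIV_add[OF D[OF that(1)] D[OF that(2)]]] .
  moreover have "vel t (\<lambda>p. c * f p) = c * vel t f" if "f \<in> smooth_funs M" for f c
    using DERIV_unique[OF D[OF smooth_cmult[OF that]] DERIV_cmult[OF D[OF that]]] .
  moreover have "vel t (\<lambda>p. f p * g p) = f (\<gamma> t) * vel t g + g (\<gamma> t) * vel t f"
    if "f \<in> smooth_funs M" "g \<in> smooth_funs M" for f g
    using DERIV_unique[OF D[OF smooth_mult[OF that]] DERIV_mult[OF D[OF that(1)] D[OF that(2)]]]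
        by simp
  ultimately show ?thesis by (simp add: tangent_space_def) (simp add: velocity_def)
qed

definition ext_vel :: "real \<Rightarrow> 'm vfield" where
  "ext_vel t = extend M (\<gamma> t) (vel t)"

lemma ext_vel: "t \<in> {0..1} \<Longrightarrow> ext_vel t \<in> vfields M" "t \<in> {0..1} \<Longrightarrow> ext_vel t (\<gamma> t) = vel t"
  using extend_vfield[OF vel_tangent] extend_at[OF vel_tangent] by (auto simp: ext_vel_def)

text \<open>The connection coefficients along the path, already contracted with the velocity:
  \<open>l\<close> is the index of the differentiated frame field, \<open>j\<close> that of the
  component.\<close>

definition christoffel :: "('n \<Rightarrow> 'm vfield) \<Rightarrow> ('n \<Rightarrow> 'm \<Rightarrow> real) \<Rightarrow> 'n \<Rightarrow> 'n \<Rightarrow> real \<Rightarrow> real" where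
  "christoffel E \<xi> j l t = nab (ext_vel t) (E l) (\<gamma> t) (\<xi> j)"

text \<open>\<open>ext_vel t\<close> is an extension chosen for each \<open>t\<close> separately, so
  continuity in \<open>t\<close> cannot be seen from the definition. Expanding in the frame replaces
  it by the components of the velocity.\<close>

lemma christoffel_continuous:
  assumes F: "local_frame M N E \<xi>" and I: "I \<subseteq> {0..1}" "\<gamma> ` I \<subseteq> N"
  shows "continuous_on I (christoffel E \<xi> j l)"
proof -
  note E = local_frameD(2)[OF F] and \<xi> = local_frameD(3)[OF F]
  have cf: "continuous_on I (\<lambda>t. f (\<gamma> t))" if "f \<in> smooth_funs M" for f
    using DERIV_continuous[OF path_deriv[OF that]] I(1)
        by (auto simp: continuous_on_eq_continuous_within)
  have "continuous_on I (\<lambda>t. \<Sum>i\<in>UNIV. vel t (\<xi> i) * nab (E i) (E l) (\<gamma> t) (\<xi> j))"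
    by (intro continuous_on_sum continuous_on_mult continuous_on_subset[OF vel_continuous[OF \<xi>]
        I(1)]
        cf[OF vfields_smooth[OF conn_vfield[OF E E] \<xi>]])
  moreover have "(\<Sum>i\<in>UNIV. vel t (\<xi> i) * nab (E i) (E l) (\<gamma> t) (\<xi> j)) = christoffel E \<xi> j l t" if
      "t \<in> I" for t
  proof -
    have "t \<in> {0..1}" "\<gamma> t \<in> N" using that I by auto
    then show ?thesis unfolding christoffel_def
      using conn_frame1[where a = "\<gamma> t" and X = "ext_vel t" and Y = "E l", OF F _ _ E] ext_vel[of
          t] by simp
  qed
  ultimately show ?thesis by (simp cong: continuous_on_cong)
qed

text \<open>The first sum is component \<open>j\<close> of the covariant derivative of
  \<open>V\<close>, computed with arbitrary fields \<open>Y i\<close>. Expanding their covariant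
  derivatives in the frame yields the classical formula for components, so the representation of
  \<open>V\<close> drops out.\<close>

lemma frame_coeff_deriv:
  assumes F: "local_frame M N E \<xi>" and t: "t \<in> {0..1}" "t \<in> I" "\<gamma> t \<in> N"
    and Y: "\<And>i. Y i \<in> vfields M" and c: "\<And>i. (c i has_real_derivative c' i) (at t within I)"
    and V: "\<delta> > 0" "\<And>s. s \<in> I \<Longrightarrow> \<bar>s - t\<bar> < \<delta> \<Longrightarrow> V s = (\<lambda>f. \<Sum>i\<in>(UNIV :: 'n set). c i s * Y i (\<gamma> s) f)"
  shows "((\<lambda>s. V s (\<xi> j)) has_real_derivative
      ((\<Sum>i\<in>UNIV. c' i * Y i (\<gamma> t) (\<xi> j) + c i t * nab (ext_vel t) (Y i) (\<gamma> t) (\<xi> j)) -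
       (\<Sum>l\<in>UNIV. V t (\<xi> l) * christoffel E \<xi> j l t))) (at t within I)"
proof -
  let ?a = "\<gamma> t" and ?X = "ext_vel t"
  note \<xi> = local_frameD(3)[OF F]
  have g: "(\<lambda>p. Y i p (\<xi> j)) \<in> smooth_funs M" for i j by (rule vfields_smooth[OF Y \<xi>])
  have "((\<lambda>s. \<Sum>i\<in>UNIV. c i s * Y i (\<gamma> s) (\<xi> j)) has_real_derivative
      (\<Sum>i\<in>UNIV. c' i * Y i ?a (\<xi> j) + vel t (\<lambda>p. Y i p (\<xi> j)) * c i t)) (at t within I)"
    by (intro DERIV_sum DERIV_mult c path_deriv[OF g t(1)])
  then have D: "((\<lambda>s. V s (\<xi> j)) has_real_derivative
      (\<Sum>i\<in>UNIV. c' i * Y i ?a (\<xi> j) + vel t (\<lambda>p. Y i p (\<xi> j)) * c i t)) (at t within I)"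
    by (rule has_field_derivative_transform_within[OF _ V(1) t(2)]) (use V(2) in \<open>auto simp:
        dist_real_def\<close>)
  have n: "nab ?X (Y i) ?a (\<xi> j) = vel t (\<lambda>p. Y i p (\<xi> j)) + (\<Sum>l\<in>UNIV. Y i ?a (\<xi> l) * christoffel
      E \<xi> j l t)" for i
  proof -
    have "(\<Sum>l\<in>UNIV. ?X ?a (\<lambda>p. Y i p (\<xi> l)) * E l ?a (\<xi> j)) = (\<Sum>l\<in>UNIV. if l = j then vel t (\<lambda>p. Y
        i p (\<xi> l)) else 0)"
      using local_frameD(4)[OF F t(3)] ext_vel(2)[OF t(1)] by (intro sum.cong) auto
    then show ?thesis
      using conn_frame2[OF F t(3) ext_vel(1)[OF t(1)] Y, of i "\<xi> j"]
          by (simp add: sum.distrib christoffel_def)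
  qed
  have "V t (\<xi> l) = (\<Sum>i\<in>UNIV. c i t * Y i ?a (\<xi> l))" for l using V(2)[OF t(2)] V(1) by simp
  then have "(\<Sum>l\<in>UNIV. V t (\<xi> l) * christoffel E \<xi> j l t) =
      (\<Sum>l\<in>UNIV. \<Sum>i\<in>UNIV. c i t * (Y i ?a (\<xi> l) * christoffel E \<xi> j l t))"
    by (simp add: sum_distrib_right mult.assoc)
  also have "\<dots> = (\<Sum>i\<in>UNIV. c i t * (\<Sum>l\<in>UNIV. Y i ?a (\<xi> l) * christoffel E \<xi> j l t))"
    by (subst sum.swap) (simp add: sum_distrib_left)
  finally have "(\<Sum>i\<in>UNIV. c' i * Y i ?a (\<xi> j) + c i t * nab ?X (Y i) ?a (\<xi> j)) -
       (\<Sum>l\<in>UNIV. V t (\<xi> l) * christoffel E \<xi> j l t) =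
      (\<Sum>i\<in>UNIV. c' i * Y i ?a (\<xi> j) + vel t (\<lambda>p. Y i p (\<xi> j)) * c i t)"
    by (simp add: n sum.distrib sum_subtractf[symmetric] algebra_simps)
  with D show ?thesis by simp
qed

definition frame_parallel :: "('n \<Rightarrow> 'm vfield) \<Rightarrow> ('n \<Rightarrow> 'm \<Rightarrow> real) \<Rightarrow> real set \<Rightarrow> (real \<Rightarrow> 'm tvec) \<Rightarrow>
    real \<Rightarrow> bool" where
  "frame_parallel E \<xi> I V t \<longleftrightarrow> (\<forall>j. ((\<lambda>s. V s (\<xi> j)) has_real_derivative
     - (\<Sum>l\<in>UNIV. V t (\<xi> l) * christoffel E \<xi> j l t)) (at t within I))"

text \<open>Derivatives are taken within the interval \<open>I\<close> and with respect to all frames, so that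
  solutions on adjacent intervals can be glued.\<close>

definition parallel_at :: "real set \<Rightarrow> (real \<Rightarrow> 'm tvec) \<Rightarrow> real \<Rightarrow> bool" where
  "parallel_at I V t \<longleftrightarrow> V t \<in> tangent_space M (\<gamma> t) \<and>
     (\<forall>N E \<xi>. local_frame M N E \<xi> \<and> \<gamma> t \<in> N \<longrightarrow> frame_parallel E \<xi> I V t)"

lemma near_frame:
  assumes N: "open N" "\<gamma> t \<in> N" and t: "t \<in> {0..1}"
  obtains \<delta> where "\<delta> > 0" "\<And>s. s \<in> {0..1} \<Longrightarrow> \<bar>s - t\<bar> < \<delta> \<Longrightarrow> \<gamma> s \<in> N"
proof -
  have "(\<gamma> \<longlongrightarrow> \<gamma> t) (at t within {0..1})" using path_continuous t by (auto simp: continuous_on_def)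
  then have "\<forall>\<^sub>F s in at t within {0..1}. \<gamma> s \<in> N" using N by (rule topological_tendstoD)
  then obtain \<delta> where "\<delta> > 0" "\<And>s. s \<in> {0..1} \<Longrightarrow> s \<noteq> t \<Longrightarrow> dist s t < \<delta> \<Longrightarrow> \<gamma> s \<in> N"
    unfolding eventually_at by auto
  then show ?thesis using that[of \<delta>] N(2) by (metis dist_real_def)
qed

lemma frame_parallel_cov_deriv:
  assumes F: "local_frame M N E \<xi>" and t: "t \<in> {0..1}" "\<gamma> t \<in> N"
    and c: "\<And>i. c' i = - (\<Sum>l\<in>UNIV. c l * christoffel E \<xi> i l t)"
  shows "(\<Sum>i\<in>UNIV. c' i * E i (\<gamma> t) f + c i * nab (ext_vel t) (E i) (\<gamma> t) f) = 0"
proof -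
  note E = local_frameD(2)[OF F]
  have "nab (ext_vel t) (E i) (\<gamma> t) f = (\<Sum>j\<in>UNIV. christoffel E \<xi> j i t * E j (\<gamma> t) f)" for i
    unfolding christoffel_def
    by (rule local_frameD(5)[OF F t(2) vfields_tangent[OF conn_vfield[OF ext_vel(1)[OF t(1)] E]]])
  then have "(\<Sum>i\<in>UNIV. c i * nab (ext_vel t) (E i) (\<gamma> t) f) =
      (\<Sum>i\<in>UNIV. \<Sum>j\<in>UNIV. c i * christoffel E \<xi> j i t * E j (\<gamma> t) f)"
    by (simp add: sum_distrib_left mult.assoc)
  also have "\<dots> = (\<Sum>j\<in>UNIV. (\<Sum>i\<in>UNIV. c i * christoffel E \<xi> j i t) * E j (\<gamma> t) f)"
    by (subst sum.swap) (simp add: sum_distrib_right)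
  finally have "(\<Sum>i\<in>UNIV. c i * nab (ext_vel t) (E i) (\<gamma> t) f) = - (\<Sum>i\<in>UNIV. c' i * E i (\<gamma> t) f)"
    by (simp add: c sum_negf)
  then show ?thesis by (simp add: sum.distrib)
qed

text \<open>In the given frame the covariant derivative of \<open>V\<close> vanishes
  (\<open>z\<close>), and \<open>frame_coeff_deriv\<close> translates this into the component
  equation in any other frame.\<close>

lemma parallel_atI:
  assumes F: "local_frame M N E \<xi>" and t: "t \<in> I" "\<gamma> t \<in> N" and I: "I \<subseteq> {0..1}"
    and V: "\<And>s. s \<in> I \<Longrightarrow> V s \<in> tangent_space M (\<gamma> s)" and P: "frame_parallel E \<xi> I V t"
  shows "parallel_at I V t"
  unfolding parallel_at_def
proof (intro conjI allI impI)
  show "V t \<in> tangent_space M (\<gamma> t)" using V t by blast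
  fix N' E' \<xi>' assume "local_frame M N' E' \<xi>' \<and> \<gamma> t \<in> N'"
  then have F': "local_frame M N' E' \<xi>'" "\<gamma> t \<in> N'" by auto
  have t01: "t \<in> {0..1}" using t I by auto
  obtain \<delta> where \<delta>: "\<delta> > 0" "\<And>s. s \<in> {0..1} \<Longrightarrow> \<bar>s - t\<bar> < \<delta> \<Longrightarrow> \<gamma> s \<in> N"
    using near_frame[OF local_frameD(1)[OF F] t(2) t01] by metis
  have rep: "V s = (\<lambda>f. \<Sum>i\<in>UNIV. V s (\<xi> i) * E i (\<gamma> s) f)" if "s \<in> I" "\<bar>s - t\<bar> < \<delta>" for s
    using \<delta>(2)[of s] that I by (intro ext local_frameD(5)[OF F _ V]) auto
  have z: "(\<Sum>i\<in>UNIV. (- (\<Sum>l\<in>UNIV. V t (\<xi> l) * christoffel E \<xi> i l t)) * E i (\<gamma> t) f +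
      V t (\<xi> i) * nab (ext_vel t) (E i) (\<gamma> t) f) = 0" for f
    by (rule frame_parallel_cov_deriv[OF F t01 t(2)]) simp
  show "frame_parallel E' \<xi>' I V t"
    unfolding frame_parallel_def
  proof
    fix j
    have "((\<lambda>s. V s (\<xi>' j)) has_real_derivative
      ((\<Sum>i\<in>UNIV. (- (\<Sum>l\<in>UNIV. V t (\<xi> l) * christoffel E \<xi> i l t)) * E i (\<gamma> t) (\<xi>' j) +
          V t (\<xi> i) * nab (ext_vel t) (E i) (\<gamma> t) (\<xi>' j)) -
       (\<Sum>l\<in>UNIV. V t (\<xi>' l) * christoffel E' \<xi>' j l t))) (at t within I)"
      by (rule frame_coeff_deriv[where c = "\<lambda>i s. V s (\<xi> i)", OF F'(1) t01 t(1) F'(2)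
          local_frameD(2)[OF F] _ \<delta>(1) rep])
        (use P in \<open>auto simp: frame_parallel_def\<close>)
    then show "((\<lambda>s. V s (\<xi>' j)) has_real_derivative
        - (\<Sum>l\<in>UNIV. V t (\<xi>' l) * christoffel E' \<xi>' j l t)) (at t within I)"
      unfolding z by simp
  qed
qed

text \<open>Trades the existential in \<open>has_cov_deriv_along\<close>, with its arbitrary fields
  and coefficients, for a linear ODE on the components in every frame.\<close>

lemma parallel_along_iff: "parallel_along M nab \<gamma> V \<longleftrightarrow> (\<forall>t\<in>{0..1}. parallel_at {0..1} V t)"
proof
  assume P: "parallel_along M nab \<gamma> V"
  show "\<forall>t\<in>{0..1}. parallel_at {0..1} V t"
  proof
    fix t :: real assume t: "t \<in> {0..1}"
    have V: "V t \<in> tangent_space M (\<gamma> t)" and "has_cov_deriv_along M nab \<gamma> V t (\<lambda>f. 0)"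
      using P t unfolding parallel_along_def by auto
    then obtain Y :: "'n \<Rightarrow> 'm vfield" and c c' \<delta> where Y: "\<And>i. Y i \<in> vfields M"
      and c: "\<And>i. (c i has_real_derivative c' i) (at t within {0..1})"
      and \<delta>: "\<delta> > 0" "\<And>s. s \<in> {0..1} \<Longrightarrow> \<bar>s - t\<bar> < \<delta> \<Longrightarrow> V s = (\<lambda>f. \<Sum>i\<in>UNIV. c i s * Y i (\<gamma> s) f)"
      and w: "(\<lambda>f. 0) = (\<lambda>f. \<Sum>i\<in>UNIV. c' i * Y i (\<gamma> t) f + c i t * nab (ext_vel t) (Y i) (\<gamma> t) f)"
      unfolding has_cov_deriv_along_def ext_vel_def by blast
    have w': "(\<Sum>i\<in>UNIV. c' i * Y i (\<gamma> t) f + c i t * nab (ext_vel t) (Y i) (\<gamma> t) f) = 0" for f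
      using fun_cong[OF w, of f] by simp
    show "parallel_at {0..1} V t"
      unfolding parallel_at_def frame_parallel_def
    proof (intro conjI allI impI V)
      fix N E \<xi> j assume "local_frame M N E \<xi> \<and> \<gamma> t \<in> N"
      then have F: "local_frame M N E \<xi>" "\<gamma> t \<in> N" by auto
      show "((\<lambda>s. V s (\<xi> j)) has_real_derivative
          - (\<Sum>l\<in>UNIV. V t (\<xi> l) * christoffel E \<xi> j l t)) (at t within {0..1})"
        using frame_coeff_deriv[OF F(1) t t F(2) Y c \<delta>, of j] unfolding w' by simp
    qed
  qed
next
  assume P: "\<forall>t\<in>{0..1}. parallel_at {0..1} V t"
  show "parallel_along M nab \<gamma> V"
    unfolding parallel_along_def
  proof
    fix t :: real assume t: "t \<in> {0..1}"
    have V: "V s \<in> tangent_space M (\<gamma> s)" if "s \<in> {0..1}" for s using P that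
        by (auto simp: parallel_at_def)
    obtain N E \<xi> where F: "local_frame M N E \<xi>" and a: "\<gamma> t \<in> N" by (rule local_frame_exists)
    obtain \<delta> where \<delta>: "\<delta> > 0" "\<And>s. s \<in> {0..1} \<Longrightarrow> \<bar>s - t\<bar> < \<delta> \<Longrightarrow> \<gamma> s \<in> N"
      using near_frame[OF local_frameD(1)[OF F] a t] by metis
    have "frame_parallel E \<xi> {0..1} V t" using P t F a by (auto simp: parallel_at_def)
    then have d: "((\<lambda>s. V s (\<xi> i)) has_real_derivative - (\<Sum>l\<in>UNIV. V t (\<xi> l) * christoffel E \<xi> i l
        t)) (at t within {0..1})" for i
      by (simp add: frame_parallel_def)
    have rep: "V s = (\<lambda>f. \<Sum>i\<in>UNIV. V s (\<xi> i) * E i (\<gamma> s) f)" if "s \<in> {0..1}" "\<bar>s - t\<bar> < \<delta>" for s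
      using \<delta>(2)[OF that] that by (intro ext local_frameD(5)[OF F _ V])
    have z: "(\<lambda>f. 0) = (\<lambda>f. \<Sum>i\<in>UNIV. (- (\<Sum>l\<in>UNIV. V t (\<xi> l) * christoffel E \<xi> i l t)) * E i (\<gamma> t)
        f +
        V t (\<xi> i) * nab (ext_vel t) (E i) (\<gamma> t) f)"
      by (intro ext frame_parallel_cov_deriv[OF F t a, symmetric]) simp
    have "has_cov_deriv_along M nab \<gamma> V t (\<lambda>f. 0)"
      unfolding has_cov_deriv_along_def ext_vel_def[symmetric]
      by (intro exI[of _ E] exI[of _ "\<lambda>i s. V s (\<xi> i)"] exI[of _ "\<lambda>i. - (\<Sum>l\<in>UNIV. V t (\<xi> l) *
          christoffel E \<xi> i l t)"]
          conjI allI d local_frameD(2)[OF F] exI[of _ \<delta>] \<delta>(1) z ballI impI rep)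
    then show "V t \<in> tangent_space M (\<gamma> t) \<and> has_cov_deriv_along M nab \<gamma> V t (\<lambda>f. 0)"
        using V[OF t] by blast
  qed
qed


section \<open>Solving the equation of parallel transport\<close>

definition chr_op :: "('n \<Rightarrow> 'm vfield) \<Rightarrow> ('n \<Rightarrow> 'm \<Rightarrow> real) \<Rightarrow> real \<Rightarrow> real^'n \<Rightarrow> real^'n" where
  "chr_op E \<xi> t x = (\<chi> j. - (\<Sum>l\<in>UNIV. x $ l * christoffel E \<xi> j l t))"

lemma vec_expansion: "(\<chi> j. a j) = (\<Sum>j\<in>UNIV. a j *\<^sub>R axis j (1::real))"
  using basis_expansion[of "\<chi> j. a j"] by (simp add: scalar_mult_eq_scaleR)

lemma frame_parallel_vec:
  "frame_parallel E \<xi> I V t \<longleftrightarrow>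
    ((\<lambda>s. \<chi> j. V s (\<xi> j)) has_vector_derivative chr_op E \<xi> t (\<chi> j. V t (\<xi> j))) (at t within I)"
  (is "_ \<longleftrightarrow> (?c has_vector_derivative ?d) _")
proof
  assume P: "frame_parallel E \<xi> I V t"
  have "((\<lambda>s. \<Sum>j\<in>UNIV. V s (\<xi> j) *\<^sub>R axis j (1::real)) has_vector_derivative
      (\<Sum>j\<in>UNIV. (- (\<Sum>l\<in>UNIV. V t (\<xi> l) * christoffel E \<xi> j l t)) *\<^sub>R axis j (1::real))) (at t
          within I)"
    by (intro has_vector_derivative_sum bounded_linear.has_vector_derivative[OF
        bounded_linear_scaleR_left])
      (use P in \<open>simp add: frame_parallel_def has_real_derivative_iff_has_vector_derivative\<close>)
  then show "(?c has_vector_derivative ?d) (at t within I)"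
    by (simp only: vec_expansion[symmetric] chr_op_def vec_lambda_beta)
next
  assume c: "(?c has_vector_derivative ?d) (at t within I)"
  show "frame_parallel E \<xi> I V t"
    unfolding frame_parallel_def
  proof
    fix j
    have "((\<lambda>s. ?c s $ j) has_vector_derivative ?d $ j) (at t within I)"
      by (rule bounded_linear.has_vector_derivative[OF bounded_linear_vec_nth c])
    then show "((\<lambda>s. V s (\<xi> j)) has_real_derivative - (\<Sum>l\<in>UNIV. V t (\<xi> l) * christoffel E \<xi> j l
        t)) (at t within I)"
      by (simp add: chr_op_def has_real_derivative_iff_has_vector_derivative)
  qed
qed

text \<open>Compactness of \<open>I\<close> bounds each of the finitely many continuous
  coefficients, and the l1 estimate of the norm turns these bounds into a single constant.\<close>

lemma chr_op_bound:
  assumes F: "local_frame M N E \<xi>" and I: "I \<subseteq> {0..1}" "\<gamma> ` I \<subseteq> N" "compact I"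
  obtains K where "K \<ge> 0" "\<And>t x. t \<in> I \<Longrightarrow> norm (chr_op E \<xi> t x) \<le> K * norm x"
proof -
  have "\<exists>B. \<forall>t\<in>I. norm (christoffel E \<xi> j l t) \<le> B" for j l
    using compact_imp_bounded[OF compact_continuous_image[OF christoffel_continuous[OF F I(1,2)]
        I(3)], of j l]
    by (auto simp: bounded_iff)
  then obtain B where B: "\<And>j l t. t \<in> I \<Longrightarrow> \<bar>christoffel E \<xi> j l t\<bar> \<le> B j l"
    by (simp only: real_norm_def) metis
  define K where "K = (\<Sum>j\<in>UNIV. \<Sum>l\<in>UNIV. \<bar>B j l\<bar>)"
  have "norm (chr_op E \<xi> t x) \<le> K * norm x" if t: "t \<in> I" for t x
  proof -
    have "norm (chr_op E \<xi> t x) \<le> (\<Sum>j\<in>UNIV. \<bar>chr_op E \<xi> t x $ j\<bar>)" by (rule norm_le_l1_cart)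
    also have "\<dots> \<le> (\<Sum>j\<in>UNIV. \<Sum>l\<in>UNIV. \<bar>B j l\<bar> * norm x)"
    proof (rule sum_mono)
      fix j
      have "\<bar>chr_op E \<xi> t x $ j\<bar> \<le> (\<Sum>l\<in>UNIV. \<bar>x $ l * christoffel E \<xi> j l t\<bar>)"
        by (simp add: chr_op_def sum_abs)
      also have "\<dots> \<le> (\<Sum>l\<in>UNIV. \<bar>B j l\<bar> * norm x)"
      proof (rule sum_mono)
        fix l
        have "\<bar>christoffel E \<xi> j l t\<bar> \<le> \<bar>B j l\<bar>" using B[OF t, of j l] by linarith
        then show "\<bar>x $ l * christoffel E \<xi> j l t\<bar> \<le> \<bar>B j l\<bar> * norm x"
          using component_le_norm_cart[of x l] by (simp add: abs_mult mult.commute mult_mono)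
      qed
      finally show "\<bar>chr_op E \<xi> t x $ j\<bar> \<le> (\<Sum>l\<in>UNIV. \<bar>B j l\<bar> * norm x)" .
    qed
    also have "\<dots> = K * norm x" by (simp add: K_def sum_distrib_right)
    finally show ?thesis .
  qed
  moreover have "K \<ge> 0" unfolding K_def by (intro sum_nonneg) simp
  ultimately show ?thesis using that by blast
qed

text \<open>Inside one frame this is \<open>linear_ode_unique\<close>; bisection extends it to the
  whole path, which need not lie in the domain of a single frame.\<close>

lemma parallel_zero:
  assumes V: "\<And>t. t \<in> {0..1} \<Longrightarrow> parallel_at {0..1} V t" and V0: "V 0 = (\<lambda>f. 0)"
  shows "V 1 = (\<lambda>f. 0)"
proof -
  \<comment> \<open>Intervals that stick out of \<open>{0..1}\<close> satisfy \<open>P\<close>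
    vacuously, since the local step of \<open>Bolzano\<close> ranges over all short intervals around
    \<open>x\<close>.\<close>
  define P where "P a b \<longleftrightarrow> (0 \<le> a \<longrightarrow> b \<le> 1 \<longrightarrow> V a = (\<lambda>f. 0) \<longrightarrow> V b = (\<lambda>f. 0))" for a b
  have "P 0 1"
  proof (rule Bolzano)
    fix a b c assume "P a b" "P b c" "a \<le> b" "b \<le> c"
    then show "P a c" unfolding P_def by (metis order_trans)
  next
    fix x :: real assume "0 \<le> x" "x \<le> 1"
    then have x: "x \<in> {0..1}" by simp
    obtain N E \<xi> where F: "local_frame M N E \<xi>" and a: "\<gamma> x \<in> N" by (rule local_frame_exists)
    obtain \<delta> where \<delta>: "\<delta> > 0" "\<And>s. s \<in> {0..1} \<Longrightarrow> \<bar>s - x\<bar> < \<delta> \<Longrightarrow> \<gamma> s \<in> N"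
      using near_frame[OF local_frameD(1)[OF F] a x] by metis
    have "P a b" if ab: "a \<le> x" "x \<le> b" "b - a < \<delta>" for a b
      unfolding P_def
    proof (intro impI)
      assume 0: "0 \<le> a" and 1: "b \<le> 1" and Va: "V a = (\<lambda>f. 0)"
      have I: "{a..b} \<subseteq> {0..1}" using 0 1 by auto
      have IN: "\<gamma> ` {a..b} \<subseteq> N" using \<delta>(2) I ab by (force simp: abs_if)
      obtain K where K: "K \<ge> 0" "\<And>t x. t \<in> {a..b} \<Longrightarrow> norm (chr_op E \<xi> t x) \<le> K * norm x"
        using chr_op_bound[OF F I IN compact_Icc] by metis
      have "(\<chi> j. V b (\<xi> j)) = 0"
      proof (rule linear_ode_unique[where L = "chr_op E \<xi>", OF _ _ K(2)])
        fix t assume t: "t \<in> {a..b}"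
        have "t \<in> {0..1}" "\<gamma> t \<in> N" using t I IN by blast+
        then have "frame_parallel E \<xi> {0..1} V t" using V[of t] F unfolding parallel_at_def by blast
        then show "((\<lambda>s. \<chi> j. V s (\<xi> j)) has_vector_derivative chr_op E \<xi> t (\<chi> j. V t (\<xi> j))) (at
            t within {a..b})"
          unfolding frame_parallel_vec by (rule has_vector_derivative_within_subset[OF _ I])
      qed (use ab Va in \<open>auto simp: vec_eq_iff\<close>)
      then have z: "V b (\<xi> j) = 0" for j by (simp add: vec_eq_iff)
      have b: "b \<in> {0..1}" "\<gamma> b \<in> N" using I IN ab by auto
      then have "V b \<in> tangent_space M (\<gamma> b)" using V by (simp add: parallel_at_def)
      from local_frameD(5)[OF F b(2) this] show "V b = (\<lambda>f. 0)" by (simp add: z fun_eq_iff)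
    qed
    then show "\<exists>d>0. \<forall>a b. a \<le> x \<and> x \<le> b \<and> b - a < d \<longrightarrow> P a b" using \<delta>(1) by blast
  qed simp
  then show ?thesis using V0 by (simp add: P_def)
qed

text \<open>At \<open>b\<close> the two one-sided derivatives agree, because both are given by the
  same equation from the common value \<open>V b = W b\<close>.\<close>

lemma parallel_glue:
  assumes ab: "a \<le> b" "b \<le> c" and V: "\<And>t. t \<in> {a..b} \<Longrightarrow> parallel_at {a..b} V t"
    and W: "\<And>t. t \<in> {b..c} \<Longrightarrow> parallel_at {b..c} W t" and eq: "V b = W b" and t: "t \<in> {a..c}"
  shows "parallel_at {a..c} (\<lambda>s. if s \<in> {a..b} then V s else W s) t" (is "parallel_at _ ?U t")
  unfolding parallel_at_def frame_parallel_def
proof (intro conjI allI impI)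
  show "?U t \<in> tangent_space M (\<gamma> t)" using V[of t] W[of t] t by (auto simp: parallel_at_def)
  fix N E \<xi> j assume "local_frame M N E \<xi> \<and> \<gamma> t \<in> N"
  then have F: "local_frame M N E \<xi>" "\<gamma> t \<in> N" by auto
  let ?d = "\<lambda>V t. - (\<Sum>l\<in>UNIV. V t (\<xi> l) * christoffel E \<xi> j l t)"
  have "((\<lambda>s. if s \<in> {a..b} then V s (\<xi> j) else W s (\<xi> j)) has_vector_derivative
      (if t \<in> {a..b} then ?d V t else ?d W t)) (at t within {a..c})"
  proof (rule has_vector_derivative_If_within_closures[where T = "{b..c}"])
    show "((\<lambda>s. V s (\<xi> j)) has_vector_derivative ?d V t) (at t within {a..b} \<union> closure {a..b} \<inter>
        closure {b..c})"
      if "t \<in> {a..b} \<union> closure {a..b} \<inter> closure {b..c}"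
    proof -
      have "{a..b} \<union> closure {a..b} \<inter> closure {b..c} = {a..b}" using ab by auto
      then show ?thesis using V[of t] that F
        by (auto simp: parallel_at_def frame_parallel_def
            has_real_derivative_iff_has_vector_derivative)
    qed
    show "((\<lambda>s. W s (\<xi> j)) has_vector_derivative ?d W t) (at t within {b..c} \<union> closure {a..b} \<inter>
        closure {b..c})"
      if "t \<in> {b..c} \<union> closure {a..b} \<inter> closure {b..c}"
    proof -
      have "{b..c} \<union> closure {a..b} \<inter> closure {b..c} = {b..c}" using ab by auto
      then show ?thesis using W[of t] that F
        by (auto simp: parallel_at_def frame_parallel_def
            has_real_derivative_iff_has_vector_derivative)
    qed
    have "t = b" if "t \<in> closure {a..b}" "t \<in> closure {b..c}" using that by auto
    then show "V t (\<xi> j) = W t (\<xi> j)" "?d V t = ?d W t" if "t \<in> closure {a..b}" "t \<in> closure {b..c}"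
      using that eq by auto
  qed (use t ab in auto)
  moreover have "(\<lambda>s. ?U s (\<xi> j)) = (\<lambda>s. if s \<in> {a..b} then V s (\<xi> j) else W s (\<xi> j))"
      by (rule ext) simp
  moreover have "?d ?U t = (if t \<in> {a..b} then ?d V t else ?d W t)" by simp
  ultimately show "((\<lambda>s. ?U s (\<xi> j)) has_real_derivative ?d ?U t) (at t within {a..c})"
    by (simp only: has_real_derivative_iff_has_vector_derivative)
qed

text \<open>Bisection again: solutions exist on intervals that stay in one frame and are short
  enough for the contraction, and adjacent ones are glued. \<open>P\<close> admits every initial
  vector, because the second piece starts wherever the first one ends.\<close>

lemma parallel_exists:
  assumes v: "v \<in> tangent_space M (\<gamma> 0)"
  obtains V where "V 0 = v" "\<And>t. t \<in> {0..1} \<Longrightarrow> parallel_at {0..1} V t"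
proof -
  define P where "P a b \<longleftrightarrow> (0 \<le> a \<longrightarrow> a \<le> b \<longrightarrow> b \<le> 1 \<longrightarrow> (\<forall>v\<in>tangent_space M (\<gamma> a).
      \<exists>V. V a = v \<and> (\<forall>t\<in>{a..b}. parallel_at {a..b} V t)))" for a b
  have "P 0 1"
  proof (rule Bolzano)
    fix a b c assume P: "P a b" "P b c" and ab: "a \<le> b" "b \<le> c"
    show "P a c"
      unfolding P_def
    proof (intro impI ballI)
      fix v assume 0: "0 \<le> a" and 1: "c \<le> 1" and v: "v \<in> tangent_space M (\<gamma> a)"
      have "0 \<le> b" "b \<le> 1" using 0 1 ab by auto
      obtain V where V: "V a = v" "\<And>t. t \<in> {a..b} \<Longrightarrow> parallel_at {a..b} V t"
        using P(1) 0 ab \<open>b \<le> 1\<close> v unfolding P_def by blast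
      have "V b \<in> tangent_space M (\<gamma> b)" using V(2)[of b] ab by (simp add: parallel_at_def)
      then obtain W where W: "W b = V b" "\<And>t. t \<in> {b..c} \<Longrightarrow> parallel_at {b..c} W t"
        using P(2) \<open>0 \<le> b\<close> ab 1 unfolding P_def by blast
      show "\<exists>V. V a = v \<and> (\<forall>t\<in>{a..c}. parallel_at {a..c} V t)"
        using parallel_glue[OF ab V(2) W(2) W(1)[symmetric]] V(1) ab
        by (intro exI[of _ "\<lambda>s. if s \<in> {a..b} then V s else W s"]) auto
    qed
  next
    fix x :: real assume "0 \<le> x" "x \<le> 1"
    then have x: "x \<in> {0..1}" by simp
    obtain N E \<xi> where F: "local_frame M N E \<xi>" and xN: "\<gamma> x \<in> N" by (rule local_frame_exists)
    note E = local_frameD(2)[OF F]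
    obtain \<delta> where \<delta>: "\<delta> > 0" "\<And>s. s \<in> {0..1} \<Longrightarrow> \<bar>s - x\<bar> < \<delta> \<Longrightarrow> \<gamma> s \<in> N"
      using near_frame[OF local_frameD(1)[OF F] xN x] by metis
    \<comment> \<open>A fixed compact interval around \<open>x\<close>, so that \<open>K\<close> is
      available before \<open>a\<close> and \<open>b\<close> are.\<close>
    define J where "J = {0..1} \<inter> {x - \<delta> / 2..x + \<delta> / 2}"
    have J: "J \<subseteq> {0..1}" "\<gamma> ` J \<subseteq> N" "compact J"
      using \<delta> by (auto simp: J_def compact_Int_closed abs_le_iff intro!: \<delta>(2))
    obtain K where K: "K \<ge> 0" "\<And>t x. t \<in> J \<Longrightarrow> norm (chr_op E \<xi> t x) \<le> K * norm x"
      using chr_op_bound[OF F J] by metis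
    \<comment> \<open>The first bound keeps \<open>{a..b}\<close> inside \<open>J\<close>, the
      second gives \<open>K * (b - a) < 1\<close>; the summand 1 avoids division by zero.\<close>
    define d where "d = min (\<delta> / 2) (1 / (K + 1))"
    have "P a b" if ab: "a \<le> x" "x \<le> b" "b - a < d" for a b
      unfolding P_def
    proof (intro impI ballI)
      fix v assume 0: "0 \<le> a" and 1: "b \<le> 1" and le: "a \<le> b" and v: "v \<in> tangent_space M (\<gamma> a)"
      have I: "{a..b} \<subseteq> J" using 0 1 ab by (auto simp: J_def d_def)
      have I01: "{a..b} \<subseteq> {0..1}" "\<gamma> ` {a..b} \<subseteq> N"
        using subset_trans[OF I J(1)] subset_trans[OF image_mono[OF I] J(2)] by blast+
      have Kab: "K * (b - a) < 1"
      proof -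
        have "K * (b - a) \<le> (K + 1) * (b - a)" using le by (simp add: algebra_simps)
        also have "\<dots> < (K + 1) * (1 / (K + 1))" using ab(3) K(1)
            by (intro mult_strict_left_mono) (auto simp: d_def)
        finally show ?thesis using K(1) by simp
      qed
      obtain c where c: "c a = (\<chi> j. v (\<xi> j))"
        "\<And>t. t \<in> {a..b} \<Longrightarrow> (c has_vector_derivative chr_op E \<xi> t (c t)) (at t within {a..b})"
      proof (rule linear_ode_exists[of a b "chr_op E \<xi>" K "\<chi> j. v (\<xi> j)"])
        show "chr_op E \<xi> t (x - y) = chr_op E \<xi> t x - chr_op E \<xi> t y" for t x y
          by (simp add: chr_op_def vec_eq_iff left_diff_distrib sum_subtractf)
        show "continuous_on {a..b} (\<lambda>t. chr_op E \<xi> t (c t))" if "continuous_on {a..b} c" for c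
          unfolding chr_op_def
          by (intro continuous_on_vec_lambda continuous_on_minus continuous_on_sum
              continuous_on_mult
              continuous_on_component that christoffel_continuous[OF F I01])
      qed (use le K I Kab in auto)
      define V where "V t f = (\<Sum>j\<in>UNIV. c t $ j * E j (\<gamma> t) f)" for t f
      have VT: "V t \<in> tangent_space M (\<gamma> t)" for t
        unfolding V_def[abs_def] by (intro tangent_space_sum tangent_space_cmult vfields_tangent E)
      have Vc: "V t (\<xi> j) = c t $ j" if "t \<in> {a..b}" for t j
      proof -
        have "\<gamma> t \<in> N" using I01(2) that by blast
        then have "V t (\<xi> j) = (\<Sum>i\<in>UNIV. if i = j then c t $ i else 0)"
          unfolding V_def using local_frameD(4)[OF F, of "\<gamma> t"] by (intro sum.cong) auto
        then show ?thesis by simp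
      qed
      have "\<gamma> a \<in> N" using I01(2) le by auto
      then have "V a f = v f" for f
        using local_frameD(5)[OF F _ v, of f] by (simp add: V_def c(1))
      then have Va: "V a = v" by (rule ext)
      have "parallel_at {a..b} V t" if t: "t \<in> {a..b}" for t
      proof (rule parallel_atI[OF F t _ I01(1) VT])
        show "\<gamma> t \<in> N" using I01(2) t by auto
        have "((\<lambda>s. \<chi> j. V s (\<xi> j)) has_vector_derivative chr_op E \<xi> t (c t)) (at t within {a..b})"
          by (rule has_vector_derivative_transform[OF t _ c(2)[OF t]]) (simp add: Vc vec_eq_iff)
        moreover have "(\<chi> j. V t (\<xi> j)) = c t" by (simp add: Vc[OF t] vec_eq_iff)
        ultimately show "frame_parallel E \<xi> {a..b} V t" unfolding frame_parallel_vec by simp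
      qed
      then show "\<exists>V. V a = v \<and> (\<forall>t\<in>{a..b}. parallel_at {a..b} V t)" using Va by blast
    qed
    moreover have "d > 0" using \<delta>(1) K(1) by (simp add: d_def)
    ultimately show "\<exists>d>0. \<forall>a b. a \<le> x \<and> x \<le> b \<and> b - a < d \<longrightarrow> P a b" by blast
  qed simp
  then show ?thesis using v that unfolding P_def by force
qed

text \<open>Justifies the \<open>THE\<close>: the difference of two parallel fields with the same
  initial vector is parallel and starts at 0, so it ends at 0.\<close>

lemma parallel_transport_eq:
  assumes V: "parallel_along M nab \<gamma> V"
  shows "parallel_transport M nab \<gamma> (V 0) = V 1"
proof -
  have T: "V 0 \<in> tangent_space M (\<gamma> 0)" using V by (simp add: parallel_along_def)
  have "(THE w. \<exists>W. parallel_along M nab \<gamma> W \<and> W 0 = V 0 \<and> W 1 = w) = V 1"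
  proof (rule the_equality)
    fix w assume "\<exists>W. parallel_along M nab \<gamma> W \<and> W 0 = V 0 \<and> W 1 = w"
    then obtain W where W: "parallel_along M nab \<gamma> W" "W 0 = V 0" "W 1 = w" by blast
    have par: "parallel_at {0..1} U t" if "parallel_along M nab \<gamma> U" "t \<in> {0..1}" for U t
      using that parallel_along_iff by blast
    have "(\<lambda>f. W 1 f + (-1) * V 1 f) = (\<lambda>f. 0)"
    proof (rule parallel_zero[where V = "\<lambda>t f. W t f + (-1) * V t f"])
      fix t :: real assume t: "t \<in> {0..1}"
      show "parallel_at {0..1} (\<lambda>t f. W t f + (-1) * V t f) t"
        unfolding parallel_at_def frame_parallel_def
      proof (intro conjI allI impI)
        show "(\<lambda>f. W t f + (-1) * V t f) \<in> tangent_space M (\<gamma> t)"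
          using par[OF V t] par[OF W(1) t] by (intro tangent_space_add tangent_space_cmult) (auto
              simp: parallel_at_def)
        fix N E \<xi> j assume F: "local_frame M N E \<xi> \<and> \<gamma> t \<in> N"
        have "((\<lambda>s. W s (\<xi> j) + (-1) * V s (\<xi> j)) has_real_derivative
            - (\<Sum>l\<in>UNIV. W t (\<xi> l) * christoffel E \<xi> j l t) + (-1) * - (\<Sum>l\<in>UNIV. V t (\<xi> l) *
                christoffel E \<xi> j l t)) (at t within {0..1})"
          using par[OF V t] par[OF W(1) t] F
          by (intro DERIV_add DERIV_cmult) (auto simp: parallel_at_def frame_parallel_def)
        moreover have "- (\<Sum>l\<in>UNIV. W t (\<xi> l) * christoffel E \<xi> j l t) + (-1) * - (\<Sum>l\<in>UNIV. V t (\<xi>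
            l) * christoffel E \<xi> j l t) =
            - (\<Sum>l\<in>UNIV. (W t (\<xi> l) + (-1) * V t (\<xi> l)) * christoffel E \<xi> j l t)"
          by (simp add: left_diff_distrib sum_subtractf)
        ultimately show "((\<lambda>s. W s (\<xi> j) + (-1) * V s (\<xi> j)) has_real_derivative
            - (\<Sum>l\<in>UNIV. (W t (\<xi> l) + (-1) * V t (\<xi> l)) * christoffel E \<xi> j l t)) (at t within
                {0..1})"
          by (simp only:)
      qed
    qed (simp add: W(2))
    then show "w = V 1" using W(3) by (auto simp: fun_eq_iff)
  qed (use V in blast)
  then show ?thesis using T by (simp add: parallel_transport_def)
qed

lemma parallel_along_exists:
  assumes "v \<in> tangent_space M (\<gamma> 0)"
  obtains V where "parallel_along M nab \<gamma> V" "V 0 = v"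
  using parallel_exists[OF assms] parallel_along_iff by metis

end

end

section \<open>Transport of Wagner connections\<close>

context related_connections begin

lemma smooth_path_push:
  assumes "smooth_path M \<gamma>"
  shows "smooth_path M (\<Psi> \<circ> \<gamma>)"
proof -
  obtain S where S: "open S" "{0..1} \<subseteq> S" "continuous_on S \<gamma>"
    "\<And>f. f \<in> smooth_funs M \<Longrightarrow> smooth_on S (f \<circ> \<gamma>)" by (rule C.path_domain[OF assms]) (rule that)
  have c: "continuous_on S (\<Psi> \<circ> \<gamma>)"
    by (rule continuous_on_compose[OF S(3) continuous_on_subset[OF cont(1)]]) simp
  have "smooth_on {t \<in> S. (\<Psi> \<circ> \<gamma>) t \<in> U} (x \<circ> (\<Psi> \<circ> \<gamma>))" if "(U, x) \<in> M" for U x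
    by (rule path_smooth_charts[OF S(1) c _ that]) (use S(4)[OF smooth_comp(1)] in \<open>simp add:
        comp_assoc\<close>)
  then show ?thesis unfolding smooth_path_def using S(1,2) c by blast
qed

lemma velocity_push: "velocity M (\<Psi> \<circ> \<gamma>) t = push \<Psi> (velocity M \<gamma> t)"
  by (auto simp: velocity_def push_def fun_eq_iff smooth_comp_iff comp_assoc)

text \<open>A representation of \<open>V\<close> by fields \<open>Y i\<close> is pushed term by
  term. The extension \<open>X'\<close> of the new velocity need not be the image of
  \<open>X\<close>, but the two agree at \<open>\<Psi> a\<close>, which is enough by
  tensoriality.\<close>

lemma parallel_along_push:
  assumes path: "smooth_path M \<gamma>" and V: "parallel_along M nab \<gamma> V"
  shows "parallel_along M nab' (\<Psi> \<circ> \<gamma>) (\<lambda>t. push \<Psi> (V t))"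
  unfolding parallel_along_def
proof
  let ?P = "push_vfield \<Psi> \<Theta>"
  fix t :: real assume t: "t \<in> {0..1}"
  define a where "a = \<gamma> t"
  define X where "X = extend M a (velocity M \<gamma> t)"
  define X' where "X' = extend M (\<Psi> a) (velocity M (\<Psi> \<circ> \<gamma>) t)"
  have X: "X \<in> vfields M" "X a = velocity M \<gamma> t"
    using C.vel_tangent[OF path t] extend_vfield extend_at by (auto simp: X_def a_def)
  have X': "X' \<in> vfields M" "X' (\<Psi> a) = velocity M (\<Psi> \<circ> \<gamma>) t"
    using C'.vel_tangent[OF smooth_path_push[OF path] t] extend_vfield extend_at
        by (auto simp: X'_def a_def)
  have VT: "V t \<in> tangent_space M a" and "has_cov_deriv_along M nab \<gamma> V t (\<lambda>f. 0)"
    using V t unfolding parallel_along_def a_def by auto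
  then obtain Y :: "'n \<Rightarrow> 'm vfield" and c c' \<delta> where Y: "\<And>i. Y i \<in> vfields M"
    and c: "\<And>i. (c i has_real_derivative c' i) (at t within {0..1})"
    and \<delta>: "\<delta> > 0" "\<And>s. s \<in> {0..1} \<Longrightarrow> \<bar>s - t\<bar> < \<delta> \<Longrightarrow> V s = (\<lambda>f. \<Sum>i\<in>UNIV. c i s * Y i (\<gamma> s) f)"
    and w: "(\<lambda>f. 0) = (\<lambda>f. \<Sum>i\<in>UNIV. c' i * Y i a f + c i t * nab X (Y i) a f)"
    unfolding has_cov_deriv_along_def X_def a_def by blast
  have "nab' X' (?P (Y i)) (\<Psi> a) f = nab X (Y i) a (f \<circ> \<Psi>)" for i f
  proof -
    have "X' (\<Psi> a) = ?P X (\<Psi> a)" using X'(2) X(2) velocity_push by simp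
    then have "nab' X' (?P (Y i)) (\<Psi> a) f = nab' (?P X) (?P (Y i)) (\<Psi> a) f"
      by (rule C'.conn_tensorial1[OF X'(1) push_vfields[OF X(1)] _ push_vfields[OF Y]])
    then show ?thesis using related X(1) Y by (simp add: related_conns_def push_def)
  qed
  then have z: "(\<lambda>f. 0) = (\<lambda>f. \<Sum>i\<in>UNIV. c' i * ?P (Y i) (\<Psi> a) f + c i t * nab' X' (?P (Y i)) (\<Psi> a)
      f)"
    using fun_cong[OF w, of "_ \<circ> \<Psi>"] by (intro ext) (simp add: push_def)
  have rep: "push \<Psi> (V s) = (\<lambda>f. \<Sum>i\<in>UNIV. c i s * ?P (Y i) ((\<Psi> \<circ> \<gamma>) s) f)"
    if "s \<in> {0..1}" "\<bar>s - t\<bar> < \<delta>" for s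
    using \<delta>(2)[OF that] by (simp add: push_def fun_eq_iff)
  have "has_cov_deriv_along M nab' (\<Psi> \<circ> \<gamma>) (\<lambda>t. push \<Psi> (V t)) t (\<lambda>f. 0)"
    unfolding has_cov_deriv_along_def comp_apply a_def[symmetric] X'_def[symmetric]
    by (intro exI[of _ "\<lambda>i. ?P (Y i)"] exI[of _ c] exI[of _ c'] conjI allI push_vfields Y c exI[of
        _ \<delta>] \<delta>(1) z
        ballI impI rep[unfolded comp_apply])
  then show "push \<Psi> (V t) \<in> tangent_space M ((\<Psi> \<circ> \<gamma>) t) \<and>
      has_cov_deriv_along M nab' (\<Psi> \<circ> \<gamma>) (\<lambda>t. push \<Psi> (V t)) t (\<lambda>f. 0)"
    using push_tangent[OF VT] by (simp add: a_def)
qed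

text \<open>Existence supplies a parallel field \<open>V\<close> starting at \<open>v\<close>;
  uniqueness, for both connections, identifies the endpoints of \<open>V\<close> and of its image as
  the two transports.\<close>

lemma parallel_transport_push:
  assumes path: "smooth_path M \<gamma>" and v: "v \<in> tangent_space M (\<gamma> 0)"
  shows "parallel_transport M nab' (\<Psi> \<circ> \<gamma>) (push \<Psi> v) = push \<Psi> (parallel_transport M nab \<gamma> v)"
proof -
  obtain V where V: "parallel_along M nab \<gamma> V" "V 0 = v"
      using C.parallel_along_exists[OF path v] by metis
  show ?thesis
    using C'.parallel_transport_eq[OF smooth_path_push[OF path] parallel_along_push[OF path V(1)]]
      C.parallel_transport_eq[OF path V(1)] V(2) by simp
qed

end

section \<open>Conjugation of connections by elements of the pseudogroup\<close>

definition conj_conn :: "('m \<Rightarrow> 'm) \<Rightarrow> ('m \<Rightarrow> 'm) \<Rightarrow> 'm conn \<Rightarrow> 'm conn" where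
  "conj_conn \<Psi> \<Theta> nab X Y = push_vfield \<Psi> \<Theta> (nab (push_vfield \<Theta> \<Psi> X) (push_vfield \<Theta> \<Psi> Y))"

context manifold begin

text \<open>Compositions with \<open>\<phi>\<close> exist near \<open>a\<close> only, so each is
  represented by a global function with the same germ. The derivation laws of \<open>v\<close> on
  the representatives pass to the differential, germs being compared on a common
  neighbourhood.\<close>

lemma differential_tangent:
  assumes \<phi>: "smooth_pmap M \<phi>" "\<phi> a = Some b" and v: "v \<in> tangent_space M a"
  shows "differential M \<phi> a v \<in> tangent_space M b"
proof -
  let ?d = "differential M \<phi> a v"
  have rep: "\<exists>g W. g \<in> smooth_funs M \<and> open W \<and> a \<in> W \<and> (\<forall>p\<in>W. g p = f (the (\<phi> p)))"
    if f: "f \<in> smooth_funs M" for f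
  proof -
    have "a \<in> dom \<phi>" using \<phi>(2) by blast
    from local_pullback[OF \<phi>(1) f this] show ?thesis by metis
  qed
  have d: "?d f = v g" if "f \<in> smooth_funs M" "g \<in> smooth_funs M" "open W" "a \<in> W" "\<And>p. p \<in> W \<Longrightarrow> g
      p = f (the (\<phi> p))" for f g W
    by (rule differential_eq[OF v that])
  show ?thesis
    unfolding tangent_space_def
  proof (intro CollectI conjI ballI allI impI)
    fix f assume f: "f \<in> smooth_funs M"
    obtain f' W where f': "f' \<in> smooth_funs M" "open W" "a \<in> W" "\<forall>p\<in>W. f' p = f (the (\<phi> p))"
        using rep[OF f] by blast
    have df: "?d f = v f'" by (rule d[OF f f'(1-3)]) (use f'(4) in blast)
    show "?d (\<lambda>p. c * f p) = c * ?d f" for c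
      using d[OF smooth_cmult[OF f] smooth_cmult[OF f'(1)] f'(2,3), of c c] f'(4) df
          tangent_cmult[OF v f'(1)] by simp
    fix g assume g: "g \<in> smooth_funs M"
    obtain g' W' where g': "g' \<in> smooth_funs M" "open W'" "a \<in> W'" "\<forall>p\<in>W'. g' p = g (the (\<phi> p))"
        using rep[OF g] by blast
    have dg: "?d g = v g'" by (rule d[OF g g'(1-3)]) (use g'(4) in blast)
    have W: "open (W \<inter> W')" "a \<in> W \<inter> W'" using f' g' by auto
    show "?d (\<lambda>p. f p + g p) = ?d f + ?d g"
      using d[OF smooth_add[OF f g] smooth_add[OF f'(1) g'(1)] W] f'(4) g'(4) df dg tangent_add[OF
          v f'(1) g'(1)] by simp
    have "f' a = f b" "g' a = g b" using f'(3,4) g'(3,4) \<phi>(2) by auto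
    then show "?d (\<lambda>p. f p * g p) = f b * ?d g + g b * ?d f"
      using d[OF smooth_mult[OF f g] smooth_mult[OF f'(1) g'(1)] W] f'(4) g'(4) df dg
          tangent_mult[OF v f'(1) g'(1)] by simp
  next
    fix f assume "f \<notin> smooth_funs M"
    then show "?d f = 0" using v by (simp add: differential_def)
  qed
qed

lemma differential_add:
  assumes "v \<in> tangent_space M a" "w \<in> tangent_space M a"
  shows "differential M \<phi> a (\<lambda>f. v f + w f) = (\<lambda>f. differential M \<phi> a v f + differential M \<phi> a w f)"
  using assms tangent_space_add[OF assms] by (auto simp: differential_def fun_eq_iff)

lemma differential_cmult:
  assumes "v \<in> tangent_space M a"
  shows "differential M \<phi> a (\<lambda>f. c * v f) = (\<lambda>f. c * differential M \<phi> a v f)"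
  using assms tangent_space_cmult[OF assms] by (auto simp: differential_def fun_eq_iff)

lemma pullback_cotangent:
  assumes "smooth_pmap M \<phi>" "\<phi> a = Some b" "\<eta> \<in> cotangent_space M b"
  shows "(\<lambda>v. if v \<in> tangent_space M a then \<eta> (differential M \<phi> a v) else 0) \<in> cotangent_space M a"
  unfolding cotangent_space_def[of M a]
  using differential_tangent[OF assms(1,2)] lin_add[OF cotangent_lin[OF assms(3)]] lin_cmult[OF
      cotangent_lin[OF assms(3)]]
  by (auto simp: tangent_space_add tangent_space_cmult differential_add differential_cmult)

end

context diffeo begin

lemma conj_conn_affine:
  assumes "affine_connection M nab"
  shows "affine_connection M (conj_conn \<Psi> \<Theta> nab)"
proof -
  interpret C: connection M nab using assms by unfold_locales
  interpret I: diffeo M \<Theta> \<Psi> by (rule inverse_diffeo)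
  let ?Q = "push_vfield \<Theta> \<Psi>"
  have Q: "?Q X \<in> vfields M" if "X \<in> vfields M" for X using I.push_vfields[OF that] .
  have add: "?Q (\<lambda>a h. X a h + X' a h) = (\<lambda>a h. ?Q X a h + ?Q X' a h)" for X X' :: "'m vfield"
    by (simp add: push_vfield_def push_def fun_eq_iff)
  have mult: "?Q (\<lambda>a h. f a * X a h) = (\<lambda>a h. (f \<circ> \<Psi>) a * ?Q X a h)" for f and X :: "'m vfield"
    by (simp add: push_vfield_def push_def fun_eq_iff)
  show ?thesis
    unfolding affine_connection_def conj_conn_def
  proof (intro conjI ballI)
    fix X Y assume X: "X \<in> vfields M" and Y: "Y \<in> vfields M"
    show "push_vfield \<Psi> \<Theta> (nab (?Q X) (?Q Y)) \<in> vfields M"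
      by (intro push_vfields C.conn_vfield Q X Y)
    fix X' assume X': "X' \<in> vfields M"
    show "push_vfield \<Psi> \<Theta> (nab (?Q (\<lambda>a h. X a h + X' a h)) (?Q Y)) =
        (\<lambda>a h. push_vfield \<Psi> \<Theta> (nab (?Q X) (?Q Y)) a h + push_vfield \<Psi> \<Theta> (nab (?Q X') (?Q Y)) a h)"
      unfolding add C.conn_add1[OF Q[OF X] Q[OF X'] Q[OF Y]]
          by (simp add: push_vfield_def push_def fun_eq_iff)
  next
    fix f X Y assume f: "f \<in> smooth_funs M" and X: "X \<in> vfields M" and Y: "Y \<in> vfields M"
    show "push_vfield \<Psi> \<Theta> (nab (?Q (\<lambda>a h. f a * X a h)) (?Q Y)) =
        (\<lambda>a h. f a * push_vfield \<Psi> \<Theta> (nab (?Q X) (?Q Y)) a h)"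
      unfolding mult C.conn_fmult1[OF smooth_comp(1)[OF f] Q[OF X] Q[OF Y]]
          by (simp add: push_vfield_def push_def fun_eq_iff)
    show "push_vfield \<Psi> \<Theta> (nab (?Q X) (?Q (\<lambda>a h. f a * Y a h))) =
        (\<lambda>a h. X a f * Y a h + f a * push_vfield \<Psi> \<Theta> (nab (?Q X) (?Q Y)) a h)"
      unfolding mult C.conn_fmult2[OF smooth_comp(1)[OF f] Q[OF X] Q[OF Y]]
      by (simp add: push_vfield_def push_def fun_eq_iff)
  next
    fix X Y Y' assume X: "X \<in> vfields M" and Y: "Y \<in> vfields M" and Y': "Y' \<in> vfields M"
    show "push_vfield \<Psi> \<Theta> (nab (?Q X) (?Q (\<lambda>a h. Y a h + Y' a h))) =
        (\<lambda>a h. push_vfield \<Psi> \<Theta> (nab (?Q X) (?Q Y)) a h + push_vfield \<Psi> \<Theta> (nab (?Q X) (?Q Y')) a h)"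
      unfolding add C.conn_add2[OF Q[OF X] Q[OF Y] Q[OF Y']]
          by (simp add: push_vfield_def push_def fun_eq_iff)
  qed
qed

lemma related_conj_conn: "related_conns M \<Psi> \<Theta> nab (conj_conn \<Psi> \<Theta> nab)"
  by (simp add: related_conns_def conj_conn_def)

end

text \<open>The bridge from partial to total maps: an element of \<open>\<Gamma>\<close> with full
  domain and range yields the pair \<open>\<Psi>\<close>, \<open>\<Theta>\<close> to which the
  theory of \<open>diffeo\<close> applies.\<close>

locale pseudogroup_diffeo = manifold M
  for M :: "('m::{t2_space,second_countable_topology}, 'n::finite) atlas" +
  fixes \<Gamma> :: "('m \<rightharpoonup> 'm) set" and \<psi> :: "'m \<rightharpoonup> 'm"
  assumes pseudogroup: "pseudogroup M \<Gamma>" and \<psi>: "\<psi> \<in> global_diffeos \<Gamma>"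
begin

definition \<Psi> :: "'m \<Rightarrow> 'm" where "\<Psi> = the \<circ> \<psi>"
definition \<Theta> :: "'m \<Rightarrow> 'm" where "\<Theta> = the \<circ> pinv \<psi>"

lemma psi_total: "\<psi> \<in> \<Gamma>" "dom \<psi> = UNIV" "ran \<psi> = UNIV"
  using \<psi> by (auto simp: global_diffeos_def)

lemma pseudogroup_closed:
  "\<forall>\<phi>\<in>\<Gamma>. local_diffeo M \<phi>" "\<forall>\<phi>\<in>\<Gamma>. \<forall>\<phi>'\<in>\<Gamma>. \<phi>' \<circ>\<^sub>m \<phi> \<in> \<Gamma>" "\<forall>\<phi>\<in>\<Gamma>. pinv \<phi> \<in> \<Gamma>"
proof -
  note * = pseudogroup[unfolded pseudogroup_def]
  show "\<forall>\<phi>\<in>\<Gamma>. local_diffeo M \<phi>" using * by (elim conjE)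
  show "\<forall>\<phi>\<in>\<Gamma>. \<forall>\<phi>'\<in>\<Gamma>. \<phi>' \<circ>\<^sub>m \<phi> \<in> \<Gamma>" using * by (elim conjE)
  show "\<forall>\<phi>\<in>\<Gamma>. pinv \<phi> \<in> \<Gamma>" using * by (elim conjE)
qed

lemma pseudogroup_local_diffeo: "\<phi> \<in> \<Gamma> \<Longrightarrow> local_diffeo M \<phi>"
  and pseudogroup_comp: "\<phi> \<in> \<Gamma> \<Longrightarrow> \<phi>' \<in> \<Gamma> \<Longrightarrow> \<phi>' \<circ>\<^sub>m \<phi> \<in> \<Gamma>"
  and pseudogroup_pinv: "\<phi> \<in> \<Gamma> \<Longrightarrow> pinv \<phi> \<in> \<Gamma>"
  by (simp_all add: pseudogroup_closed)

lemma psi_eq: "\<psi> p = Some (\<Psi> p)"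
proof -
  have "p \<in> dom \<psi>" using psi_total(2) by simp
  then show ?thesis by (auto simp: \<Psi>_def)
qed

lemma psi_inj: "\<Psi> p = \<Psi> q \<Longrightarrow> p = q"
  using pseudogroup_local_diffeo[OF psi_total(1)] psi_total(2) psi_eq
  by (auto simp: local_diffeo_def inj_on_def)

lemma pinv_psi: "pinv \<psi> (\<Psi> p) = Some p"
proof -
  have "(THE a. \<psi> a = Some (\<Psi> p)) = p" by (rule the_equality) (auto simp: psi_eq dest: psi_inj)
  then show ?thesis using psi_total(3) by (simp add: pinv_def)
qed

lemma psi_surj: "\<exists>p. q = \<Psi> p"
proof -
  have "q \<in> ran \<psi>" using psi_total(3) by simp
  then show ?thesis using psi_eq by (auto simp: ran_def)
qed

lemma pinv_eq: "pinv \<psi> q = Some (\<Theta> q)"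
  using psi_surj[of q] pinv_psi by (auto simp: \<Theta>_def)

lemma smooth_pmap_total:
  assumes "smooth_pmap M \<phi>" "\<And>p. \<phi> p = Some (h p)"
  shows "f \<in> smooth_funs M \<Longrightarrow> f \<circ> h \<in> smooth_funs M" "continuous_on UNIV h"
proof -
  have dom: "dom \<phi> = UNIV" using assms(2) by auto
  show "f \<circ> h \<in> smooth_funs M" if "f \<in> smooth_funs M"
    using smooth_pmap_pullback[OF assms(1) that] assms(2) dom
        by (simp add: smooth_near_UNIV comp_def)
  show "continuous_on UNIV h"
    using assms dom by (simp add: smooth_pmap_def comp_def)
qed

sublocale diffeo M \<Psi> \<Theta>
proof unfold_locales
  have s: "smooth_pmap M \<psi>" "smooth_pmap M (pinv \<psi>)"
    using pseudogroup_local_diffeo[OF psi_total(1)] by (auto simp: local_diffeo_def)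
  show "\<Theta> (\<Psi> p) = p" for p by (simp add: \<Theta>_def pinv_psi)
  then show "\<Psi> (\<Theta> p) = p" for p using psi_surj[of p] by auto
  show "f \<circ> \<Psi> \<in> smooth_funs M" "f \<circ> \<Theta> \<in> smooth_funs M" if "f \<in> smooth_funs M" for f
    using smooth_pmap_total(1)[OF s(1) psi_eq that] smooth_pmap_total(1)[OF s(2) pinv_eq that] by
        auto
  show "continuous_on UNIV \<Psi>" "continuous_on UNIV \<Theta>"
    using smooth_pmap_total(2)[OF s(1) psi_eq] smooth_pmap_total(2)[OF s(2) pinv_eq] by auto
qed

lemma differential_psi: "differential M \<psi> a = (\<lambda>v\<in>tangent_space M a. push \<Psi> v)"
proof
  fix v
  show "differential M \<psi> a v = (\<lambda>v\<in>tangent_space M a. push \<Psi> v) v"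
  proof (cases "v \<in> tangent_space M a")
    case v: True
    have "differential M \<psi> a v f = push \<Psi> v f" for f
    proof (cases "f \<in> smooth_funs M")
      case True
      show ?thesis
        using differential_eq[OF v True smooth_comp(1)[OF True] open_UNIV, of \<psi>]
            by (simp add: psi_eq push_def)
    next
      case False
      then show ?thesis
        using v tangent_outside[OF v, of "f \<circ> \<Psi>"] smooth_comp_iff
            by (simp add: differential_def push_def)
    qed
    then show ?thesis using v by (simp add: fun_eq_iff)
  qed (simp add: differential_def)
qed

lemma push_field_eq: "push_field M \<psi> H = push_contra H"
  by (rule ext) (simp add: push_field_def push_contra_def differential_psi pinv_eq Let_def)

lemma push_oper_eq: "push_oper \<psi> A f = push_op \<Psi> \<Theta> A f"
  by (simp add: push_oper_def push_op_def \<Psi>_def \<Theta>_def)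

text \<open>The chain rule, with germs instead of functions: a global representative
  \<open>g\<close> of the germ of f \<circ> \<Psi> \<circ> \<phi> at \<open>a\<close> gives,
  composed with \<open>\<Theta>\<close>, a representative of the germ needed at
  \<open>\<Psi> a\<close>.\<close>

lemma differential_conj:
  assumes \<phi>: "\<phi> \<in> \<Gamma>" "\<phi> a = Some c" and w: "w \<in> tangent_space M (\<Psi> a)"
  shows "differential M (\<psi> \<circ>\<^sub>m \<phi> \<circ>\<^sub>m pinv \<psi>) (\<Psi> a) w = push \<Psi> (differential M \<phi> a (push \<Theta> w))"
proof
  fix f
  have w': "push \<Theta> w \<in> tangent_space M a" using push_tangent'[OF w] .
  show "differential M (\<psi> \<circ>\<^sub>m \<phi> \<circ>\<^sub>m pinv \<psi>) (\<Psi> a) w f = push \<Psi> (differential M \<phi> a (push \<Theta> w)) f"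
  proof (cases "f \<in> smooth_funs M")
    case f: True
    have s: "smooth_pmap M \<phi>" using pseudogroup_local_diffeo[OF \<phi>(1)]
        by (simp add: local_diffeo_def)
    have a: "a \<in> dom \<phi>" using \<phi>(2) by blast
    obtain g W where g: "g \<in> smooth_funs M" "open W" "a \<in> W" "W \<subseteq> dom \<phi>" "\<And>p. p \<in> W \<Longrightarrow> g p = (f \<circ>
        \<Psi>) (the (\<phi> p))"
      by (rule local_pullback[OF s smooth_comp(1)[OF f] a]) (rule that)
    have W: "open (\<Theta> -` W)" using continuous_open_vimage[OF g(2)] cont(2)
        continuous_on_eq_continuous_at by blast
    have "differential M (\<psi> \<circ>\<^sub>m \<phi> \<circ>\<^sub>m pinv \<psi>) (\<Psi> a) w f = w (g \<circ> \<Theta>)"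
    proof (rule differential_eq[OF w f smooth_comp(2)[OF g(1)] W])
      fix q assume q: "q \<in> \<Theta> -` W"
      then obtain r where "\<phi> (\<Theta> q) = Some r" using g(4) by auto
      then show "(g \<circ> \<Theta>) q = f (the ((\<psi> \<circ>\<^sub>m \<phi> \<circ>\<^sub>m pinv \<psi>) q))"
        using g(5)[of "\<Theta> q"] q by (simp add: map_comp_def pinv_eq psi_eq)
    qed (simp add: g(3))
    also have "\<dots> = push \<Psi> (differential M \<phi> a (push \<Theta> w)) f"
    proof -
      have "differential M \<phi> a (push \<Theta> w) (f \<circ> \<Psi>) = push \<Theta> w g"
        by (rule differential_eq[OF w' smooth_comp(1)[OF f] g(1-3,5)])
      then show ?thesis unfolding push_def[of \<Psi>] by (simp only: push_def)
    qed
    finally show ?thesis .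
  next
    case False
    then show ?thesis using w w' smooth_comp_iff by (simp add: differential_def push_def)
  qed
qed

text \<open>Transport along \<open>\<gamma>\<close> for the conjugate connection is the conjugate of
  a transport along \<open>\<Theta> \<circ> \<gamma>\<close>. The latter is the differential of some
  \<open>\<phi>\<close> in \<open>\<Gamma>\<close>, so the former is that of
  \<open>\<psi> \<circ>\<^sub>m \<phi> \<circ>\<^sub>m pinv \<psi>\<close>. The other two
  conclusions are recorded for the transport of tensors.\<close>

lemma gamma_connection_conj:
  assumes G: "gamma_connection M \<Gamma> nab"
  shows "gamma_connection M \<Gamma> (conj_conn \<Psi> \<Theta> nab)"
    "\<And>\<gamma>. smooth_path M \<gamma> \<Longrightarrow> smooth_path M (\<Theta> \<circ> \<gamma>)"
    "\<And>\<gamma> w. smooth_path M \<gamma> \<Longrightarrow> w \<in> tangent_space M (\<gamma> 0) \<Longrightarrow>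
      parallel_transport M (conj_conn \<Psi> \<Theta> nab) \<gamma> w = push \<Psi> (parallel_transport M nab (\<Theta> \<circ> \<gamma>)
          (push \<Theta> w))"
proof -
  have aff: "affine_connection M nab" using G by (simp add: gamma_connection_def)
  interpret R: related_connections M \<Psi> \<Theta> nab "conj_conn \<Psi> \<Theta> nab"
    by unfold_locales (use aff conj_conn_affine related_conj_conn in auto)
  \<comment> \<open>The interpretation for the inverse serves only to show that
    \<open>\<Theta> \<circ> \<gamma>\<close> is a smooth path.\<close>
  interpret R': related_connections M \<Theta> \<Psi> nab "conj_conn \<Theta> \<Psi> nab"
    using inverse_diffeo diffeo.conj_conn_affine[OF inverse_diffeo aff]
        diffeo.related_conj_conn[OF inverse_diffeo]
    by (intro related_connections.intro related_connections_axioms.intro connection.intro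
        connection_axioms.intro aff manifold_axioms) auto
  show path: "smooth_path M (\<Theta> \<circ> \<gamma>)" if "smooth_path M \<gamma>" for \<gamma> using R'.smooth_path_push[OF that] .
  show PT: "parallel_transport M (conj_conn \<Psi> \<Theta> nab) \<gamma> w = push \<Psi> (parallel_transport M nab (\<Theta> \<circ>
      \<gamma>) (push \<Theta> w))"
    if \<gamma>: "smooth_path M \<gamma>" and w: "w \<in> tangent_space M (\<gamma> 0)" for \<gamma> w
  proof -
    have "push \<Theta> w \<in> tangent_space M ((\<Theta> \<circ> \<gamma>) 0)" using push_tangent'[of w "\<Theta> (\<gamma> 0)"] w by simp
    moreover have "\<Psi> \<circ> (\<Theta> \<circ> \<gamma>) = \<gamma>" by (simp add: fun_eq_iff)
    ultimately show ?thesis using R.parallel_transport_push[OF path[OF \<gamma>], of "push \<Theta> w"] by simp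
  qed
  have "parallel_transport M (conj_conn \<Psi> \<Theta> nab) \<gamma> \<in> linear_isotropy M \<Gamma> (\<gamma> 0) (\<gamma> 1)" if \<gamma>:
      "smooth_path M \<gamma>" for \<gamma>
  proof -
    obtain \<phi> where \<phi>: "\<phi> \<in> \<Gamma>" "\<phi> (\<Theta> (\<gamma> 0)) = Some (\<Theta> (\<gamma> 1))"
      "parallel_transport M nab (\<Theta> \<circ> \<gamma>) = differential M \<phi> (\<Theta> (\<gamma> 0))"
      using G path[OF \<gamma>] by (auto simp: gamma_connection_def linear_isotropy_def)
    let ?c = "\<psi> \<circ>\<^sub>m \<phi> \<circ>\<^sub>m pinv \<psi>"
    have "?c \<in> \<Gamma>" using \<phi>(1) psi_total(1) by (intro pseudogroup_comp pseudogroup_pinv)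
    moreover have "?c (\<gamma> 0) = Some (\<gamma> 1)" using \<phi>(2) by (simp add: map_comp_def pinv_eq psi_eq)
    moreover have "parallel_transport M (conj_conn \<Psi> \<Theta> nab) \<gamma> = differential M ?c (\<gamma> 0)"
    proof
      fix w
      show "parallel_transport M (conj_conn \<Psi> \<Theta> nab) \<gamma> w = differential M ?c (\<gamma> 0) w"
      proof (cases "w \<in> tangent_space M (\<gamma> 0)")
        case True
        then show ?thesis using PT[OF \<gamma> True] differential_conj[OF \<phi>(1,2), of w] \<phi>(3) by simp
      qed (simp add: parallel_transport_def differential_def)
    qed
    ultimately show ?thesis unfolding linear_isotropy_def by blast
  qed
  then show "gamma_connection M \<Gamma> (conj_conn \<Psi> \<Theta> nab)"
    using conj_conn_affine[OF aff] by (simp add: gamma_connection_def)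
qed

text \<open>The core is the commuting square \<open>eq\<close> of pullbacks of covectors, dual to
  the formula for the transport. Membership in cotangent spaces must be carried along because
  \<open>act\<close> is 0 on other arguments; it holds since all maps involved are differentials of
  elements of \<open>\<Gamma>\<close>.\<close>

lemma preserves_conj:
  assumes G: "gamma_connection M \<Gamma> nab" and H: "preserves M nab H"
  shows "preserves M (conj_conn \<Psi> \<Theta> nab) (push_contra H)"
  unfolding preserves_def
proof (intro allI impI ext)
  fix \<gamma> \<eta>s assume \<gamma>: "smooth_path M \<gamma>"
  note path = gamma_connection_conj(2)[OF G \<gamma>] and PT = gamma_connection_conj(3)[OF G \<gamma>]
  let ?T' = "parallel_transport M (conj_conn \<Psi> \<Theta> nab) \<gamma>" and ?T = "parallel_transport M nab (\<Theta> \<circ> \<gamma>)"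
  define a where "a = \<Theta> (\<gamma> 0)"
  define b where "b = \<Theta> (\<gamma> 1)"
  have ab: "\<gamma> 0 = \<Psi> a" "\<gamma> 1 = \<Psi> b" by (simp_all add: a_def b_def)
  obtain \<phi> where \<phi>: "\<phi> \<in> \<Gamma>" "\<phi> a = Some b" "?T = differential M \<phi> a"
    using G path by (auto simp: gamma_connection_def linear_isotropy_def a_def b_def)
  obtain \<phi>' where \<phi>': "\<phi>' \<in> \<Gamma>" "\<phi>' (\<gamma> 0) = Some (\<gamma> 1)" "?T' = differential M \<phi>' (\<gamma> 0)"
    using gamma_connection_conj(1)[OF G] \<gamma> by (auto simp: gamma_connection_def linear_isotropy_def)
  have s: "smooth_pmap M \<phi>" "smooth_pmap M \<phi>'" "smooth_pmap M \<psi>"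
    using pseudogroup_local_diffeo \<phi>(1) \<phi>'(1) psi_total(1) by (auto simp: local_diffeo_def)
  have T: "?T v \<in> tangent_space M b" if "v \<in> tangent_space M a" for v
    using differential_tangent[OF s(1) \<phi>(2) that] \<phi>(3) by simp
  show "act M (\<gamma> 0) (\<gamma> 1) ?T' (push_contra H (\<gamma> 0)) \<eta>s = push_contra H (\<gamma> 1) \<eta>s"
  proof (cases "set \<eta>s \<subseteq> cotangent_space M (\<gamma> 1)")
    case True
    let ?r' = "\<lambda>\<eta> v. if v \<in> tangent_space M (\<gamma> 0) then \<eta> (?T' v) else 0"
    let ?r = "\<lambda>\<eta> v. if v \<in> tangent_space M a then \<eta> (?T v) else 0"
    let ?p = "\<lambda>c \<eta> v. if v \<in> tangent_space M c then \<eta> ((\<lambda>v\<in>tangent_space M c. push \<Psi> v) v) else 0"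
    have r': "?r' \<eta> \<in> cotangent_space M (\<gamma> 0)" if "\<eta> \<in> set \<eta>s" for \<eta>
      unfolding \<phi>'(3) by (rule pullback_cotangent[OF s(2) \<phi>'(2)]) (use that True in blast)
    have p: "?p b \<eta> \<in> cotangent_space M b" if "\<eta> \<in> set \<eta>s" for \<eta>
      by (rule pullback_cotangent[OF s(3) psi_eq, unfolded differential_psi]) (use that True ab(2)
          in auto)
    have eq: "?p a (?r' \<eta>) = ?r (?p b \<eta>)" for \<eta>
    proof
      fix v show "?p a (?r' \<eta>) v = ?r (?p b \<eta>) v"
      proof (cases "v \<in> tangent_space M a")
        case v: True
        have "push \<Psi> v \<in> tangent_space M (\<gamma> 0)" using push_tangent[OF v] ab(1) by simp
        then show ?thesis using v PT T[OF v] by simp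
      qed simp
    qed
    have "act M (\<gamma> 0) (\<gamma> 1) ?T' (push_contra H (\<gamma> 0)) \<eta>s = push_contra H (\<gamma> 0) (map ?r' \<eta>s)"
      using True by (simp add: act_def)
    also have "\<dots> = H a (map (?p a) (map ?r' \<eta>s))"
      unfolding push_contra_def act_def a_def[symmetric] using r' by auto
    also have "map (?p a) (map ?r' \<eta>s) = map ?r (map (?p b) \<eta>s)"
      unfolding map_map by (rule map_cong[OF refl]) (simp only: comp_apply[of "?p a" ?r']
          comp_apply[of ?r "?p b"] eq)
    also have "H a (map ?r (map (?p b) \<eta>s)) = act M a b ?T (H a) (map (?p b) \<eta>s)"
      unfolding act_def using p by auto
    also have "\<dots> = H b (map (?p b) \<eta>s)"
      using H[unfolded preserves_def, rule_format, OF path] by (simp only: comp_apply a_def b_def)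
    also have "\<dots> = push_contra H (\<gamma> 1) \<eta>s"
      unfolding push_contra_def act_def b_def[symmetric] using True by simp
    finally show ?thesis .
  qed (simp add: act_def push_contra_def)
qed

text \<open>The uniqueness clause of \<open>wagner_connection\<close> for \<open>A2\<close> is
  applied to the conjugate of \<open>nab1\<close>. It gives equality on vector fields only, which is
  all that \<open>related_conns\<close> asks for.\<close>

lemma wagner_related:
  assumes W: "wagner_connection M \<Gamma> k A1 nab1" "wagner_connection M \<Gamma> k A2 nab2"
    and \<sigma>: "push_contra (symbol M k A1) = symbol M k A2"
  shows "related_connections M \<Psi> \<Theta> nab1 nab2"
proof -
  have G: "gamma_connection M \<Gamma> nab1" "gamma_connection M \<Gamma> nab2" "preserves M nab1 (symbol M k A1)"
    using W by (auto simp: wagner_connection_def)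
  have "gamma_connection M \<Gamma> (conj_conn \<Psi> \<Theta> nab1)" by (rule gamma_connection_conj(1)[OF G(1)])
  moreover have "preserves M (conj_conn \<Psi> \<Theta> nab1) (symbol M k A2)"
    using preserves_conj[OF G(1,3)] \<sigma> by simp
  ultimately have eq: "conj_conn \<Psi> \<Theta> nab1 X Y = nab2 X Y" if "X \<in> vfields M" "Y \<in> vfields M" for X Y
    using W(2) that unfolding wagner_connection_def by blast
  have "related_conns M \<Psi> \<Theta> nab1 nab2"
    using related_conj_conn[of nab1] eq push_vfields unfolding related_conns_def by metis
  then show ?thesis
    using G(1,2) by unfold_locales (auto simp: gamma_connection_def)
qed

lemma total_symbol_hd: "total_symbol M nab k A = symbol M k A # tl (total_symbol M nab k A)"
  by (cases k) auto

text \<open>Stated for a fixed \<open>\<psi>\<close>, so that one diffeomorphism serves both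
  directions. Each direction begins by extracting the equality of leading symbols, since only then
  can the two connections be compared.\<close>

lemma push_total_symbol_iff:
  assumes A: "diff_oper M k A1" "diff_oper M k A2"
    and W: "wagner_connection M \<Gamma> k A1 nab1" "wagner_connection M \<Gamma> k A2 nab2"
  shows "(\<forall>f\<in>smooth_funs M. push_oper \<psi> A1 f = A2 f) \<longleftrightarrow>
    map (push_field M \<psi>) (total_symbol M nab1 k A1) = total_symbol M nab2 k A2"
  unfolding push_field_eq push_oper_eq
proof
  assume eq: "\<forall>f\<in>smooth_funs M. push_op \<Psi> \<Theta> A1 f = A2 f"
  have "push_contra (symbol M k A1) = symbol M k A2"
    using push_contra_symbol[OF A(1)] symbol_cong[OF diff_oper_push[OF A(1)], of A2] eq by simp
  then interpret related_connections M \<Psi> \<Theta> nab1 nab2 by (rule wagner_related[OF W])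
  show "map push_contra (total_symbol M nab1 k A1) = total_symbol M nab2 k A2"
    by (rule total_symbol_push[OF A(1)]) (use eq in simp)
next
  assume eq: "map push_contra (total_symbol M nab1 k A1) = total_symbol M nab2 k A2"
  then have "push_contra (symbol M k A1) = symbol M k A2"
    using total_symbol_hd[of nab1 k A1] total_symbol_hd[of nab2 k A2]
        by (metis list.inject list.simps(9))
  then interpret related_connections M \<Psi> \<Theta> nab1 nab2 by (rule wagner_related[OF W])
  \<comment> \<open>Both operators are now described with the same connection \<open>nab2\<close>,
    so that injectivity of the total symbol applies.\<close>
  have "total_symbol M nab2 k (push_op \<Psi> \<Theta> A1) = total_symbol M nab2 k A2"
    using total_symbol_push[OF A(1), of "push_op \<Psi> \<Theta> A1"] eq by simp
  then show "\<forall>f\<in>smooth_funs M. push_op \<Psi> \<Theta> A1 f = A2 f"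
    using C'.total_symbol_inj[OF diff_oper_push[OF A(1)] A(2)] by blast
qed

end

theorem theorem12:
  fixes M :: "('m::{t2_space,second_countable_topology}, 'n::finite) atlas"
    and \<Gamma> :: "('m \<rightharpoonup> 'm) set"
    and A1 A2 :: "'m oper"
    and nab1 nab2 :: "'m conn"
    and k :: nat
  assumes "connected_smooth_manifold M"
    and "lie_pseudogroup M \<Gamma>"
    and "transitive_pseudogroup \<Gamma>"
    and "algebraic_pseudogroup M \<Gamma>"
    and "diff_oper M k A1" and "diff_oper M k A2"
    and "constant_type M \<Gamma> k A1" and "constant_type M \<Gamma> k A2"
    and "\<forall>a. finite (symbol_stabilizer M \<Gamma> k A1 a)"
    and "\<forall>a. finite (symbol_stabilizer M \<Gamma> k A2 a)"
    and "wagner_connection M \<Gamma> k A1 nab1" and "wagner_connection M \<Gamma> k A2 nab2"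
  shows "equiv_opers M \<Gamma> A1 A2 \<longleftrightarrow>
    equiv_total_symbols M \<Gamma> (total_symbol M nab1 k A1) (total_symbol M nab2 k A2)"
proof -
  have "pseudogroup M \<Gamma>" using assms(2) by (simp add: lie_pseudogroup_def regular_pseudogroup_def)
  then have "(\<forall>f\<in>smooth_funs M. push_oper \<psi> A1 f = A2 f) \<longleftrightarrow>
      map (push_field M \<psi>) (total_symbol M nab1 k A1) = total_symbol M nab2 k A2"
    if "\<psi> \<in> global_diffeos \<Gamma>" for \<psi>
    using that assms(1)
    by (intro pseudogroup_diffeo.push_total_symbol_iff[OF _ assms(5,6,11,12)]
        pseudogroup_diffeo.intro manifold.intro pseudogroup_diffeo_axioms.intro)
  then show ?thesis unfolding equiv_opers_def equiv_total_symbols_def by blast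
qed

end
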